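(* Let $d\ge2$ and let $\beta_c$ be the critical inverse temperature of the Ising model on $\mathbb{Z}^d$. For every $\beta\in(0,\infty)$ there exist constants $C_1(\beta)\in(0,\infty)$ and $C_2(\beta)\in[0,\infty)$, with $C_2(\beta)=0$ for $\beta\ge\beta_c$ and $C_2(\beta)>0$ for $\beta<\beta_c$, such that for every external field $\omega:\mathbb{Z}^d\to[-\infty,\infty]$ and all $N\in\mathbb{N}$, $$\langle\sigma_0\rangle_{\Lambda_N,\beta}^{\omega,+}-\langle\sigma_0\rangle_{\Lambda_N,\beta}^{\omega,-}\le\langle\sigma_0\rangle_{\Lambda_N,\beta}^{+}-\langle\sigma_0\rangle_{\Lambda_N,\beta}^{-}\le C_1(\beta)e^{-C_2(\beta)N}.$$
   Context: $\Lambda_N:=[-N,N]^d\cap\mathbb{Z}^d$ and $\partial\Lambda_N:=\{x\in\mathbb{Z}^d\setminus\Lambda_N:|x-y|_1=1\text{ for some }y\in\Lambda_N\}$, where $|\cdot|_1$ is the $\ell^1$ norm. $\langle\cdot\rangle^{\omega,\pm}_{\Lambda_N,\beta}$ denotes expectation with respect to the nearest-neighbour Ising model on $\Lambda_N$ with coupling constants $J\equiv1$, inverse temperature $\beta$, external field $\omega$ and $+$ (resp. $-$) boundary condition: the probability measure on $\sigma\in\{\pm1\}^{\Lambda_N}$ proportional to $$\exp\Big\{\beta\sum_{\{x,y\}}\sigma_x\sigma_y+\sum_{x\in\Lambda_N}\omega_x\sigma_x\Big\},$$ where the first sum is over unordered pairs with $|x-y|_1=1$, $x,y\in\Lambda_N\cup\partial\Lambda_N$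 and at least one of $x,y$ in $\Lambda_N$, and $\sigma_x:=+1$ (resp. $-1$) for all $x\in\partial\Lambda_N$. If $\omega_x=\pm\infty$ for some $x\in\Lambda_N$, then $\sigma_x$ is forced to be $\pm1$ (the measure is restricted to configurations satisfying these constraints and the field sum runs only over $x$ with finite $\omega_x$). The superscript $\omega$ is omitted when $\omega\equiv0$. The critical inverse temperature is $\beta_c=\sup\{\beta\ge0:\lim_{N\to\infty}\langle\sigma_0\rangle^{+}_{\Lambda_N,\beta}=0\}$. *)

theory Defs
  imports "HOL-Probability.Probability"
begin

text \<open>The lattice is \<^typ>\<open>int ^ 'd\<close>, with dimension \<open>CARD('d)\<close>.\<close>

definition l1_norm :: "int ^ 'd \<Rightarrow> int" where
  "l1_norm x = (\<Sum>i\<in>UNIV. \<bar>x $ i\<bar>)"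

definition box_lattice :: "nat \<Rightarrow> (int ^ 'd) set" where
  "box_lattice N = {x. \<forall>i. - int N \<le> x $ i \<and> x $ i \<le> int N}"

definition outer_boundary :: "nat \<Rightarrow> (int ^ 'd) set" where
  "outer_boundary N = {x. x \<notin> box_lattice N \<and> (\<exists>y\<in>box_lattice N. l1_norm (x - y) = 1)}"

definition box_edges :: "nat \<Rightarrow> (int ^ 'd) set set" where
  "box_edges N =
     {{x, y} | x y. l1_norm (x - y) = 1
        \<and> x \<in> box_lattice N \<union> outer_boundary N \<and> y \<in> box_lattice N \<union> outer_boundary N
        \<and> (x \<in> box_lattice N \<or> y \<in> box_lattice N)}"

text \<open>Spins are real numbers, so that \<open>\<sigma> x\<close> can itself serve as an observable.
  A configuration is extensional, i.e. \<^const>\<open>undefined\<close> off the box, and an infinite field value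
  fixes the spin at that site.\<close>

definition spin_configs :: "(int ^ 'd \<Rightarrow> ereal) \<Rightarrow> nat \<Rightarrow> (int ^ 'd \<Rightarrow> real) set" where
  "spin_configs \<omega> N =
     {\<sigma> \<in> box_lattice N \<rightarrow>\<^sub>E {-1, 1}.
        \<forall>x\<in>box_lattice N. (\<omega> x = \<infinity> \<longrightarrow> \<sigma> x = 1) \<and> (\<omega> x = -\<infinity> \<longrightarrow> \<sigma> x = -1)}"

definition with_boundary :: "nat \<Rightarrow> real \<Rightarrow> (int ^ 'd \<Rightarrow> real) \<Rightarrow> int ^ 'd \<Rightarrow> real" where
  "with_boundary N b \<sigma> x = (if x \<in> box_lattice N then \<sigma> x else b)"

text \<open>The two endpoints of an edge \<open>e = {x, y}\<close> are distinct, so the product over \<open>e\<close> below is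
  \<open>\<sigma> x * \<sigma> y\<close>.\<close>

definition ising_weight ::
    "real \<Rightarrow> (int ^ 'd \<Rightarrow> ereal) \<Rightarrow> real \<Rightarrow> nat \<Rightarrow> (int ^ 'd \<Rightarrow> real) \<Rightarrow> real" where
  "ising_weight \<beta> \<omega> b N \<sigma> =
     exp (\<beta> * (\<Sum>e\<in>box_edges N. \<Prod>x\<in>e. with_boundary N b \<sigma> x)
          + (\<Sum>x | x \<in> box_lattice N \<and> \<bar>\<omega> x\<bar> \<noteq> \<infinity>. real_of_ereal (\<omega> x) * \<sigma> x))"

definition partition_function :: "real \<Rightarrow> (int ^ 'd \<Rightarrow> ereal) \<Rightarrow> real \<Rightarrow> nat \<Rightarrow> real" where
  "partition_function \<beta> \<omega> b N = (\<Sum>\<sigma>\<in>spin_configs \<omega> N. ising_weight \<beta> \<omega> b N \<sigma>)"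

definition ising_measure ::
    "real \<Rightarrow> (int ^ 'd \<Rightarrow> ereal) \<Rightarrow> real \<Rightarrow> nat \<Rightarrow> (int ^ 'd \<Rightarrow> real) measure" where
  "ising_measure \<beta> \<omega> b N =
     point_measure (spin_configs \<omega> N)
       (\<lambda>\<sigma>. ennreal (ising_weight \<beta> \<omega> b N \<sigma> / partition_function \<beta> \<omega> b N))"

text \<open>The expectation of the spin at the origin; \<open>b = 1\<close> and \<open>b = -1\<close> are the plus and minus
  boundary conditions.\<close>

definition magnetization :: "real \<Rightarrow> (int ^ 'd \<Rightarrow> ereal) \<Rightarrow> real \<Rightarrow> nat \<Rightarrow> real" where
  "magnetization \<beta> \<omega> b N = (\<integral>\<sigma>. \<sigma> 0 \<partial>ising_measure \<beta> \<omega> b N)"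

text \<open>The supremum is taken in \<^typ>\<open>ereal\<close>, where it is meaningful without knowing that the set
  is bounded.\<close>

definition critical_beta :: "'d::finite itself \<Rightarrow> ereal" where
  "critical_beta _ =
     Sup (ereal ` {\<beta>. 0 \<le> \<beta> \<and>
       (\<lambda>N. magnetization \<beta> (\<lambda>_ :: int ^ 'd. 0) 1 N) \<longlonglongrightarrow> 0})"

lemma finite_box_lattice: "finite (box_lattice N :: (int ^ 'd) set)"
proof (rule finite_imageD)
  show "finite (vec_nth ` (box_lattice N :: (int ^ 'd) set))"
  proof (rule finite_subset)
    show "vec_nth ` (box_lattice N :: (int ^ 'd) set) \<subseteq> UNIV \<rightarrow>\<^sub>E {- int N..int N}"
      by (auto simp: box_lattice_def)
    show "finite ((UNIV :: 'd set) \<rightarrow>\<^sub>E {- int N..int N})"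
      by (rule finite_PiE) auto
  qed
  show "inj_on vec_nth (box_lattice N :: (int ^ 'd) set)"
    by (auto intro: inj_onI simp: vec_nth_inject)
qed

lemma finite_spin_configs: "finite (spin_configs \<omega> N)"
proof (rule finite_subset)
  show "spin_configs \<omega> N \<subseteq> box_lattice N \<rightarrow>\<^sub>E {-1, 1}"
    by (auto simp: spin_configs_def)
  show "finite (box_lattice N \<rightarrow>\<^sub>E {-1, 1 :: real})"
    by (rule finite_PiE[OF finite_box_lattice]) auto
qed

lemma spin_configs_nonempty: "spin_configs \<omega> N \<noteq> {}"
proof -
  have "(\<lambda>x\<in>box_lattice N. if \<omega> x = -\<infinity> then -1 else 1) \<in> spin_configs \<omega> N"
    by (auto simp: spin_configs_def)
  then show ?thesis by blast
qed

lemma partition_function_pos: "partition_function \<beta> \<omega> b N > 0"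
  unfolding partition_function_def
  by (intro sum_pos finite_spin_configs spin_configs_nonempty) (simp add: ising_weight_def)

lemma prob_space_ising_measure: "prob_space (ising_measure \<beta> \<omega> b N)"
proof
  let ?w = "\<lambda>\<sigma>. ising_weight \<beta> \<omega> b N \<sigma> / partition_function \<beta> \<omega> b N"
  have nn: "?w \<sigma> \<ge> 0" for \<sigma>
    using partition_function_pos[of \<beta> \<omega> b N] by (simp add: ising_weight_def)
  have "emeasure (ising_measure \<beta> \<omega> b N) (space (ising_measure \<beta> \<omega> b N))
      = (\<Sum>\<sigma>\<in>spin_configs \<omega> N. ennreal (?w \<sigma>))"
    by (simp add: ising_measure_def space_point_measure emeasure_point_measure_finite
        finite_spin_configs)
  also have "\<dots> = ennreal (\<Sum>\<sigma>\<in>spin_configs \<omega> N. ?w \<sigma>)"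
    using nn by (intro sum_ennreal) auto
  also have "(\<Sum>\<sigma>\<in>spin_configs \<omega> N. ?w \<sigma>) = 1"
    using partition_function_pos[of \<beta> \<omega> b N]
    by (simp add: sum_divide_distrib[symmetric] partition_function_def)
  finally show "emeasure (ising_measure \<beta> \<omega> b N) (space (ising_measure \<beta> \<omega> b N)) = 1"
    by simp
qed

lemma magnetization_eq_sum:
  "magnetization \<beta> \<omega> b N =
     (\<Sum>\<sigma>\<in>spin_configs \<omega> N. ising_weight \<beta> \<omega> b N \<sigma> * \<sigma> 0) / partition_function \<beta> \<omega> b N"
  using partition_function_pos[of \<beta> \<omega> b N]
  by (simp add: magnetization_def ising_measure_def lebesgue_integral_point_measure_finite
      finite_spin_configs ising_weight_def sum_divide_distrib)

end

(* Boundary influence. Pin every spin except the one at the origin and a ghost spin carrying the boundary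
   condition, and let Z(a, b) be the partition function of the remaining spins given these two. The influence of
   the boundary is a monotone function of the cross ratio Z(+,+) Z(-,-) / (Z(+,-) Z(-,+)), at its symmetric
   optimum when the field vanishes, so it suffices that the cross ratio is maximal at zero field. This is proved
   by induction on the number of sites and, for a fixed site set, on the number of edges at the origin: switch on
   one edge {0, y} with strength s. Merging y with the origin, or merging the origin with the ghost, removes a
   site, and the induction hypothesis for these two merged models bounds the s-derivative of the cross ratio at
   a critical point of the field at y by its zero-field counterpart. A maximum principle in s and in the field at
   y finishes the step. Infinite fields are limits of finite ones.

   Exponential decay. Let phi(S) be the sum, over the sites x of S with a neighbour outside S, of the free
   correlation of 0 and x in S. In the random-cluster representation the covariance of the spin at 0 with an edge
   is at least the probability that the edge is closed and pivotal for 0 to be connected to the boundary;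
   exploring the cluster of the boundary gives m' >= (1 - m) inf phi for the magnetization m as a function of the
   inverse temperature. Hence phi >= 1 on a whole interval of inverse temperatures ending at b is incompatible
   with m tending to 0 at b. So below the critical point some phi(S) < 1, and iterating the Simon-Lieb
   inequality m(0) <= sum over x of <s_0 s_x>_S m(x) gives exponential decay. *)

theory Submission
  imports Defs "HOL-Library.Function_Algebras"
begin

section \<open>Comparison of three-spin interactions\<close>

text \<open>A difference of magnetizations does not keep its form when a site is removed, whereas
  the cross ratio consists of four partition functions of the remaining sites and keeps it under
  both mergers. The merged inequalities alone do not control the slope in s for a general field at
  \<open>y\<close>: only where the derivative in that field vanishes is the mean of
  \<open>y\<close>, averaged over the two equal states of origin and ghost, the same as over the two
  opposite ones, and this common value links the two inequalities. The field must be arbitrary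
  throughout, because the maximum principle starts from the line s = 0 for every field at
  \<open>y\<close>.

  Connectivity is never treated by paths. It is read off from subgroups of spin configurations, so
  that correlation inequalities and the exploration of the boundary cluster become statements about
  finite groups and their characters with values 1 and -1.

  The critical point is a supremum, so it only yields some larger inverse temperature at which m
  tends to 0. The set S with phi(S) < 1 may be found at an inverse temperature above the given one;
  monotonicity of m carries the decay back.\<close>

definition lse :: "real \<Rightarrow> real \<Rightarrow> real \<Rightarrow> real" where
  "lse a b t = ln (a * exp t + b * exp (- t))"

text \<open>\<open>lse a b t\<close> is the logarithm of the partition function of a single spin
  with weights \<open>a\<close>, \<open>b\<close> for 1, -1 in the field \<open>t\<close>. This is
  the mean of that spin, hence the derivative of \<open>lse\<close> in \<open>t\<close>.\<close>

definition spin_mean :: "real \<Rightarrow> real \<Rightarrow> real \<Rightarrow> real" where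
  "spin_mean a b t = (a * exp t - b * exp (- t)) / (a * exp t + b * exp (- t))"

lemma lse_arg_pos: "a > 0 \<Longrightarrow> b > 0 \<Longrightarrow> a * exp t + b * exp (- t) > (0::real)"
  by (simp add: add_pos_pos)

lemma has_real_derivative_lse:
  assumes "a > 0" "b > 0"
  shows "(lse a b has_real_derivative spin_mean a b t) (at t)"
proof -
  have "((\<lambda>t. ln (a * exp t + b * exp (- t))) has_real_derivative spin_mean a b t) (at t)"
    using lse_arg_pos[OF assms, of t]
    by (auto intro!: derivative_eq_intros simp: spin_mean_def)
  then show ?thesis by (simp add: lse_def[abs_def])
qed

lemma lse_chain [derivative_intros]:
  assumes "a > 0" "b > 0" "(f has_real_derivative f') (at x)"
  shows "((\<lambda>x. lse a b (f x)) has_real_derivative spin_mean a b (f x) * f') (at x)"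
  using DERIV_chain2[OF has_real_derivative_lse[OF assms(1,2)] assms(3)] .

lemma exp_lse: "a > 0 \<Longrightarrow> b > 0 \<Longrightarrow> exp (lse a b t) = a * exp t + b * exp (- t)"
  using lse_arg_pos[of a b t] by (simp add: lse_def)

lemma one_plus_spin_mean:
  assumes "a > 0" "b > 0"
  shows "exp (lse a b t) * (1 + spin_mean a b t) = 2 * a * exp t"
    "exp (lse a b t) * (1 - spin_mean a b t) = 2 * b * exp (- t)"
  using lse_arg_pos[OF assms, of t] unfolding exp_lse[OF assms]
  by (simp_all add: spin_mean_def field_simps)

lemma spin_mean_bounds:
  assumes "a > 0" "b > 0"
  shows "\<bar>spin_mean a b t\<bar> < 1"
  using lse_arg_pos[OF assms, of t] assms by (simp add: spin_mean_def abs_less_iff field_simps)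

text \<open>In a strong field one orientation survives; the divergent term \<open>t\<close> is
  common to both logarithms and cancels. In particular a bounded shift of the field does not change
  the limit.\<close>

lemma lse_diff_tendsto:
  assumes "a > 0" "b > 0" "c > 0" "d > 0"
  shows "((\<lambda>t. lse a b t - lse c d t) \<longlongrightarrow> ln a - ln c) at_top"
    "((\<lambda>t. lse a b t - lse c d t) \<longlongrightarrow> ln b - ln d) at_bot"
proof -
  have top: "((\<lambda>t. lse a b t - t) \<longlongrightarrow> ln a) at_top" if "a > 0" "b > 0" for a b :: real
  proof -
    have "((\<lambda>t. ln (a + b * exp (- (2 * t)))) \<longlongrightarrow> ln (a + b * 0)) at_top"
      using that
      by (intro tendsto_intros filterlim_compose[OF exp_at_bot] 
          filterlim_compose[OF filterlim_uminus_at_bot_at_top] filterlim_tendsto_pos_mult_at_top[OF tendsto_const] filterlim_ident) auto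
    moreover have "ln (a + b * exp (- (2 * t))) = lse a b t - t" for t
    proof -
      have "a * exp t + b * exp (- t) = exp t * (a + b * exp (- (2 * t)))"
        by (simp add: algebra_simps exp_minus exp_add[symmetric] flip: exp_diff) (simp add: field_simps exp_add[symmetric] exp_minus flip: exp_double)
      then show ?thesis using that by (simp add: lse_def ln_mult add_pos_pos add_pos_pos[THEN less_imp_neq, THEN not_sym])
    qed
    ultimately show ?thesis by simp
  qed
  show "((\<lambda>t. lse a b t - lse c d t) \<longlongrightarrow> ln a - ln c) at_top"
    using tendsto_diff[OF top[of a b] top[of c d]] assms by simp
  have flip: "lse a b (- t) = lse b a t" for a b t
    by (simp add: lse_def add.commute)
  show "((\<lambda>t. lse a b t - lse c d t) \<longlongrightarrow> ln b - ln d) at_bot"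
    unfolding at_bot_mirror filterlim_filtermap flip
    using tendsto_diff[OF top[of b a] top[of d c]] assms by simp
qed

text \<open>\<open>X\<close> and \<open>Z\<close> stand for half the change of the mean of
  \<open>y\<close> when the origin goes from - to +, with the ghost equal and opposite to the origin
  respectively; \<open>m\<close> is the common half sum, and \<open>X0\<close>, \<open>Z0\<close>
  are the values at zero field. \<open>P\<close> gives \<open>X \<le> X0\<close>, and
  \<open>Q\<close> then bounds the difference.\<close>

lemma critical_slope_bound:
  fixes X Z m X0 Z0 :: real
  assumes X: "0 \<le> X" and "\<bar>X\<bar> + \<bar>m\<bar> < 1" "\<bar>Z\<bar> + \<bar>m\<bar> < 1" and X0: "\<bar>X0\<bar> < 1" and "\<bar>Z0\<bar> < 1" "Z0 \<le> X0"
    and P: "((1 + X)\<^sup>2 - m\<^sup>2) * (1 - X0)\<^sup>2 \<le> ((1 - X)\<^sup>2 - m\<^sup>2) * (1 + X0)\<^sup>2"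
    and Q: "((1 + X)\<^sup>2 - m\<^sup>2) * (1 + Z0)\<^sup>2 \<le> ((1 + Z)\<^sup>2 - m\<^sup>2) * (1 + X0)\<^sup>2"
  shows "X - Z \<le> X0 - Z0"
proof -
  have "X \<le> X0"
  proof (rule ccontr)
    assume "\<not> X \<le> X0"
    then have "X0 < X" by simp
    have lt: "(1 - X)\<^sup>2 * (1 + X0)\<^sup>2 < (1 + X)\<^sup>2 * (1 - X0)\<^sup>2"
    proof -
      have "(1 - X) * (1 + X0) < (1 + X) * (1 - X0)" using \<open>X0 < X\<close> by (simp add: algebra_simps)
      moreover have "0 \<le> (1 - X) * (1 + X0)" using assms by (intro mult_nonneg_nonneg) auto
      ultimately have "((1 - X) * (1 + X0))\<^sup>2 < ((1 + X) * (1 - X0))\<^sup>2" by (intro power_strict_mono) auto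
      then show ?thesis by (simp add: power_mult_distrib)
    qed
    \<comment> \<open>Expanding \<open>P\<close> leaves m^2 (-4 X0) \<ge> 4 (X - X0) (1 - X X0) > 0.
      This is impossible for X0 \<ge> 0, and for X0 < 0 it contradicts m^2 < 1.\<close>
    have "m\<^sup>2 * ((1 - X0)\<^sup>2 - (1 + X0)\<^sup>2) \<ge> (1 + X)\<^sup>2 * (1 - X0)\<^sup>2 - (1 - X)\<^sup>2 * (1 + X0)\<^sup>2"
      using P by (simp add: algebra_simps)
    then have mm: "m\<^sup>2 * (- 4 * X0) \<ge> (1 + X)\<^sup>2 * (1 - X0)\<^sup>2 - (1 - X)\<^sup>2 * (1 + X0)\<^sup>2"
      by (simp add: power2_eq_square algebra_simps)
    have eq: "(1 + X)\<^sup>2 * (1 - X0)\<^sup>2 - (1 - X)\<^sup>2 * (1 + X0)\<^sup>2 = 4 * (X - X0) * (1 - X * X0)"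
      by (simp add: power2_eq_square algebra_simps)
    show False
    proof (cases "X0 \<ge> 0")
      case True
      then have "m\<^sup>2 * (- 4 * X0) \<le> 0" by (simp add: mult_nonneg_nonpos)
      with mm lt show False by simp
    next
      case False
      have "m\<^sup>2 < 1" using assms by (simp add: abs_square_less_1)
      then have "m\<^sup>2 * (- 4 * X0) < - 4 * X0" using False by simp
      moreover have "- 4 * X0 \<le> 4 * (X - X0) * (1 - X * X0)"
      proof -
        have "X * X0 \<le> 0" using X False by (simp add: mult_nonneg_nonpos)
        have "- 4 * X0 \<le> 4 * (X - X0) * 1" using X by simp
        also have "\<dots> \<le> 4 * (X - X0) * (1 - X * X0)"
          using \<open>X0 < X\<close> \<open>X * X0 \<le> 0\<close> by (intro mult_left_mono) auto
        finally show ?thesis .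
      qed
      ultimately show False using mm eq by linarith
    qed
  qed
  \<comment> \<open>The terms with m^2 may be dropped from \<open>Q\<close>: because of
    \<open>Z0 \<le> X0\<close> they only help.\<close>
  have "(1 + X)\<^sup>2 * (1 + Z0)\<^sup>2 \<le> (1 + Z)\<^sup>2 * (1 + X0)\<^sup>2"
  proof -
    have "(1 + Z0)\<^sup>2 \<le> (1 + X0)\<^sup>2" using assms by (intro power_mono) auto
    then have "m\<^sup>2 * (1 + Z0)\<^sup>2 \<le> m\<^sup>2 * (1 + X0)\<^sup>2" by (intro mult_left_mono) auto
    with Q show ?thesis by (simp add: algebra_simps)
  qed
  then have "((1 + X) * (1 + Z0))\<^sup>2 \<le> ((1 + Z) * (1 + X0))\<^sup>2" by (simp add: power_mult_distrib)
  then have "(1 + X) * (1 + Z0) \<le> (1 + Z) * (1 + X0)"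
    by (rule power2_le_imp_le) (use assms in \<open>auto intro!: mult_nonneg_nonneg\<close>)
  then have "(X - Z) * (1 + X0) \<le> (1 + X) * (X0 - Z0)" by (simp add: algebra_simps)
  also have "\<dots> \<le> (1 + X0) * (X0 - Z0)" using \<open>X \<le> X0\<close> assms by (intro mult_right_mono) auto
  finally show ?thesis using X0 by (simp add: mult.commute[of _ "1 + X0"] abs_less_iff)
qed


text \<open>The numbers \<open>y1, \<dots>, y8\<close> are the weights of the states \<open>+++, ++-, +-+, +--, --+, ---, -++, -+-\<close> of the
  origin, the ghost and the site \<open>y\<close>; \<open>L1, \<dots>, L4\<close> are the weights of the first four at zero field, where a global
  flip gives the rest. At a critical point in \<open>\<xi>\<close> where the comparison fails, the ratio cannot increase with
  \<open>s\<close>, so \<open>F - \<delta> s\<close> has no positive maximum.\<close>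

lemma three_spin_comparison:
  fixes y1 y2 y3 y4 y5 y6 y7 y8 L1 L2 L3 L4 :: real
  assumes pos: "y1 > 0" "y2 > 0" "y3 > 0" "y4 > 0" "y5 > 0" "y6 > 0" "y7 > 0" "y8 > 0"
    "L1 > 0" "L2 > 0" "L3 > 0" "L4 > 0"
    and fkg: "y2 * y5 \<le> y1 * y6" and L: "L2 * L3 \<le> L1 * L4"
    and P: "y1 * y6 * L2\<^sup>2 \<le> y2 * y5 * L1\<^sup>2"
    and Q: "y1 * y6 * L3\<^sup>2 \<le> y3 * y8 * L1\<^sup>2"
    and init: "\<And>\<xi>. lse y1 y2 \<xi> - lse y3 y4 \<xi> + (lse y5 y6 \<xi> - lse y7 y8 \<xi>) + 2 * (lse L3 L4 0 - lse L1 L2 0) \<le> 0"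
    and s: "s \<ge> 0"
  shows "lse y1 y2 (\<xi> + s) - lse y3 y4 (\<xi> + s) + (lse y5 y6 (\<xi> - s) - lse y7 y8 (\<xi> - s)) + 2 * (lse L3 L4 s - lse L1 L2 s) \<le> 0"
proof -
  \<comment> \<open>\<open>F\<close> is the logarithm of the cross ratio divided by its zero-field
    value, for edge strength \<open>s\<close> and additional field \<open>\<xi>\<close> at
    \<open>y\<close>. At zero field the flip identifies the two equal states and the two opposite
    states, hence the factor 2.\<close>
  define F where "F = (\<lambda>s \<xi>. lse y1 y2 (\<xi> + s) - lse y3 y4 (\<xi> + s) + (lse y5 y6 (\<xi> - s) - lse y7 y8 (\<xi> - s)) + 2 * (lse L3 L4 s - lse L1 L2 s))"
  define Fs where "Fs = (\<lambda>s \<xi>. spin_mean y1 y2 (\<xi> + s) - spin_mean y3 y4 (\<xi> + s) - (spin_mean y5 y6 (\<xi> - s) - spin_mean y7 y8 (\<xi> - s)) + 2 * (spin_mean L3 L4 s - spin_mean L1 L2 s))"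
  define Fx where "Fx = (\<lambda>s \<xi>. spin_mean y1 y2 (\<xi> + s) - spin_mean y3 y4 (\<xi> + s) + (spin_mean y5 y6 (\<xi> - s) - spin_mean y7 y8 (\<xi> - s)))"
  have dFs: "((\<lambda>s. F s \<xi>) has_real_derivative Fs s \<xi>) (at s)" for s \<xi>
    unfolding F_def Fs_def using pos by (auto intro!: derivative_eq_intros)
  have dFx: "(F s has_real_derivative Fx s \<xi>) (at \<xi>)" for s \<xi>
    unfolding F_def Fx_def using pos by (auto intro!: derivative_eq_intros)
  have init: "F 0 \<xi> \<le> 0" for \<xi> using init[of \<xi>] by (simp add: F_def)
  have Lmean: "spin_mean L3 L4 s \<le> spin_mean L1 L2 s" for s
  proof -
    have "(L3 * exp s - L4 * exp (- s)) * (L1 * exp s + L2 * exp (- s)) \<le> (L1 * exp s - L2 * exp (- s)) * (L3 * exp s + L4 * exp (- s))"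
      using L by (simp add: algebra_simps exp_minus)
    then show ?thesis using lse_arg_pos[of L1 L2 s] lse_arg_pos[of L3 L4 s] pos
      by (simp add: spin_mean_def divide_simps mult.commute)
  qed
  \<comment> \<open>\<open>Fs\<close> is twice (X - Z) - (X0 - Z0) for the half differences defined
    below, and \<open>crit\<close> says that the half sums of the two pairs coincide.\<close>
  have slope: "Fs s \<xi> \<le> 0" if crit: "Fx s \<xi> = 0" and "F s \<xi> \<ge> 0" and "s \<ge> 0" for s \<xi>
  proof -
    define M1 M2 M3 M4 X0 Z0 where "M1 = spin_mean y1 y2 (\<xi> + s)" and "M2 = spin_mean y5 y6 (\<xi> - s)"
      and "M3 = spin_mean y3 y4 (\<xi> + s)" and "M4 = spin_mean y7 y8 (\<xi> - s)"
      and "X0 = spin_mean L1 L2 s" and "Z0 = spin_mean L3 L4 s"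
    define f1 f2 f3 f4 g1 g3 where "f1 = exp (lse y1 y2 (\<xi> + s))" and "f2 = exp (lse y5 y6 (\<xi> - s))"
      and "f3 = exp (lse y3 y4 (\<xi> + s))" and "f4 = exp (lse y7 y8 (\<xi> - s))"
      and "g1 = exp (lse L1 L2 s)" and "g3 = exp (lse L3 L4 s)"
    have fp: "f1 > 0" "f2 > 0" "f3 > 0" "f4 > 0" "g1 > 0" "g3 > 0"
      by (simp_all add: f1_def f2_def f3_def f4_def g1_def g3_def)
    have bd: "\<bar>M1\<bar> < 1" "\<bar>M2\<bar> < 1" "\<bar>M3\<bar> < 1" "\<bar>M4\<bar> < 1" "\<bar>X0\<bar> < 1" "\<bar>Z0\<bar> < 1"
      unfolding M1_def M2_def M3_def M4_def X0_def Z0_def using pos by (simp_all add: spin_mean_bounds)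
    have M: "f1 * (1 + M1) = 2 * y1 * exp (\<xi> + s)" "f1 * (1 - M1) = 2 * y2 * exp (- (\<xi> + s))"
      "f2 * (1 + M2) = 2 * y5 * exp (\<xi> - s)" "f2 * (1 - M2) = 2 * y6 * exp (- (\<xi> - s))"
      "f3 * (1 + M3) = 2 * y3 * exp (\<xi> + s)" "f3 * (1 - M3) = 2 * y4 * exp (- (\<xi> + s))"
      "f4 * (1 + M4) = 2 * y7 * exp (\<xi> - s)" "f4 * (1 - M4) = 2 * y8 * exp (- (\<xi> - s))"
      "g1 * (1 + X0) = 2 * L1 * exp s" "g1 * (1 - X0) = 2 * L2 * exp (- s)"
      "g3 * (1 + Z0) = 2 * L3 * exp s" "g3 * (1 - Z0) = 2 * L4 * exp (- s)"
      unfolding M1_def M2_def M3_def M4_def X0_def Z0_def f1_def f2_def f3_def f4_def g1_def g3_def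
      using pos one_plus_spin_mean by blast+
    have e: "exp (\<xi> + s) * exp (- (\<xi> - s)) = (exp s)\<^sup>2" "exp (- (\<xi> + s)) * exp (\<xi> - s) = (exp (- s))\<^sup>2"
      "exp s * exp (- s) = 1"
      by (simp_all add: exp_add[symmetric] power2_eq_square)
    \<comment> \<open>The two factors have opposite values of \<open>y\<close>, so
      \<open>\<xi>\<close> cancels and only the edge strength remains. This makes the hypotheses, in
      which no \<open>\<xi>\<close> occurs, applicable to the means.\<close>
    have 16: "f1 * f2 * ((1 + M1) * (1 - M2)) = 4 * (y1 * y6) * (exp s)\<^sup>2"
    proof -
      have "f1 * f2 * ((1 + M1) * (1 - M2)) = (f1 * (1 + M1)) * (f2 * (1 - M2))" by simp
      also have "\<dots> = 4 * (y1 * y6) * (exp (\<xi> + s) * exp (- (\<xi> - s)))" unfolding M by simp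
      finally show ?thesis unfolding e .
    qed
    have 25: "f1 * f2 * ((1 - M1) * (1 + M2)) = 4 * (y2 * y5) * (exp (- s))\<^sup>2"
    proof -
      have "f1 * f2 * ((1 - M1) * (1 + M2)) = (f1 * (1 - M1)) * (f2 * (1 + M2))" by simp
      also have "\<dots> = 4 * (y2 * y5) * (exp (- (\<xi> + s)) * exp (\<xi> - s))" unfolding M by simp
      finally show ?thesis unfolding e .
    qed
    have 38: "f3 * f4 * ((1 + M3) * (1 - M4)) = 4 * (y3 * y8) * (exp s)\<^sup>2"
    proof -
      have "f3 * f4 * ((1 + M3) * (1 - M4)) = (f3 * (1 + M3)) * (f4 * (1 - M4))" by simp
      also have "\<dots> = 4 * (y3 * y8) * (exp (\<xi> + s) * exp (- (\<xi> - s)))" unfolding M by simp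
      finally show ?thesis unfolding e .
    qed
    have gs: "g1\<^sup>2 * (1 + X0)\<^sup>2 = 4 * L1\<^sup>2 * (exp s)\<^sup>2" "g1\<^sup>2 * (1 - X0)\<^sup>2 = 4 * L2\<^sup>2 * (exp (- s))\<^sup>2"
      "g3\<^sup>2 * (1 + Z0)\<^sup>2 = 4 * L3\<^sup>2 * (exp s)\<^sup>2"
      unfolding power_mult_distrib[symmetric] M by (simp_all add: power_mult_distrib)
    define m where "m = (M1 + M2) / 2"
    define X where "X = (M1 - M2) / 2"
    define Z where "Z = (M3 - M4) / 2"
    have m': "m = (M3 + M4) / 2" using crit by (simp add: Fx_def m_def M1_def M2_def M3_def M4_def)
    have sq: "(1 + X)\<^sup>2 - m\<^sup>2 = (1 + M1) * (1 - M2)" "(1 - X)\<^sup>2 - m\<^sup>2 = (1 - M1) * (1 + M2)"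
      by (simp_all add: m_def X_def power2_eq_square field_simps)
    have sqZ: "(1 + Z)\<^sup>2 - m\<^sup>2 = (1 + M3) * (1 - M4)"
      unfolding m' by (simp add: Z_def power2_eq_square field_simps)
    have "0 \<le> X"
    proof -
      have "y2 * y5 * (exp (- s))\<^sup>2 \<le> y1 * y6 * (exp s)\<^sup>2"
        using fkg pos \<open>s \<ge> 0\<close> by (rule_tac mult_mono) (auto intro!: power_mono)
      then have "f1 * f2 * ((1 - M1) * (1 + M2)) \<le> f1 * f2 * ((1 + M1) * (1 - M2))"
        unfolding 16 25 by simp
      then have "(1 - M1) * (1 + M2) \<le> (1 + M1) * (1 - M2)" using fp by simp
      then show ?thesis by (simp add: X_def algebra_simps)
    qed
    have "X - Z \<le> X0 - Z0"
    proof (rule critical_slope_bound[OF \<open>0 \<le> X\<close>, of m])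
      show "((1 + X)\<^sup>2 - m\<^sup>2) * (1 - X0)\<^sup>2 \<le> ((1 - X)\<^sup>2 - m\<^sup>2) * (1 + X0)\<^sup>2"
      proof -
        have "(f1 * f2 * ((1 + M1) * (1 - M2))) * (g1\<^sup>2 * (1 - X0)\<^sup>2) = 16 * (y1 * y6 * L2\<^sup>2) * (exp s * exp (- s))\<^sup>2"
          unfolding 16 gs by (simp add: power_mult_distrib)
        also have "\<dots> \<le> 16 * (y2 * y5 * L1\<^sup>2) * (exp s * exp (- s))\<^sup>2" using P unfolding e by simp
        also have "\<dots> = (f1 * f2 * ((1 - M1) * (1 + M2))) * (g1\<^sup>2 * (1 + X0)\<^sup>2)"
          unfolding 25 gs by (simp add: power_mult_distrib)
        finally have "(f1 * f2 * g1\<^sup>2) * (((1 + M1) * (1 - M2)) * (1 - X0)\<^sup>2) \<le> (f1 * f2 * g1\<^sup>2) * (((1 - M1) * (1 + M2)) * (1 + X0)\<^sup>2)"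
          by (simp add: mult_ac)
        then show ?thesis unfolding sq using fp by simp
      qed
      show "((1 + X)\<^sup>2 - m\<^sup>2) * (1 + Z0)\<^sup>2 \<le> ((1 + Z)\<^sup>2 - m\<^sup>2) * (1 + X0)\<^sup>2"
      proof -
        \<comment> \<open>\<open>Q\<close> compares weights while the goal compares means. The two
          normalizations \<open>f1 * f2\<close> and \<open>f3 * f4\<close> have the cross ratio as
          their quotient, so the assumption that the comparison fails or is an equality bounds one
          by the other in the needed direction.\<close>
        have "exp (2 * lse L1 L2 s + (lse y3 y4 (\<xi> + s) + lse y7 y8 (\<xi> - s))) \<le> exp (2 * lse L3 L4 s + (lse y1 y2 (\<xi> + s) + lse y5 y6 (\<xi> - s)))"
          using \<open>F s \<xi> \<ge> 0\<close> unfolding exp_le_cancel_iff F_def by simp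
        then have "g1\<^sup>2 * (f3 * f4) \<le> g3\<^sup>2 * (f1 * f2)"
          unfolding exp_add exp_double by (simp add: f1_def f2_def f3_def f4_def g1_def g3_def)
        then have "g1\<^sup>2 * (f3 * f4) * ((1 + M1) * (1 - M2) * (1 + Z0)\<^sup>2) \<le> g3\<^sup>2 * (f1 * f2) * ((1 + M1) * (1 - M2) * (1 + Z0)\<^sup>2)"
          using bd by (intro mult_right_mono) auto
        also have "\<dots> = (f1 * f2 * ((1 + M1) * (1 - M2))) * (g3\<^sup>2 * (1 + Z0)\<^sup>2)" by (simp add: mult_ac)
        also have "\<dots> = 16 * (y1 * y6 * L3\<^sup>2) * (exp s)\<^sup>2 * (exp s)\<^sup>2" unfolding 16 gs by simp
        also have "\<dots> \<le> 16 * (y3 * y8 * L1\<^sup>2) * (exp s)\<^sup>2 * (exp s)\<^sup>2" using Q by simp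
        also have "\<dots> = (f3 * f4 * ((1 + M3) * (1 - M4))) * (g1\<^sup>2 * (1 + X0)\<^sup>2)" unfolding 38 gs by simp
        also have "\<dots> = g1\<^sup>2 * (f3 * f4) * ((1 + M3) * (1 - M4) * (1 + X0)\<^sup>2)" by (simp add: mult_ac)
        finally show ?thesis unfolding sq sqZ using fp by simp
      qed
    qed (use bd Lmean[of s] m' in \<open>auto simp: X_def m_def Z_def X0_def Z0_def abs_if field_simps split: if_splits\<close>)
    then show ?thesis
      using crit by (simp add: Fs_def Fx_def X_def Z_def M1_def M2_def M3_def M4_def X0_def Z0_def field_simps)
  qed
  have decr: "lse L3 L4 t - lse L1 L2 t \<le> lse L3 L4 0 - lse L1 L2 0" if "t \<ge> 0" for t
  proof (rule DERIV_nonpos_imp_nonincreasing[OF that, of "\<lambda>t. lse L3 L4 t - lse L1 L2 t"])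
    fix x
    show "\<exists>y. ((\<lambda>t. lse L3 L4 t - lse L1 L2 t) has_real_derivative y) (at x) \<and> y \<le> 0"
      using pos Lmean[of x]
      by (intro exI[of _ "spin_mean L3 L4 x - spin_mean L1 L2 x"]) (auto intro!: derivative_eq_intros)
  qed
  \<comment> \<open>As \<open>\<xi>\<close> tends to either infinity, the shifts by \<open>s\<close>
    disappear and the limit is bounded by \<open>init\<close>; by \<open>decr\<close> the zero-field
    term only becomes smaller with \<open>s\<close>. So a positive maximum cannot escape to
    infinity.\<close>
  have far: "\<exists>B. \<forall>s\<in>{0..S}. \<forall>\<xi>. B \<le> \<bar>\<xi>\<bar> \<longrightarrow> F s \<xi> \<le> \<eta>" if "\<eta> > 0" for S \<eta>
  proof -
    define c where "c = 2 * (lse L3 L4 0 - lse L1 L2 0)"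
    let ?r = "\<lambda>t. lse y1 y2 t - lse y3 y4 t" and ?q = "\<lambda>t. lse y5 y6 t - lse y7 y8 t"
    have lim: "(?r \<longlongrightarrow> ln y1 - ln y3) at_top" "(?q \<longlongrightarrow> ln y5 - ln y7) at_top"
      "(?r \<longlongrightarrow> ln y2 - ln y4) at_bot" "(?q \<longlongrightarrow> ln y6 - ln y8) at_bot"
      using pos by (simp_all add: lse_diff_tendsto)
    have "((\<lambda>t. ?r t + ?q t + c) \<longlongrightarrow> (ln y1 - ln y3) + (ln y5 - ln y7) + c) at_top"
      by (intro tendsto_intros lim)
    then have top0: "(ln y1 - ln y3) + (ln y5 - ln y7) + c \<le> 0"
      by (rule tendsto_upperbound) (use init in \<open>auto simp: F_def c_def\<close>)
    have "((\<lambda>t. ?r t + ?q t + c) \<longlongrightarrow> (ln y2 - ln y4) + (ln y6 - ln y8) + c) at_bot"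
      by (intro tendsto_intros lim)
    then have bot0: "(ln y2 - ln y4) + (ln y6 - ln y8) + c \<le> 0"
      by (rule tendsto_upperbound) (use init in \<open>auto simp: F_def c_def\<close>)
    have ev: "\<forall>\<^sub>F t in at_top. ?r t < ln y1 - ln y3 + \<eta> / 2" "\<forall>\<^sub>F t in at_top. ?q t < ln y5 - ln y7 + \<eta> / 2"
      "\<forall>\<^sub>F t in at_bot. ?r t < ln y2 - ln y4 + \<eta> / 2" "\<forall>\<^sub>F t in at_bot. ?q t < ln y6 - ln y8 + \<eta> / 2"
      using lim that by (auto intro: order_tendstoD(2))
    obtain B1 B2 where B1: "\<And>t. t \<ge> B1 \<Longrightarrow> ?r t < ln y1 - ln y3 + \<eta> / 2 \<and> ?q t < ln y5 - ln y7 + \<eta> / 2"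
      and B2: "\<And>t. t \<le> B2 \<Longrightarrow> ?r t < ln y2 - ln y4 + \<eta> / 2 \<and> ?q t < ln y6 - ln y8 + \<eta> / 2"
      using eventually_conj[OF ev(1,2)] eventually_conj[OF ev(3,4)]
      unfolding eventually_at_top_linorder eventually_at_bot_linorder by blast
    have "F t \<xi> \<le> \<eta>" if "t \<in> {0..S}" "\<bar>B1\<bar> + \<bar>B2\<bar> + \<bar>S\<bar> \<le> \<bar>\<xi>\<bar>" for t \<xi>
    proof (cases "\<xi> \<ge> 0")
      case True
      then have "?r (\<xi> + t) < ln y1 - ln y3 + \<eta> / 2" "?q (\<xi> - t) < ln y5 - ln y7 + \<eta> / 2"
        using that B1 by auto
      then show ?thesis using decr[of t] that top0 unfolding F_def c_def by auto
    next
      case False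
      then have "?r (\<xi> + t) < ln y2 - ln y4 + \<eta> / 2" "?q (\<xi> - t) < ln y6 - ln y8 + \<eta> / 2"
        using that B2 by auto
      then show ?thesis using decr[of t] that bot0 unfolding F_def c_def by auto
    qed
    then show ?thesis by blast
  qed
  have "F s \<xi> \<le> 0"
  proof (rule ccontr)
    assume "\<not> F s \<xi> \<le> 0"
    define \<epsilon> where "\<epsilon> = F s \<xi>"
    have \<epsilon>: "\<epsilon> > 0" using \<open>\<not> F s \<xi> \<le> 0\<close> by (simp add: \<epsilon>_def)
    with init[of \<xi>] s have "s > 0" by (cases "s = 0") (auto simp: \<epsilon>_def)
    \<comment> \<open>The slope leaves half of the excess \<open>\<epsilon>\<close> at the point
      where the comparison fails, and turns \<open>Fs \<le> 0\<close> into a strictly negative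
      derivative.\<close>
    define \<delta> where "\<delta> = \<epsilon> / (2 * s)"
    have "\<delta> > 0" "\<delta> * s = \<epsilon> / 2" using \<epsilon> \<open>s > 0\<close> by (simp_all add: \<delta>_def)
    have "\<epsilon> / 4 > 0" using \<epsilon> by simp
    from far[OF this, of s] obtain B0 where B0: "\<forall>t\<in>{0..s}. \<forall>x. B0 \<le> \<bar>x\<bar> \<longrightarrow> F t x \<le> \<epsilon> / 4" by blast
    define B where "B = max (max B0 0) \<bar>\<xi>\<bar>"
    define G where "G = (\<lambda>p. F (fst p) (snd p) - \<delta> * fst p)"
    have "continuous_on ({0..s} \<times> {-B..B}) G"
    proof -
      have "continuous_on UNIV (lse a b)" if "a > 0" "b > 0" for a b
        by (rule continuous_at_imp_continuous_on) (use has_real_derivative_lse[OF that] DERIV_isCont in blast)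
      then have cont: "continuous_on T (\<lambda>p. lse a b (f p))" if "a > 0" "b > 0" "continuous_on T f"
        for a b and T :: "(real \<times> real) set" and f
        using continuous_on_compose2[of UNIV "lse a b" T f] that by simp
      then show ?thesis unfolding G_def F_def using pos by (intro continuous_intros cont) simp_all
    qed
    moreover have "(s, \<xi>) \<in> {0..s} \<times> {-B..B}" using s by (auto simp: B_def)
    moreover have "compact ({0..s} \<times> {-B..B})" by (intro compact_Times) auto
    ultimately obtain p where p: "p \<in> {0..s} \<times> {-B..B}" "\<And>q. q \<in> {0..s} \<times> {-B..B} \<Longrightarrow> G q \<le> G p"
      using continuous_attains_sup[of "{0..s} \<times> {-B..B}" G] by blast
    obtain t x where tx: "p = (t, x)" by (cases p)
    have t: "0 \<le> t" "t \<le> s" and x: "\<bar>x\<bar> \<le> B" using p(1) tx by auto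
    have "G (s, \<xi>) = \<epsilon> / 2" using \<open>\<delta> * s = \<epsilon> / 2\<close> by (simp add: G_def \<epsilon>_def)
    with p(2)[OF \<open>(s, \<xi>) \<in> _\<close>] have "\<epsilon> / 2 \<le> F t x - \<delta> * t" by (simp add: G_def tx)
    moreover have "0 \<le> \<delta> * t" using t \<open>\<delta> > 0\<close> by simp
    ultimately have Ft: "F t x \<ge> \<epsilon> / 2" by linarith
    have "t > 0" using Ft init[of x] t \<epsilon> by (cases "t = 0") auto
    have "\<bar>x\<bar> < B0" using B0[rule_format, of t x] Ft t \<epsilon> by (cases "B0 \<le> \<bar>x\<bar>") auto
    have "Fx t x = 0"
    proof (rule DERIV_local_max[OF dFx])
      show "0 < B0 - \<bar>x\<bar>" using \<open>\<bar>x\<bar> < B0\<close> by simp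
      show "\<forall>y. \<bar>x - y\<bar> < B0 - \<bar>x\<bar> \<longrightarrow> F t y \<le> F t x"
      proof (intro allI impI)
        fix y assume "\<bar>x - y\<bar> < B0 - \<bar>x\<bar>"
        then have "(t, y) \<in> {0..s} \<times> {-B..B}" using t by (auto simp: B_def)
        from p(2)[OF this] show "F t y \<le> F t x" by (simp add: G_def tx)
      qed
    qed
    with slope[of t x] Ft \<epsilon> t have "Fs t x \<le> 0" by simp
    have "((\<lambda>t. F t x - \<delta> * t) has_real_derivative (Fs t x - \<delta>)) (at t)"
      by (auto intro!: derivative_eq_intros dFs)
    \<comment> \<open>The maximum may lie on the edge t = s, so the contradiction uses smaller
      values of \<open>t\<close> only, which exist as t > 0.\<close>
    from DERIV_neg_dec_left[OF this] \<open>Fs t x \<le> 0\<close> \<open>\<delta> > 0\<close>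
    obtain d where d: "d > 0" "\<And>h. 0 < h \<Longrightarrow> h < d \<Longrightarrow> F t x - \<delta> * t < F (t - h) x - \<delta> * (t - h)" by auto
    define h where "h = min (d / 2) t"
    have h: "0 < h" "h < d" "h \<le> t" using d(1) \<open>t > 0\<close> by (auto simp: h_def)
    then have "(t - h, x) \<in> {0..s} \<times> {-B..B}" using t x by auto
    from p(2)[OF this] d(2)[OF h(1,2)] show False by (simp add: G_def tx)
  qed
  then show ?thesis by (simp add: F_def)
qed

section \<open>Maximality of the boundary influence at zero field\<close>

text \<open>The value 1 off \<open>A\<close>, in place of \<open>undefined\<close>, makes this a
  group under pointwise multiplication that grows with \<open>A\<close>, and it is the plus boundary
  condition for edges that leave \<open>A\<close>.\<close>

definition spins :: "'a set \<Rightarrow> ('a \<Rightarrow> real) set" where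
  "spins A = {\<sigma>. (\<forall>x\<in>A. \<sigma> x = 1 \<or> \<sigma> x = -1) \<and> (\<forall>x. x \<notin> A \<longrightarrow> \<sigma> x = 1)}"

lemma spins_insert:
  assumes "x \<notin> A"
  shows "spins (insert x A) = spins A \<union> (\<lambda>\<sigma>. \<sigma>(x := -1)) ` spins A"
proof (intro equalityI subsetI)
  fix \<sigma> assume s: "\<sigma> \<in> spins (insert x A)"
  show "\<sigma> \<in> spins A \<union> (\<lambda>\<sigma>. \<sigma>(x := -1)) ` spins A"
  proof (cases "\<sigma> x = 1")
    case True
    then have "\<sigma> \<in> spins A" using s by (auto simp: spins_def)
    then show ?thesis by blast
  next
    case False
    have "\<sigma>(x := 1) \<in> spins A" using s assms by (auto simp: spins_def)
    moreover have "\<sigma> = (\<sigma>(x := 1))(x := -1)" using False s by (auto simp: spins_def)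
    ultimately show ?thesis by blast
  qed
next
  fix \<sigma> :: "'a \<Rightarrow> real" assume "\<sigma> \<in> spins A \<union> (\<lambda>\<sigma>. \<sigma>(x := -1)) ` spins A"
  then show "\<sigma> \<in> spins (insert x A)"
    using assms by (fastforce simp: spins_def)
qed

lemma spins_empty [simp]: "spins {} = {\<lambda>_. 1}"
  by (auto simp: spins_def)

lemma finite_spins [simp]: "finite A \<Longrightarrow> finite (spins A)"
  by (induction A rule: finite_induct) (simp_all add: spins_insert)

lemma spins_nonempty [simp]: "spins A \<noteq> {}"
  by (rule ex_in_conv[THEN iffD1]) (rule exI[of _ "\<lambda>_. 1"], simp add: spins_def)

lemma sum_spins_insert:
  assumes "finite A" "x \<notin> A"
  shows "(\<Sum>\<sigma>\<in>spins (insert x A). f \<sigma>) = (\<Sum>\<sigma>\<in>spins A. f \<sigma>) + (\<Sum>\<sigma>\<in>spins A. f (\<sigma>(x := -1)))"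
proof -
  have "inj_on (\<lambda>\<sigma>. \<sigma>(x := -1)) (spins A)"
  proof (rule inj_onI)
    fix \<sigma> \<tau> :: "'a \<Rightarrow> real"
    assume "\<sigma> \<in> spins A" "\<tau> \<in> spins A" "\<sigma>(x := -1) = \<tau>(x := -1)"
    then have "\<sigma> z = \<tau> z" for z
      using assms(2) by (cases "z = x") (auto simp: spins_def dest: fun_cong[where x = z])
    then show "\<sigma> = \<tau>" by blast
  qed
  moreover have "spins A \<inter> (\<lambda>\<sigma>. \<sigma>(x := -1)) ` spins A = {}"
    using assms(2) by (auto simp: spins_def dest: fun_cong[where x = x])
  ultimately show ?thesis
    using assms by (simp add: spins_insert sum.union_disjoint sum.reindex)
qed

text \<open>Any two sites may be coupled and every site carries a field, so that fixing a spin leads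
  back to the same form on fewer sites.\<close>

definition field_Z :: "('a set \<Rightarrow> real) \<Rightarrow> 'a set \<Rightarrow> ('a \<Rightarrow> real) \<Rightarrow> real" where
  "field_Z J A h = (\<Sum>\<sigma>\<in>spins A.
     exp ((\<Sum>e | e \<subseteq> A \<and> card e = 2. J e * (\<Prod>x\<in>e. \<sigma> x)) + (\<Sum>x\<in>A. h x * \<sigma> x)))"

lemma field_Z_pos: "finite A \<Longrightarrow> field_Z J A h > 0"
  unfolding field_Z_def by (intro sum_pos) auto

lemma field_Z_cong: "(\<And>x. x \<in> A \<Longrightarrow> h x = h' x) \<Longrightarrow> field_Z J A h = field_Z J A h'"
  by (simp add: field_Z_def)

lemma sum_pairs_insert:
  fixes g :: "'a set \<Rightarrow> real"
  assumes "finite A" "x \<notin> A"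
  shows "(\<Sum>e | e \<subseteq> insert x A \<and> card e = 2. g e) = (\<Sum>e | e \<subseteq> A \<and> card e = 2. g e) + (\<Sum>y\<in>A. g {x, y})"
proof -
  have eq: "{e. e \<subseteq> insert x A \<and> card e = 2} = {e. e \<subseteq> A \<and> card e = 2} \<union> (\<lambda>y. {x, y}) ` A"
  proof (intro equalityI subsetI)
    fix e assume e: "e \<in> {e. e \<subseteq> insert x A \<and> card e = 2}"
    show "e \<in> {e. e \<subseteq> A \<and> card e = 2} \<union> (\<lambda>y. {x, y}) ` A"
    proof (cases "x \<in> e")
      case True
      with e obtain y where "e = {x, y}" "y \<noteq> x"
        by (auto simp: card_2_iff)
      with e show ?thesis by auto
    qed (use e in auto)
  qed (use assms in \<open>auto simp: card_insert_if\<close>)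
  have inj: "inj_on (\<lambda>y. {x, y}) A"
    using assms(2) by (auto intro!: inj_onI simp: doubleton_eq_iff)
  have fin: "finite {e. e \<subseteq> A \<and> card e = 2}"
    using assms(1) by (auto intro: finite_subset[of _ "Pow A"])
  show ?thesis
    unfolding eq using assms inj fin
    by (subst sum.union_disjoint) (auto simp: sum.reindex)
qed

lemmas fun_ops = plus_fun_def fun_diff_def fun_Compl_def zero_fun_def

text \<open>The field exerted on \<open>y\<close> by a spin 1 at \<open>x\<close>. Fixing the spin
  at \<open>x\<close> adds this function, or its negative, to the external field.\<close>

definition neighbour_field :: "('a set \<Rightarrow> real) \<Rightarrow> 'a \<Rightarrow> 'a \<Rightarrow> real" where
  "neighbour_field J x y = J {x, y}"

lemma prod_spin_upd:
  fixes \<sigma> :: "'a \<Rightarrow> real"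
  assumes "x \<notin> e"
  shows "(\<Prod>z\<in>e. (\<sigma>(x := c)) z) = (\<Prod>z\<in>e. \<sigma> z)"
  by (rule prod.cong) (use assms in auto)

lemma field_weight_insert:
  fixes \<sigma> :: "'a \<Rightarrow> real"
  assumes "finite A" "x \<notin> A" 
  shows "(\<Sum>e | e \<subseteq> insert x A \<and> card e = 2. J e * (\<Prod>z\<in>e. (\<sigma>(x := c)) z)) + (\<Sum>z\<in>insert x A. h z * (\<sigma>(x := c)) z)
    = c * h x + ((\<Sum>e | e \<subseteq> A \<and> card e = 2. J e * (\<Prod>z\<in>e. \<sigma> z)) + (\<Sum>z\<in>A. (h z + c * J {x, z}) * \<sigma> z))"
proof -
  have "(\<Sum>e | e \<subseteq> A \<and> card e = 2. J e * (\<Prod>z\<in>e. (\<sigma>(x := c)) z)) = (\<Sum>e | e \<subseteq> A \<and> card e = 2. J e * (\<Prod>z\<in>e. \<sigma> z))"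
    using assms by (intro sum.cong refl) (subst prod_spin_upd, auto)
  moreover have "(\<Sum>y\<in>A. J {x, y} * (\<Prod>z\<in>{x, y}. (\<sigma>(x := c)) z)) = (\<Sum>y\<in>A. c * J {x, y} * \<sigma> y)"
    using assms by (intro sum.cong refl) (subst prod.insert, auto)
  moreover have "(\<Sum>z\<in>A. h z * (\<sigma>(x := c)) z) = (\<Sum>z\<in>A. h z * \<sigma> z)"
    using assms by (intro sum.cong) auto
  ultimately show ?thesis
    using assms by (simp add: sum_pairs_insert sum.distrib distrib_right del: fun_upd_apply) simp
qed

lemma field_sum_insert:
  assumes "finite A" "x \<notin> A"
  shows "(\<Sum>\<sigma>\<in>spins (insert x A). g (\<sigma> x) * exp ((\<Sum>e | e \<subseteq> insert x A \<and> card e = 2. J e * (\<Prod>z\<in>e. \<sigma> z)) + (\<Sum>z\<in>insert x A. h z * \<sigma> z)))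
    = g 1 * (exp (h x) * field_Z J A (h + neighbour_field J x)) + g (-1) * (exp (- h x) * field_Z J A (h - neighbour_field J x))"
    (is "sum (\<lambda>\<sigma>. g (\<sigma> x) * exp (?e \<sigma>)) _ = _")
proof -
  have "g (\<sigma> x) * exp (?e \<sigma>) = g 1 * (exp (h x) * exp ((\<Sum>e | e \<subseteq> A \<and> card e = 2. J e * (\<Prod>x\<in>e. \<sigma> x)) + (\<Sum>z\<in>A. (h + neighbour_field J x) z * \<sigma> z)))"
    if "\<sigma> \<in> spins A" for \<sigma>
  proof -
    have "\<sigma>(x := 1) = \<sigma>" "\<sigma> x = 1" using that assms by (auto simp: spins_def)
    with field_weight_insert[OF assms, of J \<sigma> 1 h] show ?thesis
      by (simp only:) (simp add: exp_add neighbour_field_def)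
  qed
  moreover have "g ((\<sigma>(x := -1)) x) * exp (?e (\<sigma>(x := -1))) = g (-1) * (exp (- h x) * exp ((\<Sum>e | e \<subseteq> A \<and> card e = 2. J e * (\<Prod>x\<in>e. \<sigma> x)) + (\<Sum>z\<in>A. (h - neighbour_field J x) z * \<sigma> z)))"
    for \<sigma>
    using field_weight_insert[OF assms, of J \<sigma> "-1" h]
    by (simp only:) (simp add: exp_add[symmetric] neighbour_field_def)
  ultimately show ?thesis
    using assms by (simp add: sum_spins_insert field_Z_def sum_distrib_left del: fun_upd_apply)
qed

lemma field_Z_insert:
  assumes "finite A" "x \<notin> A"
  shows "field_Z J (insert x A) h = exp (h x) * field_Z J A (h + neighbour_field J x) + exp (- h x) * field_Z J A (h - neighbour_field J x)"
  using field_sum_insert[OF assms, of "\<lambda>_. 1"] by (simp add: field_Z_def)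

lemma field_Z_uminus: "finite A \<Longrightarrow> field_Z J A (- h) = field_Z J A h"
proof (induction A arbitrary: h rule: finite_induct)
  case (insert x A)
  have "field_Z J A (- h + neighbour_field J x) = field_Z J A (h - neighbour_field J x)"
    "field_Z J A (- h - neighbour_field J x) = field_Z J A (h + neighbour_field J x)"
    using insert.IH[of "h - neighbour_field J x"] insert.IH[of "h + neighbour_field J x"] by (simp_all add: fun_ops)
  then show ?case using insert.hyps by (simp add: field_Z_insert fun_ops)
qed (simp add: field_Z_def)

text \<open>Multiply by \<open>a\<close> and use (a - c) (a - d) \<ge> 0. It serves for sums of
  mixed terms of which one side controls each term by \<open>a\<close> and their product.\<close>

lemma four_products_sum_le:
  fixes a b c d :: real
  assumes "c \<le> a" "d \<le> a" "c * d \<le> a * b" "a > 0"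
  shows "c + d \<le> a + b"
proof -
  have "0 \<le> (a - c) * (a - d)" using assms by simp
  then have "a * (c + d) \<le> a * (a + b)" using assms(3) by (simp add: algebra_simps)
  then show ?thesis using assms(4) by simp
qed

text \<open>Positive correlation of two extra spins coupled to \<open>A\<close> by \<open>u\<close>
  and \<open>v\<close>: the four factors are their partition functions for the states (+,-), (-,+),
  (+,+) and (-,-). The sites of \<open>A\<close> are summed out one at a time in both
  factors.\<close>

lemma field_Z_supermodular:
  assumes "finite A" and J: "\<And>e. J e \<ge> 0"
    and "\<And>x. x \<in> A \<Longrightarrow> u x \<ge> 0" "\<And>x. x \<in> A \<Longrightarrow> v x \<ge> 0"
  shows "field_Z J A (h + u - v) * field_Z J A (h - u + v) \<le> field_Z J A (h + u + v) * field_Z J A (h - u - v)"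
  using assms(1,3,4)
proof (induction A arbitrary: h u v rule: finite_induct)
  case (insert x A)
  let ?Z = "field_Z J A" and ?w = "neighbour_field J x"
  note pos = field_Z_pos[OF insert.hyps(1), of J]
  note IH = insert.IH
  have uv: "u y \<ge> 0" "v y \<ge> 0" "?w y \<ge> 0" if "y \<in> A" for y
    using insert.prems that J by (auto simp: neighbour_field_def)
  have "u x \<ge> 0" "v x \<ge> 0" using insert.prems by auto
  define y1 y2 y3 y4 y5 y6 y7 y8 where
    "y1 = exp (h x + u x + v x) * ?Z (h + u + v + ?w)" and
    "y2 = exp (- (h x + u x + v x)) * ?Z (h + u + v - ?w)" and
    "y3 = exp (h x + u x - v x) * ?Z (h + u - v + ?w)" and
    "y4 = exp (- (h x + u x - v x)) * ?Z (h + u - v - ?w)" and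
    "y5 = exp (h x - u x - v x) * ?Z (h - u - v + ?w)" and
    "y6 = exp (- (h x - u x - v x)) * ?Z (h - u - v - ?w)" and
    "y7 = exp (h x - u x + v x) * ?Z (h - u + v + ?w)" and
    "y8 = exp (- (h x - u x + v x)) * ?Z (h - u + v - ?w)"
  note y = y1_def y2_def y3_def y4_def y5_def y6_def y7_def y8_def
  have ypos: "y1 > 0" "y2 > 0" "y3 > 0" "y4 > 0" "y5 > 0" "y6 > 0" "y7 > 0" "y8 > 0"
    unfolding y using pos by simp_all
  have e: "exp a * s * (exp b * t) = exp (a + b) * (s * t)" for a b s t :: real
    by (simp add: exp_add)
  have 15: "y3 * y7 \<le> y1 * y5"
    using IH[of u v "h + ?w"] uv unfolding y e
    by (simp add: algebra_simps fun_ops)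
  have 26: "y4 * y8 \<le> y2 * y6"
    using IH[of u v "h - ?w"] uv unfolding y e
    by (simp add: algebra_simps fun_ops)
  \<comment> \<open>Where the two factors have opposite values at \<open>x\<close>, the field of
    \<open>x\<close> is absorbed into \<open>u\<close>; in the next step it is absorbed into
    \<open>v\<close>.\<close>
  have 16: "y3 * y8 \<le> y1 * y6"
  proof -
    have "?Z (h + u - v + ?w) * ?Z (h - u + v - ?w) \<le> ?Z (h + u + v + ?w) * ?Z (h - u - v - ?w)"
      using IH[of "u + ?w" v h] uv by (simp add: algebra_simps fun_ops)
    then show ?thesis unfolding y e
      using \<open>u x \<ge> 0\<close> \<open>v x \<ge> 0\<close> pos by (rule_tac mult_mono) (simp_all add: less_imp_le)
  qed
  have m16: "y4 * y7 \<le> y1 * y6"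
  proof -
    have "?Z (h + u - v - ?w) * ?Z (h - u + v + ?w) \<le> ?Z (h + u + v + ?w) * ?Z (h - u - v - ?w)"
      using IH[of "v + ?w" u h] uv by (simp add: algebra_simps fun_ops)
    then show ?thesis unfolding y e
      using \<open>u x \<ge> 0\<close> \<open>v x \<ge> 0\<close> pos by (rule_tac mult_mono) (simp_all add: less_imp_le)
  qed
  have "y3 * y8 + y4 * y7 \<le> y1 * y6 + y2 * y5"
  proof (rule four_products_sum_le)
    have "(y3 * y7) * (y4 * y8) \<le> (y1 * y5) * (y2 * y6)"
      using 15 26 ypos by (rule_tac mult_mono) auto
    then show "y3 * y8 * (y4 * y7) \<le> y1 * y6 * (y2 * y5)" by (simp add: algebra_simps)
  qed (use 16 m16 ypos in auto)
  with 15 26 have "(y3 + y4) * (y7 + y8) \<le> (y1 + y2) * (y5 + y6)"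
    by (simp add: algebra_simps)
  then show ?case
    unfolding field_Z_insert[OF insert.hyps] y by (simp add: algebra_simps fun_ops)
qed (simp add: field_Z_def)

text \<open>\<open>u\<close> and \<open>v\<close> are the couplings of origin and ghost, which are
  not sites of \<open>A\<close>, so the four factors with \<open>h\<close> form the cross ratio. A
  coupling between origin and ghost themselves would enter both sides equally. At zero field the
  global flip produces the squares.\<close>

lemma field_Z_product_le:
  assumes "finite A" and J: "\<And>e. J e \<ge> 0"
    and "\<And>x. x \<in> A \<Longrightarrow> u x \<ge> 0" "\<And>x. x \<in> A \<Longrightarrow> v x \<ge> 0"
  shows "field_Z J A (h + u + v) * field_Z J A (h - u - v) * (field_Z J A (u - v))\<^sup>2
    \<le> field_Z J A (h + u - v) * field_Z J A (h - u + v) * (field_Z J A (u + v))\<^sup>2"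
  using assms(1,3,4)
proof (induction "card A" arbitrary: A h u v rule: less_induct)
  case less
  note J = assms(2)
  note card_IH = less.hyps
  have "finite A" by fact
  from less.prems(2) less.prems(3) show ?case
  proof (induction "card {x \<in> A. u x \<noteq> 0}" arbitrary: u h rule: less_induct)
    case (less u h)
    show ?case
    proof (cases "\<forall>x\<in>A. u x = 0")
      case True
      have "field_Z J A (h + u + v) = field_Z J A (h + v)" "field_Z J A (h - u - v) = field_Z J A (h - v)"
        "field_Z J A (h + u - v) = field_Z J A (h - v)" "field_Z J A (h - u + v) = field_Z J A (h + v)"
        "field_Z J A (u - v) = field_Z J A (- v)" "field_Z J A (u + v) = field_Z J A v"
        using True by (auto intro!: field_Z_cong)
      then show ?thesis using field_Z_uminus[OF \<open>finite A\<close>, of J v] by simp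
    next
      case False
      then obtain y where y: "y \<in> A" "u y \<noteq> 0" by blast
      define A' where "A' = A - {y}"
      have A': "finite A'" "y \<notin> A'" "A = insert y A'" using y \<open>finite A\<close> by (auto simp: A'_def)
      have card: "card A' < card A" using y \<open>finite A\<close> unfolding A'_def by (rule_tac card_Diff1_less) auto
      define s where "s = u y"
      have "s \<ge> 0" using less.prems y by (simp add: s_def)
      let ?Z = "field_Z J A'" and ?w = "neighbour_field J y"
      note pos = field_Z_pos[OF A'(1), of J]
      have uv: "u z \<ge> 0" "v z \<ge> 0" "?w z \<ge> 0" if "z \<in> A'" for z
        using less.prems that J A'(3) by (auto simp: neighbour_field_def)
      have "v y \<ge> 0" using less.prems(2) y by simp
      define y1 y2 y3 y4 y5 y6 y7 y8 L1 L2 L3 L4 where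
        "y1 = exp (h y + v y) * ?Z (h + u + v + ?w)" and
        "y2 = exp (- (h y + v y)) * ?Z (h + u + v - ?w)" and
        "y3 = exp (h y - v y) * ?Z (h + u - v + ?w)" and
        "y4 = exp (- (h y - v y)) * ?Z (h + u - v - ?w)" and
        "y5 = exp (h y - v y) * ?Z (h - u - v + ?w)" and
        "y6 = exp (- (h y - v y)) * ?Z (h - u - v - ?w)" and
        "y7 = exp (h y + v y) * ?Z (h - u + v + ?w)" and
        "y8 = exp (- (h y + v y)) * ?Z (h - u + v - ?w)" and
        "L1 = exp (v y) * ?Z (u + v + ?w)" and
        "L2 = exp (- v y) * ?Z (u + v - ?w)" and
        "L3 = exp (- v y) * ?Z (u - v + ?w)" and
        "L4 = exp (v y) * ?Z (u - v - ?w)"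
      note Y = y1_def y2_def y3_def y4_def y5_def y6_def y7_def y8_def L1_def L2_def L3_def L4_def
      have ypos: "y1 > 0" "y2 > 0" "y3 > 0" "y4 > 0" "y5 > 0" "y6 > 0" "y7 > 0" "y8 > 0"
        "L1 > 0" "L2 > 0" "L3 > 0" "L4 > 0"
        unfolding Y using pos by simp_all
      have e: "exp a * s * (exp b * t) = exp (a + b) * (s * t)" for a b s t :: real
        by (simp add: exp_add)
      have e2: "(exp a * s)\<^sup>2 = exp (2 * a) * s\<^sup>2" for a s :: real
        by (simp add: power_mult_distrib exp_double)
      have insA: "field_Z J A g = exp (g y) * ?Z (g + ?w) + exp (- g y) * ?Z (g - ?w)" for g
        unfolding A'(3) by (rule field_Z_insert[OF A'(1,2)])
      \<comment> \<open>\<open>U t\<close> replaces the coupling between origin and \<open>y\<close>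
        by t, and \<open>H \<xi>\<close> shifts the field at \<open>y\<close>. At t = 0 the inner
        induction hypothesis holds for every \<open>\<xi>\<close>, since \<open>h\<close> is
        arbitrary in it.\<close>
      define U where "U = (\<lambda>t. u(y := t))"
      define H where "H = (\<lambda>\<xi>. h(y := h y + \<xi>))"
      have split: "field_Z J A g = exp (g y) * ?Z (k + ?w) + exp (- g y) * ?Z (k - ?w)"
        if "\<And>z. z \<in> A' \<Longrightarrow> g z = k z" for g k
        unfolding insA using that by (intro arg_cong2[where f = "(+)"] arg_cong2[where f = "(*)"] refl field_Z_cong) auto
      have off: "z \<noteq> y" if "z \<in> A'" for z using that A'(2) by blast
      have Zlse: "field_Z J A g = exp (lse (exp \<alpha> * ?Z (k + ?w)) (exp (- \<alpha>) * ?Z (k - ?w)) \<tau>)"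
        if g: "g y = \<alpha> + \<tau>" "\<And>z. z \<in> A' \<Longrightarrow> g z = k z" for g \<alpha> k \<tau>
      proof -
        have "exp (- (\<alpha> + \<tau>)) = exp (- \<alpha>) * exp (- \<tau>)" by (simp add: exp_add[symmetric])
        then show ?thesis using pos split[of g k, OF g(2)] by (simp add: g(1) exp_lse exp_add[of \<alpha> \<tau>])
      qed
      have Z: "field_Z J A (H \<xi> + U t + v) = exp (lse y1 y2 (\<xi> + t))"
        "field_Z J A (H \<xi> - U t - v) = exp (lse y5 y6 (\<xi> - t))"
        "field_Z J A (H \<xi> + U t - v) = exp (lse y3 y4 (\<xi> + t))"
        "field_Z J A (H \<xi> - U t + v) = exp (lse y7 y8 (\<xi> - t))"
        "field_Z J A (U t + v) = exp (lse L1 L2 t)" for \<xi> t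
        unfolding Y by (rule Zlse; use off in \<open>simp add: H_def U_def\<close>)+
      have Z': "field_Z J A (U t - v) = exp (lse L3 L4 t)" for t
        unfolding Y using Zlse[of "U t - v" "- v y" t "u - v"] off by (simp add: U_def)
      note Z = Z Z'
      have cmp: "exp a * exp b * (exp c)\<^sup>2 \<le> exp a' * exp b' * (exp c')\<^sup>2 \<longleftrightarrow> a - a' + (b - b') + 2 * (c - c') \<le> 0" for a b c a' b' c' :: real
        unfolding exp_double[symmetric] exp_add[symmetric] exp_le_cancel_iff by auto
      have "lse y1 y2 (0 + s) - lse y3 y4 (0 + s) + (lse y5 y6 (0 - s) - lse y7 y8 (0 - s)) + 2 * (lse L3 L4 s - lse L1 L2 s) \<le> 0"
      proof (rule three_spin_comparison[OF ypos])
        show "s \<ge> 0" by fact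
        show "y2 * y5 \<le> y1 * y6"
          unfolding Y e using field_Z_supermodular[of A' J "u + v" ?w h] A'(1) J uv
          by (auto intro!: mult_mono simp: less_imp_le[OF pos] \<open>v y \<ge> 0\<close> algebra_simps fun_ops)
        show "L2 * L3 \<le> L1 * L4"
          unfolding Y e using field_Z_supermodular[of A' J v ?w u] A'(1) J uv
          by (auto intro!: mult_mono simp: less_imp_le[OF pos] \<open>v y \<ge> 0\<close> algebra_simps fun_ops)
        show "y1 * y6 * L2\<^sup>2 \<le> y2 * y5 * L1\<^sup>2"
        proof -
          \<comment> \<open>Origin and ghost merged into one spin with coupling u + v; the second
            spin is \<open>y\<close>.\<close>
          have "?Z (h + (u + v) + ?w) * ?Z (h - (u + v) - ?w) * (?Z ((u + v) - ?w))\<^sup>2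
            \<le> ?Z (h + (u + v) - ?w) * ?Z (h - (u + v) + ?w) * (?Z ((u + v) + ?w))\<^sup>2"
            by (rule card_IH[OF card A'(1)]) (use uv in auto)
          then show ?thesis unfolding Y e e2 by (simp add: exp_add[symmetric] algebra_simps)
        qed
        show "y1 * y6 * L3\<^sup>2 \<le> y3 * y8 * L1\<^sup>2"
        proof -
          \<comment> \<open>The origin merged with \<open>y\<close>, against the ghost.\<close>
          have "?Z (h + (u + ?w) + v) * ?Z (h - (u + ?w) - v) * (?Z ((u + ?w) - v))\<^sup>2
            \<le> ?Z (h + (u + ?w) - v) * ?Z (h - (u + ?w) + v) * (?Z ((u + ?w) + v))\<^sup>2"
            by (rule card_IH[OF card A'(1)]) (use uv in auto)
          then show ?thesis unfolding Y e e2 by (simp add: exp_add[symmetric] algebra_simps)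
        qed
        show "lse y1 y2 \<xi> - lse y3 y4 \<xi> + (lse y5 y6 \<xi> - lse y7 y8 \<xi>) + 2 * (lse L3 L4 0 - lse L1 L2 0) \<le> 0" for \<xi>
        proof -
          have "{x \<in> A. U 0 x \<noteq> 0} \<subset> {x \<in> A. u x \<noteq> 0}" using y by (auto simp: U_def)
          then have "card {x \<in> A. U 0 x \<noteq> 0} < card {x \<in> A. u x \<noteq> 0}"
            using \<open>finite A\<close> by (intro psubset_card_mono) auto
          then have "field_Z J A (H \<xi> + U 0 + v) * field_Z J A (H \<xi> - U 0 - v) * (field_Z J A (U 0 - v))\<^sup>2
              \<le> field_Z J A (H \<xi> + U 0 - v) * field_Z J A (H \<xi> - U 0 + v) * (field_Z J A (U 0 + v))\<^sup>2"
            by (rule less.hyps) (use less.prems in \<open>auto simp: U_def\<close>)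
          then show ?thesis unfolding Z cmp by simp
        qed
      qed
      then have "field_Z J A (H 0 + U s + v) * field_Z J A (H 0 - U s - v) * (field_Z J A (U s - v))\<^sup>2
        \<le> field_Z J A (H 0 + U s - v) * field_Z J A (H 0 - U s + v) * (field_Z J A (U s + v))\<^sup>2"
        unfolding Z cmp by simp
      moreover have "H 0 = h" "U s = u" by (auto simp: H_def U_def s_def)
      ultimately show ?thesis by simp
    qed
  qed
qed


section \<open>From the cross ratio to the difference of means\<close>

definition field_mean :: "('a set \<Rightarrow> real) \<Rightarrow> 'a set \<Rightarrow> 'a \<Rightarrow> ('a \<Rightarrow> real) \<Rightarrow> real" where
  "field_mean J B p h = (\<Sum>\<sigma>\<in>spins B. \<sigma> p *
     exp ((\<Sum>e | e \<subseteq> B \<and> card e = 2. J e * (\<Prod>x\<in>e. \<sigma> x)) + (\<Sum>x\<in>B. h x * \<sigma> x))) / field_Z J B h"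

lemma field_mean_remove:
  assumes "finite A" "p \<notin> A"
  shows "field_mean J (insert p A) p g
    = (exp (g p) * field_Z J A (g + neighbour_field J p) - exp (- g p) * field_Z J A (g - neighbour_field J p))
      / (exp (g p) * field_Z J A (g + neighbour_field J p) + exp (- g p) * field_Z J A (g - neighbour_field J p))"
  unfolding field_mean_def field_Z_insert[OF assms] using field_sum_insert[OF assms, of "\<lambda>x. x" J g] by simp

text \<open>With p^2 = a d and q^2 = b c the left side equals 2 (p^2 - q^2) / ((a + b) (c + d)), and
  (a + b) (c + d) \<ge> (p + q)^2 by the inequality of arithmetic and geometric means. For q \<le> p
  this bounds it by 2 (p - q) / (p + q), which increases with the cross ratio and is attained by the
  symmetric weights on the right.\<close>

lemma cross_ratio_mean_difference:
  fixes a b c d a0 b0 :: real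
  assumes pos: "a > 0" "b > 0" "c > 0" "d > 0" "a0 > 0" "b0 > 0"
    and "a * d * b0\<^sup>2 \<le> b * c * a0\<^sup>2" "b0 \<le> a0"
  shows "(a - b) / (a + b) - (c - d) / (c + d) \<le> (a0 - b0) / (a0 + b0) - (b0 - a0) / (b0 + a0)"
proof -
  define p q where "p = sqrt (a * d)" and "q = sqrt (b * c)"
  have pq: "p > 0" "q > 0" "p\<^sup>2 = a * d" "q\<^sup>2 = b * c" using pos by (simp_all add: p_def q_def)
  have "(p * b0)\<^sup>2 \<le> (q * a0)\<^sup>2" using assms(7) pq by (simp add: power_mult_distrib)
  then have "p * b0 \<le> q * a0" by (rule power2_le_imp_le) (use pos pq in auto)
  have "(a - b) / (a + b) - (c - d) / (c + d) = 2 * (p\<^sup>2 - q\<^sup>2) / ((a + b) * (c + d))"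
    unfolding pq using pos by (simp add: field_simps)
  also have "\<dots> \<le> 2 * (a0 - b0) / (a0 + b0)"
  proof (cases "q \<le> p")
    case True
    have "2 * p * q \<le> a * c + b * d"
    proof -
      have "2 * p * q = 2 * (sqrt (a * c) * sqrt (b * d))" using pos by (simp add: p_def q_def real_sqrt_mult)
      also have "\<dots> \<le> (sqrt (a * c))\<^sup>2 + (sqrt (b * d))\<^sup>2" using sum_squares_bound[of "sqrt (a * c)" "sqrt (b * d)"] by simp
      finally show ?thesis using pos by simp
    qed
    then have "(p + q)\<^sup>2 \<le> (a + b) * (c + d)" unfolding power2_sum pq by (simp add: algebra_simps)
    moreover have "0 \<le> p\<^sup>2 - q\<^sup>2" using True pq(1,2) by (simp add: power_mono)
    ultimately have "2 * (p\<^sup>2 - q\<^sup>2) / ((a + b) * (c + d)) \<le> 2 * (p\<^sup>2 - q\<^sup>2) / (p + q)\<^sup>2"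
      using pq pos by (intro divide_left_mono) auto
    also have "\<dots> = 2 * (p - q) / (p + q)"
    proof -
      have "p\<^sup>2 - q\<^sup>2 = (p - q) * (p + q)" by (simp add: power2_eq_square algebra_simps)
      then show ?thesis using pq(1,2) by (simp add: power2_eq_square)
    qed
    also have "\<dots> \<le> 2 * (a0 - b0) / (a0 + b0)"
      using \<open>p * b0 \<le> q * a0\<close> pq(1,2) pos by (simp add: divide_simps) (simp add: algebra_simps)
    finally show ?thesis .
  next
    case False
    then have "p\<^sup>2 \<le> q\<^sup>2" using pq by (intro power_mono) auto
    then have "2 * (p\<^sup>2 - q\<^sup>2) / ((a + b) * (c + d)) \<le> 0" using pos by (intro divide_nonpos_pos) auto
    also have "0 \<le> 2 * (a0 - b0) / (a0 + b0)" using assms by simp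
    finally show ?thesis .
  qed
  also have "2 * (a0 - b0) = (a0 - b0) - (b0 - a0)" by simp
  also have "((a0 - b0) - (b0 - a0)) / (a0 + b0) = (a0 - b0) / (a0 + b0) - (b0 - a0) / (b0 + a0)"
    by (simp only: diff_divide_distrib add.commute)
  finally show ?thesis .
qed

lemma field_mean_uminus:
  assumes "finite B" "p \<in> B"
  shows "field_mean J B p (- h) = - field_mean J B p h"
proof -
  define A where "A = B - {p}"
  have A: "finite A" "p \<notin> A" "B = insert p A" using assms by (auto simp: A_def)
  let ?Z = "field_Z J A" and ?w = "neighbour_field J p"
  note mean = field_mean_remove[OF A(1,2), of J, folded A(3)]
  have "?Z (- h + ?w) = ?Z (h - ?w)" "?Z (- h - ?w) = ?Z (h + ?w)"
    using field_Z_uminus[OF A(1), of J "h - ?w"] field_Z_uminus[OF A(1), of J "h + ?w"]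
    by (simp_all add: fun_ops)
  then have "field_mean J B p (- h) = (exp (- h p) * ?Z (h - ?w) - exp (h p) * ?Z (h + ?w)) / (exp (- h p) * ?Z (h - ?w) + exp (h p) * ?Z (h + ?w))"
    unfolding mean by (simp add: fun_Compl_def)
  also have "\<dots> = - field_mean J B p h" unfolding mean by (simp add: add.commute minus_divide_left)
  finally show ?thesis .
qed

text \<open>After all sites but \<open>p\<close> are summed out, \<open>p\<close> and the ghost are
  the two extra spins, with couplings \<open>neighbour_field J p\<close> and \<open>v\<close>. Their
  mutual coupling \<open>v p\<close> and the field \<open>h p\<close> drop out of the comparison of
  cross ratios.\<close>

theorem field_mean_difference_le:
  assumes "finite B" "p \<in> B" and J: "\<And>e. J e \<ge> 0" and v: "\<And>x. x \<in> B \<Longrightarrow> v x \<ge> 0"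
  shows "field_mean J B p (h + v) - field_mean J B p (h - v) \<le> field_mean J B p v - field_mean J B p (- v)"
proof -
  define A where "A = B - {p}"
  have A: "finite A" "p \<notin> A" "B = insert p A" using assms by (auto simp: A_def)
  let ?Z = "field_Z J A" and ?w = "neighbour_field J p"
  note pos = field_Z_pos[OF A(1), of J]
  note mean = field_mean_remove[OF A(1,2), of J, folded A(3)]
  have flip: "?Z (- v + ?w) = ?Z (v - ?w)" "?Z (- v - ?w) = ?Z (v + ?w)"
    using field_Z_uminus[OF A(1), of J "v - ?w"] field_Z_uminus[OF A(1), of J "v + ?w"]
    by (simp_all add: fun_ops)
  have uv: "v x \<ge> 0" "?w x \<ge> 0" if "x \<in> A" for x using v J that A(3) by (auto simp: neighbour_field_def)
  have "v p \<ge> 0" using v assms(2) by simp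
  have main: "?Z (h + v + ?w) * ?Z (h - v - ?w) * (?Z (v - ?w))\<^sup>2 \<le> ?Z (h + v - ?w) * ?Z (h - v + ?w) * (?Z (v + ?w))\<^sup>2"
    by (rule field_Z_product_le[OF A(1) J]) (use uv in auto)
  have "(exp ((h + v) p) * ?Z (h + v + ?w) - exp (- (h + v) p) * ?Z (h + v - ?w)) / (exp ((h + v) p) * ?Z (h + v + ?w) + exp (- (h + v) p) * ?Z (h + v - ?w))
     - (exp ((h - v) p) * ?Z (h - v + ?w) - exp (- (h - v) p) * ?Z (h - v - ?w)) / (exp ((h - v) p) * ?Z (h - v + ?w) + exp (- (h - v) p) * ?Z (h - v - ?w))
    \<le> (exp (v p) * ?Z (v + ?w) - exp (- v p) * ?Z (v - ?w)) / (exp (v p) * ?Z (v + ?w) + exp (- v p) * ?Z (v - ?w))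
      - (exp (- v p) * ?Z (v - ?w) - exp (v p) * ?Z (v + ?w)) / (exp (- v p) * ?Z (v - ?w) + exp (v p) * ?Z (v + ?w))"
  proof (rule cross_ratio_mean_difference)
    have e: "exp a * s * (exp b * t) = exp (a + b) * (s * t)" "(exp a * s)\<^sup>2 = exp (2 * a) * s\<^sup>2" for a b s t :: real
      by (simp_all add: exp_add power_mult_distrib exp_double)
    show "exp ((h + v) p) * ?Z (h + v + ?w) * (exp (- (h - v) p) * ?Z (h - v - ?w)) * (exp (- v p) * ?Z (v - ?w))\<^sup>2
      \<le> exp (- (h + v) p) * ?Z (h + v - ?w) * (exp ((h - v) p) * ?Z (h - v + ?w)) * (exp (v p) * ?Z (v + ?w))\<^sup>2"
      unfolding e using main by (simp add: exp_add[symmetric] algebra_simps)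
    have "(?Z (v - ?w))\<^sup>2 \<le> (?Z (v + ?w))\<^sup>2"
    proof -
      have "?Z (0 + v - ?w) * ?Z (0 - v + ?w) \<le> ?Z (0 + v + ?w) * ?Z (0 - v - ?w)"
        by (rule field_Z_supermodular[OF A(1) J]) (use uv in auto)
      then show ?thesis using flip by (simp add: power2_eq_square)
    qed
    then have "?Z (v - ?w) \<le> ?Z (v + ?w)" by (rule power2_le_imp_le) (simp add: less_imp_le[OF pos])
    then show "exp (- v p) * ?Z (v - ?w) \<le> exp (v p) * ?Z (v + ?w)"
      using \<open>v p \<ge> 0\<close> by (intro mult_mono) (auto simp: less_imp_le[OF pos])
  qed (use pos in auto)
  then show ?thesis unfolding mean flip by (simp add: flip)
qed

section \<open>Random-cluster representation\<close>

definition edge_spin :: "'a set \<Rightarrow> ('a \<Rightarrow> real) \<Rightarrow> real" where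
  "edge_spin e \<sigma> = (\<Prod>x\<in>e. \<sigma> x)"

text \<open>The boundary condition is implicit: an edge that leaves \<open>A\<close> sees the spin 1
  there, and if every edge lies inside \<open>A\<close> the model is free.\<close>

definition ising_sum :: "'a set set \<Rightarrow> 'a set \<Rightarrow> real \<Rightarrow> (('a \<Rightarrow> real) \<Rightarrow> real) \<Rightarrow> real" where
  "ising_sum E A \<beta> f = (\<Sum>\<sigma>\<in>spins A. f \<sigma> * exp (\<beta> * (\<Sum>e\<in>E. edge_spin e \<sigma>)))"

definition ising_mean :: "'a set set \<Rightarrow> 'a set \<Rightarrow> real \<Rightarrow> (('a \<Rightarrow> real) \<Rightarrow> real) \<Rightarrow> real" where
  "ising_mean E A \<beta> f = ising_sum E A \<beta> f / ising_sum E A \<beta> (\<lambda>_. 1)"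

lemma ising_sum_pos: "finite A \<Longrightarrow> ising_sum E A \<beta> (\<lambda>_. 1) > 0"
  unfolding ising_sum_def by (intro sum_pos) auto

lemma spin_cases: "\<sigma> \<in> spins A \<Longrightarrow> \<sigma> x = 1 \<or> \<sigma> x = -1"
  by (auto simp: spins_def)

lemma spin_square: "\<sigma> \<in> spins A \<Longrightarrow> \<sigma> x * \<sigma> x = 1"
  using spin_cases[of \<sigma> A x] by auto

lemma spins_times: "\<sigma> \<in> spins A \<Longrightarrow> \<tau> \<in> spins A \<Longrightarrow> \<sigma> * \<tau> \<in> spins A"
  by (fastforce simp: spins_def)

lemma spins_times_cancel: "\<sigma> \<in> spins A \<Longrightarrow> \<sigma> * (\<sigma> * \<tau>) = \<tau>"
  using spin_square[of \<sigma> A] by (auto simp: fun_eq_iff mult.assoc[symmetric])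

lemma one_in_spins: "1 \<in> spins A"
  by (simp add: spins_def)

lemma spins_mono: "S \<subseteq> A \<Longrightarrow> spins S \<subseteq> spins A"
  by (auto simp: spins_def)

text \<open>Single spins, edge spins and their products are homomorphisms from the group
  \<open>spins A\<close> to {1, -1}; this common property is all that the expansions below need of
  an observable.\<close>

definition character :: "'a set \<Rightarrow> (('a \<Rightarrow> real) \<Rightarrow> real) \<Rightarrow> bool" where
  "character A g \<longleftrightarrow> (\<forall>\<sigma>\<in>spins A. g \<sigma> = 1 \<or> g \<sigma> = -1) \<and> (\<forall>\<sigma>\<in>spins A. \<forall>\<tau>\<in>spins A. g (\<sigma> * \<tau>) = g \<sigma> * g \<tau>)"

lemma character_cases: "character A g \<Longrightarrow> \<sigma> \<in> spins A \<Longrightarrow> g \<sigma> = 1 \<or> g \<sigma> = -1"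
  by (auto simp: character_def)

lemma character_times: "character A g \<Longrightarrow> \<sigma> \<in> spins A \<Longrightarrow> \<tau> \<in> spins A \<Longrightarrow> g (\<sigma> * \<tau>) = g \<sigma> * g \<tau>"
  by (auto simp: character_def)

lemma character_const: "character A (\<lambda>_. 1)"
  by (simp add: character_def)

lemma character_eval: "character A (\<lambda>\<sigma>. \<sigma> x)"
  by (auto simp: character_def dest: spin_cases[of _ _ x])

lemma character_mult:
  assumes "character A g" "character A h"
  shows "character A (\<lambda>\<sigma>. g \<sigma> * h \<sigma>)"
  using assms unfolding character_def by fastforce

lemma character_edge_spin: "character A (edge_spin e)"
proof -
  have "edge_spin e \<sigma> = 1 \<or> edge_spin e \<sigma> = -1" if "\<sigma> \<in> spins A" for \<sigma>
    unfolding edge_spin_def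
    by (induction e rule: infinite_finite_induct) (use spin_cases[OF that] in fastforce)+
  then show ?thesis by (auto simp: character_def edge_spin_def prod.distrib)
qed

text \<open>In the random-cluster representation a set \<open>F\<close> of open edges has weight proportional to the number of spin
  configurations that agree along every edge of \<open>F\<close>. These form the group \<open>frozen F A\<close>, and connectivity can be read
  off from it: \<open>x\<close> is joined to the boundary iff \<open>\<sigma> x = 1\<close> on the whole group, and to \<open>y\<close> iff \<open>\<sigma> x * \<sigma> y = 1\<close>.\<close>

definition frozen :: "'a set set \<Rightarrow> 'a set \<Rightarrow> ('a \<Rightarrow> real) set" where
  "frozen F A = {\<sigma> \<in> spins A. \<forall>e\<in>F. edge_spin e \<sigma> = 1}"

lemma frozen_subset: "frozen F A \<subseteq> spins A"
  by (auto simp: frozen_def)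

lemma finite_frozen: "finite A \<Longrightarrow> finite (frozen F A)"
  by (rule finite_subset[OF frozen_subset]) simp

lemma one_in_frozen: "1 \<in> frozen F A"
  by (simp add: frozen_def one_in_spins edge_spin_def)

lemma card_frozen_pos: "finite A \<Longrightarrow> card (frozen F A) > 0"
  using one_in_frozen[of F A] by (auto simp: card_gt_0_iff finite_frozen)

lemma frozen_times: "\<sigma> \<in> frozen F A \<Longrightarrow> \<tau> \<in> frozen F A \<Longrightarrow> \<sigma> * \<tau> \<in> frozen F A"
  using character_times[OF character_edge_spin, of \<sigma> A \<tau>] by (auto simp: frozen_def spins_times)

lemma frozen_Un: "frozen (F \<union> G) A = frozen F A \<inter> frozen G A"
  by (auto simp: frozen_def)

definition forces :: "('a \<Rightarrow> real) set \<Rightarrow> (('a \<Rightarrow> real) \<Rightarrow> real) \<Rightarrow> bool" where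
  "forces V g \<longleftrightarrow> (\<forall>\<sigma>\<in>V. g \<sigma> = 1)"

text \<open>Orthogonality of characters: if \<open>g\<close> is -1 at some \<open>\<tau>\<close> of
  the group, translation by \<open>\<tau>\<close> reverses the sign of the sum.\<close>

lemma sum_character_frozen:
  assumes "character A g" "finite A"
  shows "(\<Sum>\<sigma>\<in>frozen F A. g \<sigma>) = card (frozen F A) * of_bool (forces (frozen F A) g)"
proof (cases "forces (frozen F A) g")
  case True
  then show ?thesis by (simp add: forces_def)
next
  case False
  then obtain \<tau> where \<tau>: "\<tau> \<in> frozen F A" "g \<tau> \<noteq> 1" by (auto simp: forces_def)
  then have "\<tau> \<in> spins A" using frozen_subset by blast
  with \<tau> assms have "g \<tau> = -1" using character_cases by blast
  have "(\<Sum>\<sigma>\<in>frozen F A. g \<sigma>) = (\<Sum>\<sigma>\<in>frozen F A. g (\<tau> * \<sigma>))"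
    by (rule sum.reindex_bij_witness[of _ "(*) \<tau>" "(*) \<tau>"])
      (auto simp: frozen_times[OF \<tau>(1)] spins_times_cancel[OF \<open>\<tau> \<in> spins A\<close>])
  also have "\<dots> = - (\<Sum>\<sigma>\<in>frozen F A. g \<sigma>)"
    unfolding sum_negf[symmetric]
  proof (rule sum.cong[OF refl])
    fix \<sigma> assume "\<sigma> \<in> frozen F A"
    then show "g (\<tau> * \<sigma>) = - g \<sigma>"
      using character_times[OF assms(1) \<open>\<tau> \<in> spins A\<close>] frozen_subset \<open>g \<tau> = -1\<close> by fastforce
  qed
  finally show ?thesis using False by simp
qed

lemma spins_eq_frozen: "spins A = frozen {} A"
  by (auto simp: frozen_def)

text \<open>The first Griffiths inequality: multiplying out the factors one by one leaves sums of
  characters over the whole group, each of which is 0 or positive.\<close>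

lemma sum_character_nonneg:
  assumes "finite A" "finite I" "character A g" "\<And>e. e \<in> I \<Longrightarrow> a e \<ge> (0::real)" "\<And>e. e \<in> I \<Longrightarrow> b e \<ge> 0"
  shows "(\<Sum>\<sigma>\<in>spins A. g \<sigma> * (\<Prod>e\<in>I. a e + b e * edge_spin e \<sigma>)) \<ge> 0"
  using assms(2-)
proof (induction I arbitrary: g rule: finite_induct)
  case empty
  then show ?case
    using sum_character_frozen[of A g "{}"] assms(1) by (simp add: spins_eq_frozen)
next
  case (insert e I)
  have "(\<Sum>\<sigma>\<in>spins A. g \<sigma> * (\<Prod>e\<in>insert e I. a e + b e * edge_spin e \<sigma>))
    = a e * (\<Sum>\<sigma>\<in>spins A. g \<sigma> * (\<Prod>e\<in>I. a e + b e * edge_spin e \<sigma>))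
      + b e * (\<Sum>\<sigma>\<in>spins A. (g \<sigma> * edge_spin e \<sigma>) * (\<Prod>e\<in>I. a e + b e * edge_spin e \<sigma>))"
    using insert.hyps by (simp add: sum_distrib_left sum.distrib[symmetric] algebra_simps)
  also have "\<dots> \<ge> 0"
    using insert by (intro add_nonneg_nonneg mult_nonneg_nonneg insert.IH character_mult character_edge_spin) auto
  finally show ?case .
qed

text \<open>Edwards--Sokal expansion: an edge factor is exp (- \<beta>) times 1 + (exp (2 \<beta>) -
  1) [the edge spin is 1], and \<open>F\<close> records where the second summand is taken. Summing
  over the spins turns the expectation of a character into the probability that it is
  forced.\<close>

lemma ising_sum_fk:
  assumes "finite A" "finite E" "character A g"
  shows "ising_sum E A \<beta> g = exp (- \<beta>) ^ card E *
    (\<Sum>F\<in>Pow E. (exp (2 * \<beta>) - 1) ^ card F * card (frozen F A) * of_bool (forces (frozen F A) g))"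
proof -
  let ?u = "exp (2 * \<beta>) - 1"
  have edge: "exp (\<beta> * edge_spin e \<sigma>) = exp (- \<beta>) * (?u * of_bool (edge_spin e \<sigma> = 1) + 1)" if "\<sigma> \<in> spins A" for e \<sigma>
    using character_cases[OF character_edge_spin that, of e] by (auto simp: algebra_simps exp_add[symmetric])
  have "exp (\<beta> * (\<Sum>e\<in>E. edge_spin e \<sigma>)) = exp (- \<beta>) ^ card E * (\<Sum>F\<in>Pow E. ?u ^ card F * of_bool (\<sigma> \<in> frozen F A))"
    if "\<sigma> \<in> spins A" for \<sigma>
  proof -
    have "exp (\<beta> * (\<Sum>e\<in>E. edge_spin e \<sigma>)) = (\<Prod>e\<in>E. exp (\<beta> * edge_spin e \<sigma>))"
      using assms(2) by (simp add: sum_distrib_left exp_sum)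
    also have "\<dots> = exp (- \<beta>) ^ card E * (\<Prod>e\<in>E. ?u * of_bool (edge_spin e \<sigma> = 1) + 1)"
      unfolding edge[OF that] by (simp add: prod.distrib)
    also have "(\<Prod>e\<in>E. ?u * of_bool (edge_spin e \<sigma> = 1) + 1) = (\<Sum>F\<in>Pow E. (\<Prod>e\<in>F. ?u * of_bool (edge_spin e \<sigma> = 1)))"
      using assms(2) by (simp add: prod_add)
    also have "\<dots> = (\<Sum>F\<in>Pow E. ?u ^ card F * of_bool (\<sigma> \<in> frozen F A))"
    proof (rule sum.cong[OF refl])
      fix F assume "F \<in> Pow E"
      then have "finite F" using assms(2) finite_subset by auto
      then have "(\<Prod>e\<in>F. of_bool (edge_spin e \<sigma> = 1) :: real) = of_bool (\<sigma> \<in> frozen F A)"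
        by (induction F rule: finite_induct) (auto simp: frozen_def that)
      then show "(\<Prod>e\<in>F. ?u * of_bool (edge_spin e \<sigma> = 1)) = ?u ^ card F * of_bool (\<sigma> \<in> frozen F A)"
        by (simp add: prod.distrib)
    qed
    finally show ?thesis .
  qed
  then have "ising_sum E A \<beta> g = (\<Sum>\<sigma>\<in>spins A. \<Sum>F\<in>Pow E. exp (- \<beta>) ^ card E * (?u ^ card F * (of_bool (\<sigma> \<in> frozen F A) * g \<sigma>)))"
    unfolding ising_sum_def by (intro sum.cong refl) (simp add: sum_distrib_left mult_ac)
  also have "\<dots> = (\<Sum>F\<in>Pow E. exp (- \<beta>) ^ card E * (?u ^ card F * (\<Sum>\<sigma>\<in>spins A. of_bool (\<sigma> \<in> frozen F A) * g \<sigma>)))"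
    by (subst sum.swap) (simp add: sum_distrib_left)
  also have "(\<lambda>F. \<Sum>\<sigma>\<in>spins A. of_bool (\<sigma> \<in> frozen F A) * g \<sigma>) = (\<lambda>F. \<Sum>\<sigma>\<in>frozen F A. g \<sigma>)"
  proof
    fix F
    have "(\<Sum>\<sigma>\<in>spins A. of_bool (\<sigma> \<in> frozen F A) * g \<sigma>) = (\<Sum>\<sigma>\<in>spins A. if \<sigma> \<in> frozen F A then g \<sigma> else 0)"
      by (intro sum.cong) auto
    also have "\<dots> = (\<Sum>\<sigma>\<in>frozen F A. g \<sigma>)"
      using assms(1) frozen_subset[of F A] by (simp add: sum.inter_restrict[symmetric] Int_absorb1)
    finally show "(\<Sum>\<sigma>\<in>spins A. of_bool (\<sigma> \<in> frozen F A) * g \<sigma>) = (\<Sum>\<sigma>\<in>frozen F A. g \<sigma>)" .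
  qed
  finally show ?thesis
    using assms by (simp add: sum_character_frozen sum_distrib_left mult_ac)
qed

text \<open>For subgroups V, W the product of their orders is |VW| |V \<inter> W|. Here V \<inter> W
  is the group of the union, and VW is contained in the group of the intersection.\<close>

lemma card_frozen_supermodular:
  assumes "finite A"
  shows "card (frozen F A) * card (frozen G A) \<le> card (frozen (F \<union> G) A) * card (frozen (F \<inter> G) A)"
proof -
  \<comment> \<open>One factorization is chosen for each product. As it depends on the product
    alone, the pair can be recovered from its image under \<open>\<Phi>\<close>.\<close>
  define rep where "rep z = (SOME \<rho>. \<rho> \<in> frozen F A \<and> \<rho> * z \<in> frozen G A)" for z
  have rep: "rep (\<sigma> * \<tau>) \<in> frozen F A" "rep (\<sigma> * \<tau>) * (\<sigma> * \<tau>) \<in> frozen G A"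
    if "\<sigma> \<in> frozen F A" "\<tau> \<in> frozen G A" for \<sigma> \<tau>
  proof -
    have "\<sigma> \<in> frozen F A \<and> \<sigma> * (\<sigma> * \<tau>) \<in> frozen G A"
      using that frozen_subset by (metis spins_times_cancel subsetD)
    then have "rep (\<sigma> * \<tau>) \<in> frozen F A \<and> rep (\<sigma> * \<tau>) * (\<sigma> * \<tau>) \<in> frozen G A"
      unfolding rep_def by (rule someI[of "\<lambda>\<rho>. \<rho> \<in> frozen F A \<and> \<rho> * (\<sigma> * \<tau>) \<in> frozen G A"])
    then show "rep (\<sigma> * \<tau>) \<in> frozen F A" "rep (\<sigma> * \<tau>) * (\<sigma> * \<tau>) \<in> frozen G A" by auto
  qed
  define \<Phi> where "\<Phi> = (\<lambda>(\<sigma>, \<tau>). (\<sigma> * rep (\<sigma> * \<tau>), \<sigma> * \<tau>))"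
  have sp: "\<sigma> \<in> spins A" if "\<sigma> \<in> frozen F A \<or> \<sigma> \<in> frozen G A" for \<sigma>
    using that frozen_subset by blast
  have "card (frozen F A \<times> frozen G A) \<le> card (frozen (F \<union> G) A \<times> frozen (F \<inter> G) A)"
  proof (rule card_inj_on_le)
    show "finite (frozen (F \<union> G) A \<times> frozen (F \<inter> G) A)" using assms by (simp add: finite_frozen)
    show "inj_on \<Phi> (frozen F A \<times> frozen G A)"
    proof (rule inj_onI, clarsimp simp: \<Phi>_def)
      fix \<sigma> \<tau> \<sigma>' \<tau>'
      assume m: "\<sigma> \<in> frozen F A" "\<tau> \<in> frozen G A" "\<sigma>' \<in> frozen F A" "\<tau>' \<in> frozen G A"
        and eq: "\<sigma> * rep (\<sigma>' * \<tau>') = \<sigma>' * rep (\<sigma>' * \<tau>')" "\<sigma> * \<tau> = \<sigma>' * \<tau>'"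
      have "rep (\<sigma>' * \<tau>') \<in> spins A" using rep m sp by blast
      then have "\<sigma> = \<sigma>'"
        using eq(1) spins_times_cancel[of "rep (\<sigma>' * \<tau>')" A] by (metis mult.commute)
      moreover from this have "\<tau> = \<tau>'"
        using eq(2) spins_times_cancel[of \<sigma> A] m sp by metis
      ultimately show "\<sigma> = \<sigma>' \<and> \<tau> = \<tau>'" by simp
    qed
    show "\<Phi> ` (frozen F A \<times> frozen G A) \<subseteq> frozen (F \<union> G) A \<times> frozen (F \<inter> G) A"
    proof (clarsimp simp: \<Phi>_def)
      fix \<sigma> \<tau> assume m: "\<sigma> \<in> frozen F A" "\<tau> \<in> frozen G A"
      let ?\<rho> = "rep (\<sigma> * \<tau>)"
      have 1: "\<sigma> * ?\<rho> \<in> frozen F A" using m rep by (simp add: frozen_times)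
      have "\<tau> * (?\<rho> * (\<sigma> * \<tau>)) \<in> frozen G A" using m rep by (simp add: frozen_times)
      also have "\<tau> * (?\<rho> * (\<sigma> * \<tau>)) = \<tau> * (\<tau> * (\<sigma> * ?\<rho>))" by (simp add: mult_ac)
      also have "\<dots> = \<sigma> * ?\<rho>" using m sp by (blast intro: spins_times_cancel)
      finally have 2: "\<sigma> * ?\<rho> \<in> frozen G A" .
      have "\<sigma> \<in> frozen (F \<inter> G) A" "\<tau> \<in> frozen (F \<inter> G) A"
        using m by (auto simp: frozen_def)
      then show "\<sigma> * ?\<rho> \<in> frozen (F \<union> G) A \<and> \<sigma> * \<tau> \<in> frozen (F \<inter> G) A"
        using 1 2 by (simp add: frozen_Un frozen_times)
    qed
  qed
  then show ?thesis using assms by (simp add: card_cartesian_product)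
qed

section \<open>Four functions theorem and positive correlation in the random-cluster model\<close>

lemma four_functions_one_point:
  fixes a0 a1 b0 b1 c0 c1 d0 d1 :: real
  assumes "a0 \<ge> 0" "a1 \<ge> 0" "b0 \<ge> 0" "b1 \<ge> 0" "c0 \<ge> 0" "c1 \<ge> 0" "d0 \<ge> 0" "d1 \<ge> 0"
    and "a0 * b0 \<le> c0 * d0" "a0 * b1 \<le> c1 * d0" "a1 * b0 \<le> c1 * d0" "a1 * b1 \<le> c1 * d1"
  shows "(a0 + a1) * (b0 + b1) \<le> (c0 + c1) * (d0 + d1)"
proof -
  have "a0 * b1 + a1 * b0 \<le> c1 * d0 + c0 * d1"
  proof (cases "c1 * d0 = 0")
    case True
    then have "a0 * b1 + a1 * b0 \<le> 0" using assms by linarith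
    also have "0 \<le> c1 * d0 + c0 * d1" using assms by simp
    finally show ?thesis .
  next
    case False
    then have "c1 * d0 > 0" using assms by (simp add: less_le)
    show ?thesis
    proof (rule four_products_sum_le)
      have "(a0 * b0) * (a1 * b1) \<le> (c0 * d0) * (c1 * d1)"
        using assms by (rule_tac mult_mono) auto
      then show "a0 * b1 * (a1 * b0) \<le> c1 * d0 * (c0 * d1)" by (simp add: mult_ac)
    qed (use assms \<open>c1 * d0 > 0\<close> in auto)
  qed
  then show ?thesis using assms by (simp add: algebra_simps)
qed

lemma sum_Pow_insert:
  assumes "finite E" "e \<notin> E"
  shows "(\<Sum>F\<in>Pow (insert e E). f F) = (\<Sum>F\<in>Pow E. f F + f (insert e F))"
proof -
  have "inj_on (insert e) (Pow E)" using assms(2) by (auto simp: inj_on_def)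
  moreover have "Pow E \<inter> insert e ` Pow E = {}" using assms(2) by auto
  ultimately show ?thesis
    using assms by (simp add: Pow_insert sum.union_disjoint sum.reindex sum.distrib)
qed

text \<open>The Ahlswede--Daykin theorem for subsets of a finite set. Summing over whether
  \<open>e\<close> belongs to the set preserves the hypothesis, by the case of one point.\<close>

lemma four_functions:
  fixes a b c d :: "'a set \<Rightarrow> real"
  assumes "finite E"
    and "\<And>F. F \<subseteq> E \<Longrightarrow> a F \<ge> 0 \<and> b F \<ge> 0 \<and> c F \<ge> 0 \<and> d F \<ge> 0"
    and "\<And>F G. F \<subseteq> E \<Longrightarrow> G \<subseteq> E \<Longrightarrow> a F * b G \<le> c (F \<union> G) * d (F \<inter> G)"
  shows "(\<Sum>F\<in>Pow E. a F) * (\<Sum>F\<in>Pow E. b F) \<le> (\<Sum>F\<in>Pow E. c F) * (\<Sum>F\<in>Pow E. d F)"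
  using assms
proof (induction E arbitrary: a b c d rule: finite_induct)
  case (insert e E)
  show ?case
    unfolding sum_Pow_insert[OF insert.hyps]
  proof (rule insert.IH)
    fix F assume "F \<subseteq> E"
    then have "F \<subseteq> insert e E" "insert e F \<subseteq> insert e E" by auto
    then show "a F + a (insert e F) \<ge> 0 \<and> b F + b (insert e F) \<ge> 0 \<and> c F + c (insert e F) \<ge> 0 \<and> d F + d (insert e F) \<ge> 0"
      using insert.prems(1) by (simp add: add_nonneg_nonneg)
  next
    fix F G assume FG: "F \<subseteq> E" "G \<subseteq> E"
    then have sub: "F \<subseteq> insert e E" "insert e F \<subseteq> insert e E" "G \<subseteq> insert e E" "insert e G \<subseteq> insert e E"
      "F \<union> G \<subseteq> insert e E" "insert e (F \<union> G) \<subseteq> insert e E" "F \<inter> G \<subseteq> insert e E" "insert e (F \<inter> G) \<subseteq> insert e E"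
      by auto
    have "e \<notin> F" "e \<notin> G" using FG insert.hyps by auto
    then have eqs: "F \<union> insert e G = insert e (F \<union> G)" "insert e F \<union> G = insert e (F \<union> G)"
      "insert e F \<union> insert e G = insert e (F \<union> G)" "F \<inter> insert e G = F \<inter> G" "insert e F \<inter> G = F \<inter> G"
      "insert e F \<inter> insert e G = insert e (F \<inter> G)"
      by auto
    show "(a F + a (insert e F)) * (b G + b (insert e G))
      \<le> (c (F \<union> G) + c (insert e (F \<union> G))) * (d (F \<inter> G) + d (insert e (F \<inter> G)))"
      using insert.prems(1)[OF sub(1)] insert.prems(1)[OF sub(2)] insert.prems(1)[OF sub(3)] insert.prems(1)[OF sub(4)]
        insert.prems(1)[OF sub(5)] insert.prems(1)[OF sub(6)] insert.prems(1)[OF sub(7)] insert.prems(1)[OF sub(8)]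
        insert.prems(2)[OF sub(1) sub(3)] insert.prems(2)[OF sub(1) sub(4)] insert.prems(2)[OF sub(2) sub(3)] insert.prems(2)[OF sub(2) sub(4)]
      unfolding eqs by (intro four_functions_one_point) auto
  qed
qed simp

definition fk_weight :: "real \<Rightarrow> 'a set \<Rightarrow> 'a set set \<Rightarrow> real" where
  "fk_weight \<beta> A F = (exp (2 * \<beta>) - 1) ^ card F * card (frozen F A)"

lemma fk_weight_nonneg: "\<beta> \<ge> 0 \<Longrightarrow> fk_weight \<beta> A F \<ge> 0"
  by (simp add: fk_weight_def)

lemma fk_sum_pos:
  assumes "finite A" "finite E" "\<beta> \<ge> 0"
  shows "(\<Sum>F\<in>Pow E. fk_weight \<beta> A F) > 0"
proof (rule sum_pos2[of _ "{}"])
  show "fk_weight \<beta> A {} > 0" using card_frozen_pos[OF assms(1)] by (simp add: fk_weight_def)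
qed (use assms in \<open>auto simp: fk_weight_nonneg\<close>)

lemma ising_mean_fk:
  assumes "finite A" "finite E" "character A g"
  shows "ising_mean E A \<beta> g =
    (\<Sum>F\<in>Pow E. fk_weight \<beta> A F * of_bool (forces (frozen F A) g)) / (\<Sum>F\<in>Pow E. fk_weight \<beta> A F)"
  unfolding ising_mean_def ising_sum_fk[OF assms] ising_sum_fk[OF assms(1,2) character_const]
  by (simp add: fk_weight_def forces_def)

text \<open>Opening edges shrinks the group, so being forced is an increasing event; the weights
  satisfy the lattice condition by \<open>card_frozen_supermodular\<close>, with equality in the
  powers.\<close>

lemma fk_positive_correlation:
  assumes "finite A" "finite E" "\<beta> \<ge> 0"
  shows "(\<Sum>F\<in>Pow E. fk_weight \<beta> A F * of_bool (forces (frozen F A) g)) * (\<Sum>F\<in>Pow E. fk_weight \<beta> A F * of_bool (forces (frozen F A) h))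
    \<le> (\<Sum>F\<in>Pow E. fk_weight \<beta> A F * of_bool (forces (frozen F A) g \<and> forces (frozen F A) h)) * (\<Sum>F\<in>Pow E. fk_weight \<beta> A F)"
proof (rule four_functions[OF assms(2)])
  fix F G assume FG: "F \<subseteq> E" "G \<subseteq> E"
  have "fk_weight \<beta> A F * fk_weight \<beta> A G \<le> fk_weight \<beta> A (F \<union> G) * fk_weight \<beta> A (F \<inter> G)"
  proof -
    have fin: "finite F" "finite G" using FG assms(2) finite_subset by auto
    let ?u = "exp (2 * \<beta>) - 1"
    have u: "?u ^ card F * ?u ^ card G = ?u ^ card (F \<union> G) * ?u ^ card (F \<inter> G)"
      using card_Un_Int[OF fin] by (simp add: power_add[symmetric])
    have "real (card (frozen F A)) * real (card (frozen G A)) \<le> real (card (frozen (F \<union> G) A)) * real (card (frozen (F \<inter> G) A))"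
      using card_frozen_supermodular[OF assms(1), of F G] by (metis of_nat_le_iff of_nat_mult)
    then have "(?u ^ card F * ?u ^ card G) * (real (card (frozen F A)) * real (card (frozen G A)))
      \<le> (?u ^ card F * ?u ^ card G) * (real (card (frozen (F \<union> G) A)) * real (card (frozen (F \<inter> G) A)))"
      using assms(3) by (intro mult_left_mono) auto
    also have "\<dots> = fk_weight \<beta> A (F \<union> G) * fk_weight \<beta> A (F \<inter> G)"
      unfolding u by (simp add: fk_weight_def)
    finally show ?thesis by (simp add: fk_weight_def mult_ac)
  qed
  moreover have "forces (frozen (F \<union> G) A) g \<and> forces (frozen (F \<union> G) A) h"
    if "forces (frozen F A) g" "forces (frozen G A) h"
    using that by (auto simp: forces_def frozen_Un)
  ultimately show "fk_weight \<beta> A F * of_bool (forces (frozen F A) g) * (fk_weight \<beta> A G * of_bool (forces (frozen G A) h))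
    \<le> fk_weight \<beta> A (F \<union> G) * of_bool (forces (frozen (F \<union> G) A) g \<and> forces (frozen (F \<union> G) A) h) * fk_weight \<beta> A (F \<inter> G)"
    using fk_weight_nonneg[OF assms(3)] by (auto intro!: mult_nonneg_nonneg)
qed (use assms fk_weight_nonneg in auto)

text \<open>Where \<open>g\<close> is forced, the product is forced exactly when \<open>h\<close>
  is, and positive correlation makes this part at least the product of the means. The remaining part
  is the bound. For a spin at \<open>p\<close> and an edge spin it says that one end of the edge is
  joined to \<open>p\<close> and the other to the boundary, while \<open>p\<close> is not.\<close>

lemma covariance_lower_bound:
  assumes "finite A" "finite E" "\<beta> \<ge> 0" "character A g" "character A h"
  shows "ising_mean E A \<beta> (\<lambda>\<sigma>. g \<sigma> * h \<sigma>) - ising_mean E A \<beta> g * ising_mean E A \<beta> h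
    \<ge> (\<Sum>F\<in>Pow E. fk_weight \<beta> A F * of_bool (forces (frozen F A) (\<lambda>\<sigma>. g \<sigma> * h \<sigma>) \<and> \<not> forces (frozen F A) g))
        / (\<Sum>F\<in>Pow E. fk_weight \<beta> A F)"
proof -
  let ?w = "fk_weight \<beta> A"
  define Z where "Z = sum ?w (Pow E)"
  define G H GH R where "G = (\<Sum>F\<in>Pow E. ?w F * of_bool (forces (frozen F A) g))"
    and "H = (\<Sum>F\<in>Pow E. ?w F * of_bool (forces (frozen F A) h))"
    and "GH = (\<Sum>F\<in>Pow E. ?w F * of_bool (forces (frozen F A) g \<and> forces (frozen F A) h))"
    and "R = (\<Sum>F\<in>Pow E. ?w F * of_bool (forces (frozen F A) (\<lambda>\<sigma>. g \<sigma> * h \<sigma>) \<and> \<not> forces (frozen F A) g))"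
  have "Z > 0" unfolding Z_def using assms by (intro fk_sum_pos) auto
  have "G * H \<le> GH * Z" unfolding G_def H_def GH_def Z_def by (rule fk_positive_correlation) fact+
  have "(\<Sum>F\<in>Pow E. ?w F * of_bool (forces (frozen F A) (\<lambda>\<sigma>. g \<sigma> * h \<sigma>))) = GH + R"
    unfolding GH_def R_def sum.distrib[symmetric]
  proof (rule sum.cong[OF refl])
    fix F
    have "forces (frozen F A) (\<lambda>\<sigma>. g \<sigma> * h \<sigma>) \<longleftrightarrow> forces (frozen F A) h" if "forces (frozen F A) g"
      using that by (simp add: forces_def)
    then show "?w F * of_bool (forces (frozen F A) (\<lambda>\<sigma>. g \<sigma> * h \<sigma>)) =
      ?w F * of_bool (forces (frozen F A) g \<and> forces (frozen F A) h) + ?w F * of_bool (forces (frozen F A) (\<lambda>\<sigma>. g \<sigma> * h \<sigma>) \<and> \<not> forces (frozen F A) g)"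
      by (cases "forces (frozen F A) g") auto
  qed
  then have "ising_mean E A \<beta> (\<lambda>\<sigma>. g \<sigma> * h \<sigma>) = (GH + R) / Z"
    using ising_mean_fk[OF assms(1,2) character_mult[OF assms(4,5)], of \<beta>] by (simp add: Z_def)
  moreover have "ising_mean E A \<beta> g = G / Z" "ising_mean E A \<beta> h = H / Z"
    unfolding G_def H_def Z_def by (intro ising_mean_fk assms)+
  moreover have "G / Z * (H / Z) \<le> GH / Z"
    using \<open>G * H \<le> GH * Z\<close> \<open>Z > 0\<close> by (simp add: field_simps)
  ultimately have "R / Z \<le> ising_mean E A \<beta> (\<lambda>\<sigma>. g \<sigma> * h \<sigma>) - ising_mean E A \<beta> g * ising_mean E A \<beta> h"
    by (simp add: add_divide_distrib)
  then show ?thesis by (simp add: R_def Z_def)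
qed

section \<open>Derivative in the inverse temperature and the cluster of the boundary\<close>

lemma has_derivative_ising_sum:
  assumes "finite E"
  shows "((\<lambda>\<beta>. ising_sum E A \<beta> f) has_real_derivative (\<Sum>e\<in>E. ising_sum E A \<beta> (\<lambda>\<sigma>. f \<sigma> * edge_spin e \<sigma>))) (at \<beta>)"
proof -
  have "((\<lambda>\<beta>. ising_sum E A \<beta> f) has_real_derivative
    (\<Sum>\<sigma>\<in>spins A. f \<sigma> * (exp (\<beta> * (\<Sum>e\<in>E. edge_spin e \<sigma>)) * (\<Sum>e\<in>E. edge_spin e \<sigma>)))) (at \<beta>)"
    unfolding ising_sum_def by (rule DERIV_sum) (auto intro!: derivative_eq_intros)
  also have "(\<Sum>\<sigma>\<in>spins A. f \<sigma> * (exp (\<beta> * (\<Sum>e\<in>E. edge_spin e \<sigma>)) * (\<Sum>e\<in>E. edge_spin e \<sigma>)))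
    = (\<Sum>\<sigma>\<in>spins A. \<Sum>e\<in>E. f \<sigma> * edge_spin e \<sigma> * exp (\<beta> * (\<Sum>e\<in>E. edge_spin e \<sigma>)))"
  proof (rule sum.cong[OF refl])
    fix \<sigma>
    have "a * (X * (\<Sum>e\<in>E. edge_spin e \<sigma>)) = (\<Sum>e\<in>E. a * edge_spin e \<sigma> * X)" for a X
      by (simp add: sum_distrib_left mult_ac)
    then show "f \<sigma> * (exp (\<beta> * (\<Sum>e\<in>E. edge_spin e \<sigma>)) * (\<Sum>e\<in>E. edge_spin e \<sigma>))
      = (\<Sum>e\<in>E. f \<sigma> * edge_spin e \<sigma> * exp (\<beta> * (\<Sum>e\<in>E. edge_spin e \<sigma>)))" .
  qed
  also have "\<dots> = (\<Sum>e\<in>E. ising_sum E A \<beta> (\<lambda>\<sigma>. f \<sigma> * edge_spin e \<sigma>))"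
    by (subst sum.swap) (simp add: ising_sum_def)
  finally show ?thesis .
qed

lemma has_derivative_ising_mean:
  assumes "finite A" "finite E"
  shows "((\<lambda>\<beta>. ising_mean E A \<beta> f) has_real_derivative
    (\<Sum>e\<in>E. ising_mean E A \<beta> (\<lambda>\<sigma>. f \<sigma> * edge_spin e \<sigma>) - ising_mean E A \<beta> f * ising_mean E A \<beta> (edge_spin e))) (at \<beta>)"
proof -
  let ?Z = "ising_sum E A \<beta> (\<lambda>_. 1)"
  have Z: "?Z \<noteq> 0" using ising_sum_pos[OF assms(1), of E \<beta>] by simp
  have "((\<lambda>\<beta>. ising_mean E A \<beta> f) has_real_derivative
    ((\<Sum>e\<in>E. ising_sum E A \<beta> (\<lambda>\<sigma>. f \<sigma> * edge_spin e \<sigma>)) * ?Z - ising_sum E A \<beta> f * (\<Sum>e\<in>E. ising_sum E A \<beta> (\<lambda>\<sigma>. 1 * edge_spin e \<sigma>))) / (?Z * ?Z)) (at \<beta>)"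
    unfolding ising_mean_def using Z
    by (intro DERIV_divide has_derivative_ising_sum assms)
  also have "((\<Sum>e\<in>E. ising_sum E A \<beta> (\<lambda>\<sigma>. f \<sigma> * edge_spin e \<sigma>)) * ?Z - ising_sum E A \<beta> f * (\<Sum>e\<in>E. ising_sum E A \<beta> (\<lambda>\<sigma>. 1 * edge_spin e \<sigma>))) / (?Z * ?Z)
    = (\<Sum>e\<in>E. ising_mean E A \<beta> (\<lambda>\<sigma>. f \<sigma> * edge_spin e \<sigma>) - ising_mean E A \<beta> f * ising_mean E A \<beta> (edge_spin e))"
    unfolding ising_mean_def sum_distrib_left sum_distrib_right sum_subtractf[symmetric] sum_divide_distrib
    using Z by (intro sum.cong refl) (simp add: field_simps)
  finally show ?thesis .
qed

definition unforced :: "'a set set \<Rightarrow> 'a set \<Rightarrow> 'a set" where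
  "unforced F A = {x \<in> A. \<not> forces (frozen F A) (\<lambda>\<sigma>. \<sigma> x)}"

text \<open>The sites forced to be \<open>+1\<close> form the cluster of the boundary; on the rest \<open>S\<close> the model is free.\<close>

lemma frozen_split:
  assumes S: "S \<subseteq> A" and F1: "\<And>e. e \<in> F1 \<Longrightarrow> e \<inter> S = {}" and F2: "\<And>e. e \<in> F2 \<Longrightarrow> e \<subseteq> S"
    and triv: "frozen F1 (A - S) = {1}"
  shows "frozen (F1 \<union> F2) A = frozen F2 S"
proof (intro equalityI subsetI)
  fix \<sigma> assume \<sigma>: "\<sigma> \<in> frozen (F1 \<union> F2) A"
  define \<tau> where "\<tau> = (\<lambda>x. if x \<in> S then 1 else \<sigma> x)"
  have "\<tau> \<in> frozen F1 (A - S)"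
  proof -
    have "edge_spin e \<tau> = edge_spin e \<sigma>" if "e \<in> F1" for e
      unfolding edge_spin_def using F1[OF that] by (intro prod.cong) (auto simp: \<tau>_def)
    then show ?thesis using \<sigma> by (auto simp: frozen_def spins_def \<tau>_def)
  qed
  with triv have "\<tau> = 1" by blast
  then have "\<sigma> x = 1" if "x \<notin> S" for x using that by (auto simp: \<tau>_def fun_eq_iff split: if_splits)
  then show "\<sigma> \<in> frozen F2 S" using \<sigma> S by (auto simp: frozen_def spins_def)
next
  fix \<sigma> assume \<sigma>: "\<sigma> \<in> frozen F2 S"
  have "edge_spin e \<sigma> = 1" if "e \<in> F1" for e
    unfolding edge_spin_def using F1[OF that] \<sigma> by (intro prod.neutral) (auto simp: frozen_def spins_def)
  then show "\<sigma> \<in> frozen (F1 \<union> F2) A" using \<sigma> spins_mono[OF S] by (auto simp: frozen_def)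
qed

text \<open>Flipping all spins of \<open>S\<close> at once changes both ends of every edge, so each
  edge spin stays 1.\<close>

lemma unforced_free:
  assumes "\<And>e. e \<in> F \<Longrightarrow> e \<subseteq> S \<and> card e = 2"
  shows "unforced F S = S"
proof -
  let ?\<sigma> = "\<lambda>x. if x \<in> S then -1 else 1 :: real"
  have "edge_spin e ?\<sigma> = 1" if "e \<in> F" for e
  proof -
    have "edge_spin e ?\<sigma> = (\<Prod>x\<in>e. -1)" unfolding edge_spin_def using assms[OF that] by (intro prod.cong) auto
    then show ?thesis using assms[OF that] by simp
  qed
  then have "?\<sigma> \<in> frozen F S" by (auto simp: frozen_def spins_def)
  then show ?thesis by (auto simp: unforced_def forces_def intro!: bexI[of _ ?\<sigma>])
qed

text \<open>An open edge between a forced and an unforced site would force the latter. Hence open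
  edges do not cross, and those away from \<open>S\<close> must by themselves force all of
  \<open>A - S\<close>.\<close>

lemma unforced_split:
  fixes A :: "'a set"
  assumes E: "\<And>e. e \<in> F \<Longrightarrow> card e = 2"
  defines "S \<equiv> unforced F A"
  shows "\<And>e. e \<in> F \<Longrightarrow> e \<subseteq> S \<or> e \<inter> S = {}"
    and "frozen {e \<in> F. e \<inter> S = {}} (A - S) = {1}"
proof -
  have out: "\<sigma> x = 1" if "\<sigma> \<in> frozen F A" "x \<notin> S" for \<sigma> x
    using that by (cases "x \<in> A") (auto simp: S_def unforced_def forces_def frozen_def spins_def)
  show split: "e \<subseteq> S \<or> e \<inter> S = {}" if e: "e \<in> F" for e
  proof (rule ccontr)
    assume "\<not> (e \<subseteq> S \<or> e \<inter> S = {})"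
    then obtain x y where xy: "x \<in> e" "y \<in> e" "x \<in> S" "y \<notin> S" by blast
    with E[OF e] have "e = {x, y}" "x \<noteq> y" by (auto simp: card_2_iff)
    have "\<sigma> x = 1" if "\<sigma> \<in> frozen F A" for \<sigma>
    proof -
      have "edge_spin e \<sigma> = 1" using that e by (simp add: frozen_def)
      then show ?thesis using out[OF that xy(4)] \<open>e = {x, y}\<close> \<open>x \<noteq> y\<close> by (simp add: edge_spin_def)
    qed
    then show False using xy(3) by (auto simp: S_def unforced_def forces_def)
  qed
  show "frozen {e \<in> F. e \<inter> S = {}} (A - S) = {1}"
  proof (intro equalityI subsetI)
    fix \<sigma> assume \<sigma>: "\<sigma> \<in> frozen {e \<in> F. e \<inter> S = {}} (A - S)"
    have one: "\<sigma> x = 1" if "x \<in> S" for x using \<sigma> that by (auto simp: frozen_def spins_def)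
    have "edge_spin e \<sigma> = 1" if "e \<in> F" for e
      using split[OF that]
    proof
      assume "e \<subseteq> S"
      then show ?thesis unfolding edge_spin_def using one by (intro prod.neutral) auto
    qed (use \<sigma> that in \<open>auto simp: frozen_def\<close>)
    then have "\<sigma> \<in> frozen F A" using \<sigma> spins_mono[of "A - S" A] by (auto simp: frozen_def)
    then have "\<sigma> = 1" using out one by (auto simp: fun_eq_iff)
    then show "\<sigma> \<in> {1}" by simp
  qed (auto simp: one_in_frozen)
qed

lemma fk_sum_unforced:
  fixes q :: "('a \<Rightarrow> real) set \<Rightarrow> real"
  assumes "finite A" "finite E" "\<And>e. e \<in> E \<Longrightarrow> card e = 2" "S \<subseteq> A"
  shows "(\<Sum>F | F \<subseteq> E \<and> unforced F A = S. fk_weight \<beta> A F * q (frozen F A))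
    = (\<Sum>F | F \<subseteq> {e \<in> E. e \<inter> S = {}} \<and> frozen F (A - S) = {1}. (exp (2 * \<beta>) - 1) ^ card F)
      * (\<Sum>F\<in>Pow {e \<in> E. e \<subseteq> S}. fk_weight \<beta> S F * q (frozen F S))"
proof -
  let ?u = "exp (2 * \<beta>) - 1"
  define Good where "Good = {F. F \<subseteq> {e \<in> E. e \<inter> S = {}} \<and> frozen F (A - S) = {1}}"
  define In where "In = Pow {e \<in> E. e \<subseteq> S}"
  have disj: "F1 \<inter> F2 = {}" if "F1 \<in> Good" "F2 \<in> In" for F1 F2
  proof -
    have "e = {}" if "e \<in> F1" "e \<in> F2" for e
      using that \<open>F1 \<in> Good\<close> \<open>F2 \<in> In\<close> by (auto simp: Good_def In_def)
    moreover have "{} \<notin> F1" using assms(3)[of "{}"] \<open>F1 \<in> Good\<close> by (auto simp: Good_def)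
    ultimately show ?thesis by blast
  qed
  have fr: "frozen (F1 \<union> F2) A = frozen F2 S" if "F1 \<in> Good" "F2 \<in> In" for F1 F2
    by (rule frozen_split) (use assms(4) that in \<open>auto simp: Good_def In_def\<close>)
  have unf: "unforced (F1 \<union> F2) A = S" if "F1 \<in> Good" "F2 \<in> In" for F1 F2
  proof -
    have "unforced F2 S = S" by (rule unforced_free) (use that assms(3) in \<open>auto simp: In_def\<close>)
    moreover have "forces (frozen F2 S) (\<lambda>\<sigma>. \<sigma> x)" if "x \<notin> S" for x
      using that by (auto simp: forces_def frozen_def spins_def)
    ultimately show ?thesis using assms(4) fr[OF that] by (auto simp: unforced_def)
  qed
  have img: "{F. F \<subseteq> E \<and> unforced F A = S} = (\<lambda>(F1, F2). F1 \<union> F2) ` (Good \<times> In)"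
  proof (intro equalityI subsetI)
    fix F assume "F \<in> {F. F \<subseteq> E \<and> unforced F A = S}"
    then have F: "F \<subseteq> E" "unforced F A = S" by auto
    have card2: "card e = 2" if "e \<in> F" for e using that F(1) assms(3) by blast
    have "{e \<in> F. e \<inter> S = {}} \<in> Good"
      using unforced_split(2)[where F = F and A = A, OF card2] F unfolding Good_def by auto
    moreover have "{e \<in> F. e \<subseteq> S} \<in> In" using F by (auto simp: In_def)
    moreover have "F = {e \<in> F. e \<inter> S = {}} \<union> {e \<in> F. e \<subseteq> S}"
      using unforced_split(1)[where F = F and A = A, OF card2] F by auto
    ultimately show "F \<in> (\<lambda>(F1, F2). F1 \<union> F2) ` (Good \<times> In)"
      by (intro image_eqI[where x = "({e \<in> F. e \<inter> S = {}}, {e \<in> F. e \<subseteq> S})"]) auto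
  next
    fix F assume "F \<in> (\<lambda>(F1, F2). F1 \<union> F2) ` (Good \<times> In)"
    then obtain F1 F2 where "F = F1 \<union> F2" "F1 \<in> Good" "F2 \<in> In" by auto
    with unf[of F1 F2] show "F \<in> {F. F \<subseteq> E \<and> unforced F A = S}" by (auto simp: Good_def In_def)
  qed
  have inj: "inj_on (\<lambda>(F1, F2). F1 \<union> F2) (Good \<times> In)"
  proof (rule inj_onI, clarsimp)
    fix F1 F2 G1 G2 assume m: "F1 \<in> Good" "F2 \<in> In" "G1 \<in> Good" "G2 \<in> In" and eq: "F1 \<union> F2 = G1 \<union> G2"
    have d: "F1 \<inter> G2 = {}" "G1 \<inter> F2 = {}" "F1 \<inter> F2 = {}" "G1 \<inter> G2 = {}" using disj m by auto
    show "F1 = G1 \<and> F2 = G2" using eq d by blast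
  qed
  have finE: "finite F" if "F \<subseteq> E" for F using that assms(2) finite_subset by auto
  have "(\<Sum>F | F \<subseteq> E \<and> unforced F A = S. fk_weight \<beta> A F * q (frozen F A))
    = (\<Sum>(F1, F2)\<in>Good \<times> In. fk_weight \<beta> A (F1 \<union> F2) * q (frozen (F1 \<union> F2) A))"
    unfolding img by (subst sum.reindex[OF inj]) (simp add: case_prod_beta comp_def)
  also have "\<dots> = (\<Sum>(F1, F2)\<in>Good \<times> In. ?u ^ card F1 * (fk_weight \<beta> S F2 * q (frozen F2 S)))"
  proof (intro sum.cong refl, clarsimp)
    fix F1 F2 assume m: "F1 \<in> Good" "F2 \<in> In"
    then have "finite F1" "finite F2" unfolding Good_def In_def by (auto intro!: finE)
    then have "card (F1 \<union> F2) = card F1 + card F2" using disj[OF m] by (simp add: card_Un_disjoint)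
    then show "fk_weight \<beta> A (F1 \<union> F2) * q (frozen (F1 \<union> F2) A) = ?u ^ card F1 * (fk_weight \<beta> S F2 * q (frozen F2 S))"
      by (simp add: fk_weight_def fr[OF m] power_add mult_ac)
  qed
  also have "\<dots> = (\<Sum>F1\<in>Good. ?u ^ card F1) * (\<Sum>F2\<in>In. fk_weight \<beta> S F2 * q (frozen F2 S))"
    by (simp add: sum.cartesian_product[symmetric] sum_product)
  finally show ?thesis by (simp add: Good_def In_def)
qed

definition inner_boundary :: "'a set set \<Rightarrow> 'a set \<Rightarrow> 'a set" where
  "inner_boundary E S = {x \<in> S. \<exists>y. y \<notin> S \<and> {x, y} \<in> E}"

definition boundary_correlation :: "'a set set \<Rightarrow> real \<Rightarrow> 'a \<Rightarrow> 'a set \<Rightarrow> real" where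
  "boundary_correlation E \<beta> p S = (\<Sum>x\<in>inner_boundary E S. ising_mean {e \<in> E. e \<subseteq> S} S \<beta> (\<lambda>\<sigma>. \<sigma> p * \<sigma> x))"

text \<open>A boundary site of the unforced set has an edge to a site where every frozen spin is 1,
  so the edge spin equals the spin of that site. Distinct sites give distinct edges because only one
  end is unforced.\<close>

lemma card_crossing_edges:
  assumes "finite E" "finite A" "p \<in> unforced F A"
  shows "card {x \<in> inner_boundary E (unforced F A). forces (frozen F A) (\<lambda>\<sigma>. \<sigma> p * \<sigma> x)}
    \<le> card {e \<in> E. forces (frozen F A) (\<lambda>\<sigma>. \<sigma> p * edge_spin e \<sigma>)}"
    (is "card ?X \<le> card ?Y")
proof -
  let ?S = "unforced F A"
  define other where "other x = (SOME y. y \<notin> ?S \<and> {x, y} \<in> E)" for x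
  have other: "other x \<notin> ?S" "{x, other x} \<in> E" if "x \<in> inner_boundary E ?S" for x
    using someI_ex[of "\<lambda>y. y \<notin> ?S \<and> {x, y} \<in> E"] that by (auto simp: other_def inner_boundary_def)
  show ?thesis
  proof (rule card_inj_on_le[of "\<lambda>x. {x, other x}"])
    show "inj_on (\<lambda>x. {x, other x}) ?X"
      using other by (fastforce intro!: inj_onI simp: doubleton_eq_iff inner_boundary_def)
    show "(\<lambda>x. {x, other x}) ` ?X \<subseteq> ?Y"
    proof clarsimp
      fix x assume x: "x \<in> inner_boundary E ?S" and f: "forces (frozen F A) (\<lambda>\<sigma>. \<sigma> p * \<sigma> x)"
      have "x \<in> ?S" using x by (simp add: inner_boundary_def)
      then have ne: "x \<noteq> other x" using other(1)[OF x] by auto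
      have out: "\<sigma> (other x) = 1" if "\<sigma> \<in> frozen F A" for \<sigma>
        using other(1)[OF x] that by (cases "other x \<in> A") (auto simp: unforced_def forces_def frozen_def spins_def)
      have "forces (frozen F A) (\<lambda>\<sigma>. \<sigma> p * edge_spin {x, other x} \<sigma>)"
        unfolding forces_def
      proof (intro ballI)
        fix \<sigma> assume "\<sigma> \<in> frozen F A"
        with out[OF this] show "\<sigma> p * edge_spin {x, other x} \<sigma> = 1"
          using f ne by (auto simp: forces_def edge_spin_def)
      qed
      then show "{x, other x} \<in> E \<and> forces (frozen F A) (\<lambda>\<sigma>. \<sigma> p * edge_spin {x, other x} \<sigma>)"
        using other(2)[OF x] by simp
    qed
  qed (use assms in auto)
qed

theorem derivative_lower_bound:
  assumes "finite A" "finite E" "\<And>e. e \<in> E \<Longrightarrow> card e = 2" "\<beta> \<ge> 0" "p \<in> A"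
    and phi: "\<And>S. S \<subseteq> A \<Longrightarrow> p \<in> S \<Longrightarrow> boundary_correlation E \<beta> p S \<ge> 1"
  shows "(\<Sum>e\<in>E. ising_mean E A \<beta> (\<lambda>\<sigma>. \<sigma> p * edge_spin e \<sigma>) - ising_mean E A \<beta> (\<lambda>\<sigma>. \<sigma> p) * ising_mean E A \<beta> (edge_spin e))
    \<ge> 1 - ising_mean E A \<beta> (\<lambda>\<sigma>. \<sigma> p)"
proof -
  let ?w = "fk_weight \<beta> A"
  define Z where "Z = sum ?w (Pow E)"
  have "Z > 0" unfolding Z_def using assms by (intro fk_sum_pos) auto
  define D where "D F = {x \<in> inner_boundary E (unforced F A). forces (frozen F A) (\<lambda>\<sigma>. \<sigma> p * \<sigma> x)}" for F
  have by_S: "(\<Sum>F | F \<subseteq> E \<and> p \<in> unforced F A. g F) = (\<Sum>S | S \<subseteq> A \<and> p \<in> S. \<Sum>F | F \<subseteq> E \<and> unforced F A = S. g F)"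
    for g :: "'a set set \<Rightarrow> real"
  proof -
    have "(\<Sum>S | S \<subseteq> A \<and> p \<in> S. \<Sum>F | F \<subseteq> E \<and> unforced F A = S. g F)
      = (\<Sum>S | S \<subseteq> A \<and> p \<in> S. \<Sum>F | F \<in> {F. F \<subseteq> E \<and> p \<in> unforced F A} \<and> unforced F A = S. g F)"
      by (intro sum.cong) auto
    also have "\<dots> = (\<Sum>F | F \<subseteq> E \<and> p \<in> unforced F A. g F)"
      using assms(1,2) by (intro sum.group) (auto simp: unforced_def)
    finally show ?thesis by simp
  qed
  \<comment> \<open>Given that \<open>S\<close> is the unforced set, the expected size of
    \<open>D F\<close> is \<open>boundary_correlation\<close> of the free model on \<open>S\<close>;
    the outer factor \<open>K\<close> is common to both sides.\<close>
  have one: "(\<Sum>F | F \<subseteq> E \<and> unforced F A = S. ?w F) \<le> (\<Sum>F | F \<subseteq> E \<and> unforced F A = S. ?w F * card (D F))"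
    if S: "S \<subseteq> A" "p \<in> S" for S
  proof -
    let ?ES = "{e \<in> E. e \<subseteq> S}"
    define K where "K = (\<Sum>F | F \<subseteq> {e \<in> E. e \<inter> S = {}} \<and> frozen F (A - S) = {1}. (exp (2 * \<beta>) - 1) ^ card F)"
    define ZS where "ZS = (\<Sum>F\<in>Pow ?ES. fk_weight \<beta> S F)"
    have fin: "finite S" "finite ?ES" using S assms finite_subset by auto
    have "ZS > 0" unfolding ZS_def using assms fin by (intro fk_sum_pos) auto
    have "K \<ge> 0" unfolding K_def using assms(4) by (intro sum_nonneg) auto
    note split = fk_sum_unforced[OF assms(1-3) S(1), of \<beta>, folded K_def]
    have tot: "(\<Sum>F | F \<subseteq> E \<and> unforced F A = S. ?w F) = K * ZS"
      using split[of "\<lambda>_. 1"] by (simp add: ZS_def)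
    have finB: "finite (inner_boundary E S)" using fin by (simp add: inner_boundary_def)
    have "(\<Sum>F | F \<subseteq> E \<and> unforced F A = S. ?w F * card (D F))
      = (\<Sum>F | F \<subseteq> E \<and> unforced F A = S. \<Sum>x\<in>inner_boundary E S. ?w F * of_bool (forces (frozen F A) (\<lambda>\<sigma>. \<sigma> p * \<sigma> x)))"
    proof (intro sum.cong refl, clarsimp)
      fix F assume "S = unforced F A"
      then have "real (card (D F)) = (\<Sum>x\<in>inner_boundary E (unforced F A). of_bool (forces (frozen F A) (\<lambda>\<sigma>. \<sigma> p * \<sigma> x)))"
        using finB by (simp add: D_def sum.If_cases Int_def of_bool_def)
      then show "?w F * real (card (D F)) = (\<Sum>x\<in>inner_boundary E (unforced F A). ?w F * of_bool (forces (frozen F A) (\<lambda>\<sigma>. \<sigma> p * \<sigma> x)))"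
        by (simp add: sum_distrib_left)
    qed
    also have "\<dots> = (\<Sum>x\<in>inner_boundary E S. \<Sum>F | F \<subseteq> E \<and> unforced F A = S. ?w F * of_bool (forces (frozen F A) (\<lambda>\<sigma>. \<sigma> p * \<sigma> x)))"
      by (rule sum.swap)
    also have "\<dots> = (\<Sum>x\<in>inner_boundary E S. K * ZS * ising_mean ?ES S \<beta> (\<lambda>\<sigma>. \<sigma> p * \<sigma> x))"
    proof (rule sum.cong[OF refl])
      fix x
      define X where "X = (\<Sum>F\<in>Pow ?ES. fk_weight \<beta> S F * of_bool (forces (frozen F S) (\<lambda>\<sigma>. \<sigma> p * \<sigma> x)))"
      have "ising_mean ?ES S \<beta> (\<lambda>\<sigma>. \<sigma> p * \<sigma> x) = X / ZS"
        unfolding X_def ZS_def by (rule ising_mean_fk[OF fin character_mult[OF character_eval character_eval]])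
      moreover have "(\<Sum>F | F \<subseteq> E \<and> unforced F A = S. ?w F * of_bool (forces (frozen F A) (\<lambda>\<sigma>. \<sigma> p * \<sigma> x))) = K * X"
        unfolding X_def by (rule split)
      ultimately show "(\<Sum>F | F \<subseteq> E \<and> unforced F A = S. ?w F * of_bool (forces (frozen F A) (\<lambda>\<sigma>. \<sigma> p * \<sigma> x)))
        = K * ZS * ising_mean ?ES S \<beta> (\<lambda>\<sigma>. \<sigma> p * \<sigma> x)"
        using \<open>ZS > 0\<close> by simp
    qed
    also have "\<dots> = K * ZS * boundary_correlation E \<beta> p S"
      by (simp add: boundary_correlation_def sum_distrib_left)
    also have "K * ZS * 1 \<le> \<dots>" using phi[OF S] \<open>K \<ge> 0\<close> \<open>ZS > 0\<close> by (intro mult_left_mono) auto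
    finally show ?thesis using tot by simp
  qed
  \<comment> \<open>One minus the mean is the probability that \<open>p\<close> is not joined to the
    boundary.\<close>
  have "Z * (1 - ising_mean E A \<beta> (\<lambda>\<sigma>. \<sigma> p)) = (\<Sum>F | F \<subseteq> E \<and> p \<in> unforced F A. ?w F)"
  proof -
    have "Z * (1 - ising_mean E A \<beta> (\<lambda>\<sigma>. \<sigma> p)) = (\<Sum>F\<in>Pow E. ?w F * (1 - of_bool (forces (frozen F A) (\<lambda>\<sigma>. \<sigma> p))))"
      using \<open>Z > 0\<close> unfolding ising_mean_fk[OF assms(1,2) character_eval] Z_def
      by (simp add: right_diff_distrib sum_subtractf)
    also have "\<dots> = (\<Sum>F\<in>Pow E. if p \<in> unforced F A then ?w F else 0)"
      using assms(5) by (intro sum.cong) (auto simp: unforced_def)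
    also have "\<dots> = (\<Sum>F | F \<subseteq> E \<and> p \<in> unforced F A. ?w F)"
      using assms(2) by (subst sum.inter_filter[symmetric]) (auto intro!: sum.cong)
    finally show ?thesis .
  qed
  also have "\<dots> \<le> (\<Sum>F | F \<subseteq> E \<and> p \<in> unforced F A. ?w F * card (D F))"
    unfolding by_S by (rule sum_mono) (use one in auto)
  also have "\<dots> \<le> (\<Sum>F | F \<subseteq> E \<and> p \<in> unforced F A. ?w F * card {e \<in> E. forces (frozen F A) (\<lambda>\<sigma>. \<sigma> p * edge_spin e \<sigma>)})"
    unfolding D_def using assms by (intro sum_mono mult_left_mono) (auto simp: card_crossing_edges fk_weight_nonneg)
  also have "\<dots> = (\<Sum>F\<in>Pow E. \<Sum>e\<in>E. ?w F * of_bool (forces (frozen F A) (\<lambda>\<sigma>. \<sigma> p * edge_spin e \<sigma>) \<and> \<not> forces (frozen F A) (\<lambda>\<sigma>. \<sigma> p)))"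
  proof -
    have "?w F * card {e \<in> E. forces (frozen F A) (\<lambda>\<sigma>. \<sigma> p * edge_spin e \<sigma>)} = (\<Sum>e\<in>E. ?w F * of_bool (forces (frozen F A) (\<lambda>\<sigma>. \<sigma> p * edge_spin e \<sigma>)))" for F
      using assms(2) by (simp add: sum_distrib_left[symmetric] of_bool_def sum.If_cases Int_def)
    then have "(\<Sum>F | F \<subseteq> E \<and> p \<in> unforced F A. ?w F * card {e \<in> E. forces (frozen F A) (\<lambda>\<sigma>. \<sigma> p * edge_spin e \<sigma>)})
      = (\<Sum>F\<in>Pow E. if p \<in> unforced F A then \<Sum>e\<in>E. ?w F * of_bool (forces (frozen F A) (\<lambda>\<sigma>. \<sigma> p * edge_spin e \<sigma>)) else 0)"
      using assms(2) by (subst sum.inter_filter[symmetric]) (auto intro!: sum.cong)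
    also have "\<dots> = (\<Sum>F\<in>Pow E. \<Sum>e\<in>E. ?w F * of_bool (forces (frozen F A) (\<lambda>\<sigma>. \<sigma> p * edge_spin e \<sigma>) \<and> \<not> forces (frozen F A) (\<lambda>\<sigma>. \<sigma> p)))"
      using assms(5) by (intro sum.cong refl) (auto simp: unforced_def)
    finally show ?thesis .
  qed
  also have "\<dots> = (\<Sum>e\<in>E. Z * ((\<Sum>F\<in>Pow E. ?w F * of_bool (forces (frozen F A) (\<lambda>\<sigma>. \<sigma> p * edge_spin e \<sigma>) \<and> \<not> forces (frozen F A) (\<lambda>\<sigma>. \<sigma> p))) / Z))"
    using \<open>Z > 0\<close> by (subst sum.swap) simp
  also have "\<dots> \<le> (\<Sum>e\<in>E. Z * (ising_mean E A \<beta> (\<lambda>\<sigma>. \<sigma> p * edge_spin e \<sigma>) - ising_mean E A \<beta> (\<lambda>\<sigma>. \<sigma> p) * ising_mean E A \<beta> (edge_spin e)))"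
    using \<open>Z > 0\<close> unfolding Z_def
    by (intro sum_mono mult_left_mono covariance_lower_bound assms character_eval character_edge_spin) auto
  finally show ?thesis using \<open>Z > 0\<close> by (simp add: sum_distrib_left[symmetric])
qed

section \<open>The Simon--Lieb inequality\<close>

lemma ising_mean_spin_pair_nonneg:
  assumes "finite A" "finite E" "\<beta> \<ge> 0"
  shows "ising_mean E A \<beta> (\<lambda>\<sigma>. \<sigma> x * \<sigma> y) \<ge> 0"
  unfolding ising_mean_fk[OF assms(1,2) character_mult[OF character_eval character_eval]]
  using assms(3) by (intro divide_nonneg_nonneg sum_nonneg mult_nonneg_nonneg fk_weight_nonneg) auto

lemma ising_mean_spin_bounds:
  assumes "finite A" "finite E" "\<beta> \<ge> 0"
  shows "ising_mean E A \<beta> (\<lambda>\<sigma>. \<sigma> x) \<ge> 0" "ising_mean E A \<beta> (\<lambda>\<sigma>. \<sigma> x) \<le> 1"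
proof -
  show "ising_mean E A \<beta> (\<lambda>\<sigma>. \<sigma> x) \<ge> 0"
    unfolding ising_mean_fk[OF assms(1,2) character_eval]
    using assms(3) by (intro divide_nonneg_nonneg sum_nonneg mult_nonneg_nonneg fk_weight_nonneg) auto
  have "(\<Sum>F\<in>Pow E. fk_weight \<beta> A F * of_bool (forces (frozen F A) (\<lambda>\<sigma>. \<sigma> x))) \<le> (\<Sum>F\<in>Pow E. fk_weight \<beta> A F)"
    using fk_weight_nonneg[OF assms(3)] by (intro sum_mono) auto
  then show "ising_mean E A \<beta> (\<lambda>\<sigma>. \<sigma> x) \<le> 1"
    unfolding ising_mean_fk[OF assms(1,2) character_eval] using fk_sum_pos[OF assms] by simp
qed

text \<open>The derivative is a sum of covariances, each bounded below by a probability.\<close>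

lemma ising_mean_edge_mono:
  assumes "finite A" "finite E" "0 \<le> \<beta>" "\<beta> \<le> \<beta>'"
  shows "ising_mean E A \<beta> (\<lambda>\<sigma>. \<sigma> p) \<le> ising_mean E A \<beta>' (\<lambda>\<sigma>. \<sigma> p)"
proof (rule DERIV_nonneg_imp_nondecreasing[OF assms(4), of "\<lambda>\<beta>. ising_mean E A \<beta> (\<lambda>\<sigma>. \<sigma> p)"])
  fix t assume "\<beta> \<le> t"
  then have "t \<ge> 0" using assms(3) by simp
  have "0 \<le> ising_mean E A t (\<lambda>\<sigma>. \<sigma> p * edge_spin e \<sigma>) - ising_mean E A t (\<lambda>\<sigma>. \<sigma> p) * ising_mean E A t (edge_spin e)" for e
    by (rule order_trans[OF _ covariance_lower_bound[OF assms(1,2) \<open>t \<ge> 0\<close> character_eval character_edge_spin]])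
      (intro divide_nonneg_nonneg sum_nonneg mult_nonneg_nonneg fk_weight_nonneg \<open>t \<ge> 0\<close>; simp)
  then show "\<exists>y. ((\<lambda>\<beta>. ising_mean E A \<beta> (\<lambda>\<sigma>. \<sigma> p)) has_real_derivative y) (at t) \<and> 0 \<le> y"
    using has_derivative_ising_mean[OF assms(1,2), of "\<lambda>\<sigma>. \<sigma> p" t] by (blast intro: sum_nonneg)
qed

text \<open>By m' \<ge> 1 - m the function (1 - m) exp t is nonincreasing, and 1 - m is at most 1 at
  the left end.\<close>

lemma ising_mean_lower_bound:
  assumes "finite A" "finite E" "\<And>e. e \<in> E \<Longrightarrow> card e = 2" "p \<in> A" "0 \<le> \<beta>" "\<beta> \<le> \<beta>'"
    and phi: "\<And>t S. \<beta> \<le> t \<Longrightarrow> t \<le> \<beta>' \<Longrightarrow> S \<subseteq> A \<Longrightarrow> p \<in> S \<Longrightarrow> boundary_correlation E t p S \<ge> 1"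
  shows "ising_mean E A \<beta>' (\<lambda>\<sigma>. \<sigma> p) \<ge> 1 - exp (\<beta> - \<beta>')"
proof -
  let ?m = "\<lambda>t. ising_mean E A t (\<lambda>\<sigma>. \<sigma> p)"
  have "(1 - ?m \<beta>') * exp \<beta>' \<le> (1 - ?m \<beta>) * exp \<beta>"
  proof (rule DERIV_nonpos_imp_nonincreasing[OF assms(6)])
    fix t assume t: "\<beta> \<le> t" "t \<le> \<beta>'"
    define D where "D = (\<Sum>e\<in>E. ising_mean E A t (\<lambda>\<sigma>. \<sigma> p * edge_spin e \<sigma>) - ?m t * ising_mean E A t (edge_spin e))"
    have "(?m has_real_derivative D) (at t)"
      unfolding D_def by (rule has_derivative_ising_mean[OF assms(1,2)])
    then have "((\<lambda>t. (1 - ?m t) * exp t) has_real_derivative ((1 - ?m t - D) * exp t)) (at t)"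
      by (auto intro!: derivative_eq_intros simp: algebra_simps)
    moreover have "D \<ge> 1 - ?m t"
      unfolding D_def using t assms by (intro derivative_lower_bound) auto
    then have "(1 - ?m t - D) * exp t \<le> 0" by (intro mult_nonpos_nonneg) auto
    ultimately show "\<exists>y. ((\<lambda>t. (1 - ?m t) * exp t) has_real_derivative y) (at t) \<and> y \<le> 0" by blast
  qed
  moreover have "?m \<beta> \<ge> 0"
    by (rule ising_mean_spin_bounds(1)[OF assms(1,2,5)])
  ultimately have "(1 - ?m \<beta>') * exp \<beta>' \<le> 1 * exp \<beta>"
    by (meson diff_le_eq exp_ge_zero le_add_same_cancel1 mult_right_mono order_trans)
  then have "1 - ?m \<beta>' \<le> exp (\<beta> - \<beta>')" by (simp add: exp_diff field_simps)
  then show ?thesis by simp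
qed

definition restrict_spin :: "'a set \<Rightarrow> ('a \<Rightarrow> real) \<Rightarrow> 'a \<Rightarrow> real" where
  "restrict_spin S \<sigma> = (\<lambda>x. if x \<in> S then \<sigma> x else 1)"

lemma restrict_spin_in: "\<sigma> \<in> spins A \<Longrightarrow> restrict_spin S \<sigma> \<in> spins S"
  using spin_cases by (auto simp: spins_def restrict_spin_def)

lemma edge_spin_restrict: "e \<subseteq> S \<Longrightarrow> edge_spin e (restrict_spin S \<sigma>) = edge_spin e \<sigma>"
  unfolding edge_spin_def by (intro prod.cong) (auto simp: restrict_spin_def)

lemma sum_spins_translate:
  assumes "\<tau> \<in> spins S"
  shows "(\<Sum>\<sigma>\<in>spins S. f (\<tau> * \<sigma>)) = (\<Sum>\<sigma>\<in>spins S. f \<sigma>)"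
  by (rule sum.reindex_bij_witness[of _ "(*) \<tau>" "(*) \<tau>"])
    (auto simp: spins_times[OF assms] spins_times_cancel[OF assms])

text \<open>The second copy of the model lives on \<open>S\<close> only; writing it as \<open>\<sigma> * \<epsilon>\<close> makes an edge inside \<open>S\<close>
  contribute \<open>1\<close> unless \<open>\<epsilon>\<close> agrees at its two ends.\<close>

lemma ising_sum_product:
  assumes "finite A" "finite E" "S \<subseteq> A"
  shows "ising_sum E A \<beta> f * ising_sum {e \<in> E. e \<subseteq> S} S \<beta> g
    = (\<Sum>F\<in>Pow {e \<in> E. e \<subseteq> S}. \<Sum>\<sigma>\<in>spins A. f \<sigma>
        * ((\<Prod>e\<in>F. exp (2 * \<beta> * edge_spin e \<sigma>) - 1) * (\<Prod>e\<in>{e \<in> E. \<not> e \<subseteq> S}. exp (\<beta> * edge_spin e \<sigma>)))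
        * (\<Sum>\<epsilon>\<in>frozen F S. g (restrict_spin S \<sigma> * \<epsilon>)))"
proof -
  let ?ES = "{e \<in> E. e \<subseteq> S}" and ?EO = "{e \<in> E. \<not> e \<subseteq> S}"
  have fin: "finite ?ES" "finite ?EO" "finite S" using assms finite_subset by auto
  have eq: "exp (\<beta> * (\<Sum>e\<in>E. edge_spin e \<sigma>)) * exp (\<beta> * (\<Sum>e\<in>?ES. edge_spin e (restrict_spin S \<sigma> * \<epsilon>)))
    = (\<Sum>F\<in>Pow ?ES. (\<Prod>e\<in>F. exp (2 * \<beta> * edge_spin e \<sigma>) - 1) * (\<Prod>e\<in>?EO. exp (\<beta> * edge_spin e \<sigma>)) * of_bool (\<epsilon> \<in> frozen F S))"
    if \<sigma>: "\<sigma> \<in> spins A" and \<epsilon>: "\<epsilon> \<in> spins S" for \<sigma> \<epsilon>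
  proof -
    have "(\<Sum>e\<in>E. edge_spin e \<sigma>) = (\<Sum>e\<in>?ES. edge_spin e \<sigma>) + (\<Sum>e\<in>?EO. edge_spin e \<sigma>)"
      using assms(2) by (subst sum.union_disjoint[symmetric]) (auto intro!: sum.cong)
    moreover have "edge_spin e (restrict_spin S \<sigma> * \<epsilon>) = edge_spin e \<sigma> * edge_spin e \<epsilon>" if "e \<in> ?ES" for e
      using character_times[OF character_edge_spin restrict_spin_in[OF \<sigma>] \<epsilon>, of e] that
      by (simp add: edge_spin_restrict)
    ultimately have "exp (\<beta> * (\<Sum>e\<in>E. edge_spin e \<sigma>)) * exp (\<beta> * (\<Sum>e\<in>?ES. edge_spin e (restrict_spin S \<sigma> * \<epsilon>)))
      = exp (\<Sum>e\<in>?ES. \<beta> * edge_spin e \<sigma> * (1 + edge_spin e \<epsilon>)) * exp (\<Sum>e\<in>?EO. \<beta> * edge_spin e \<sigma>)"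
      by (simp add: exp_add[symmetric] sum_distrib_left sum.distrib algebra_simps)
    also have "\<dots> = (\<Prod>e\<in>?ES. exp (\<beta> * edge_spin e \<sigma> * (1 + edge_spin e \<epsilon>))) * (\<Prod>e\<in>?EO. exp (\<beta> * edge_spin e \<sigma>))"
      using fin by (simp add: exp_sum)
    also have "(\<Prod>e\<in>?ES. exp (\<beta> * edge_spin e \<sigma> * (1 + edge_spin e \<epsilon>)))
      = (\<Prod>e\<in>?ES. (exp (2 * \<beta> * edge_spin e \<sigma>) - 1) * of_bool (edge_spin e \<epsilon> = 1) + 1)"
    proof (rule prod.cong[OF refl])
      fix e
      show "exp (\<beta> * edge_spin e \<sigma> * (1 + edge_spin e \<epsilon>)) = (exp (2 * \<beta> * edge_spin e \<sigma>) - 1) * of_bool (edge_spin e \<epsilon> = 1) + 1"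
        using character_cases[OF character_edge_spin \<epsilon>, of e] by (auto simp: mult_ac)
    qed
    also have "\<dots> = (\<Sum>F\<in>Pow ?ES. \<Prod>e\<in>F. (exp (2 * \<beta> * edge_spin e \<sigma>) - 1) * of_bool (edge_spin e \<epsilon> = 1))"
      using fin by (simp add: prod_add)
    also have "\<dots> = (\<Sum>F\<in>Pow ?ES. (\<Prod>e\<in>F. exp (2 * \<beta> * edge_spin e \<sigma>) - 1) * of_bool (\<epsilon> \<in> frozen F S))"
    proof (rule sum.cong[OF refl])
      fix F assume "F \<in> Pow ?ES"
      then have "finite F" using finite_subset[OF _ fin(1)] by auto
      then have "(\<Prod>e\<in>F. of_bool (edge_spin e \<epsilon> = 1) :: real) = of_bool (\<epsilon> \<in> frozen F S)"
        by (induction F rule: finite_induct) (auto simp: frozen_def \<epsilon>)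
      then show "(\<Prod>e\<in>F. (exp (2 * \<beta> * edge_spin e \<sigma>) - 1) * of_bool (edge_spin e \<epsilon> = 1))
        = (\<Prod>e\<in>F. exp (2 * \<beta> * edge_spin e \<sigma>) - 1) * of_bool (\<epsilon> \<in> frozen F S)"
        by (simp add: prod.distrib)
    qed
    finally show ?thesis unfolding sum_distrib_right by (simp only: mult_ac)
  qed
  let ?R = "\<lambda>F \<sigma>. (\<Prod>e\<in>F. exp (2 * \<beta> * edge_spin e \<sigma>) - 1) * (\<Prod>e\<in>?EO. exp (\<beta> * edge_spin e \<sigma>))"
  have "ising_sum E A \<beta> f * ising_sum ?ES S \<beta> g
    = (\<Sum>\<sigma>\<in>spins A. f \<sigma> * exp (\<beta> * (\<Sum>e\<in>E. edge_spin e \<sigma>)) * (\<Sum>\<epsilon>\<in>spins S. g \<epsilon> * exp (\<beta> * (\<Sum>e\<in>?ES. edge_spin e \<epsilon>))))"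
    by (simp add: ising_sum_def sum_distrib_right)
  also have "\<dots> = (\<Sum>\<sigma>\<in>spins A. f \<sigma> * (\<Sum>\<epsilon>\<in>spins S. g (restrict_spin S \<sigma> * \<epsilon>) *
    (exp (\<beta> * (\<Sum>e\<in>E. edge_spin e \<sigma>)) * exp (\<beta> * (\<Sum>e\<in>?ES. edge_spin e (restrict_spin S \<sigma> * \<epsilon>))))))"
  proof (rule sum.cong[OF refl])
    fix \<sigma> assume "\<sigma> \<in> spins A"
    then have r: "restrict_spin S \<sigma> \<in> spins S" by (rule restrict_spin_in)
    show "f \<sigma> * exp (\<beta> * (\<Sum>e\<in>E. edge_spin e \<sigma>)) * (\<Sum>\<epsilon>\<in>spins S. g \<epsilon> * exp (\<beta> * (\<Sum>e\<in>?ES. edge_spin e \<epsilon>)))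
      = f \<sigma> * (\<Sum>\<epsilon>\<in>spins S. g (restrict_spin S \<sigma> * \<epsilon>) *
    (exp (\<beta> * (\<Sum>e\<in>E. edge_spin e \<sigma>)) * exp (\<beta> * (\<Sum>e\<in>?ES. edge_spin e (restrict_spin S \<sigma> * \<epsilon>)))))"
      unfolding sum_spins_translate[OF r, of "\<lambda>\<epsilon>. g \<epsilon> * exp (\<beta> * (\<Sum>e\<in>?ES. edge_spin e \<epsilon>))", symmetric]
      unfolding mult.assoc sum_distrib_left[of "exp _"] by (simp only: mult.left_commute)
  qed
  also have "\<dots> = (\<Sum>\<sigma>\<in>spins A. f \<sigma> * (\<Sum>\<epsilon>\<in>spins S. g (restrict_spin S \<sigma> * \<epsilon>) *
    (\<Sum>F\<in>Pow ?ES. ?R F \<sigma> * of_bool (\<epsilon> \<in> frozen F S))))"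
    by (intro sum.cong refl arg_cong2[where f = "(*)"] eq)
  also have "\<dots> = (\<Sum>\<sigma>\<in>spins A. \<Sum>F\<in>Pow ?ES. f \<sigma> * ?R F \<sigma> * (\<Sum>\<epsilon>\<in>frozen F S. g (restrict_spin S \<sigma> * \<epsilon>)))"
  proof (rule sum.cong[OF refl])
    fix \<sigma>
    have "f \<sigma> * (\<Sum>\<epsilon>\<in>spins S. g (restrict_spin S \<sigma> * \<epsilon>) * (\<Sum>F\<in>Pow ?ES. ?R F \<sigma> * of_bool (\<epsilon> \<in> frozen F S)))
      = (\<Sum>\<epsilon>\<in>spins S. \<Sum>F\<in>Pow ?ES. f \<sigma> * ?R F \<sigma> * (of_bool (\<epsilon> \<in> frozen F S) * g (restrict_spin S \<sigma> * \<epsilon>)))"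
      by (simp add: sum_distrib_left mult_ac)
    also have "\<dots> = (\<Sum>F\<in>Pow ?ES. f \<sigma> * ?R F \<sigma> * (\<Sum>\<epsilon>\<in>spins S. of_bool (\<epsilon> \<in> frozen F S) * g (restrict_spin S \<sigma> * \<epsilon>)))"
      by (subst sum.swap) (simp add: sum_distrib_left)
    also have "\<dots> = (\<Sum>F\<in>Pow ?ES. f \<sigma> * ?R F \<sigma> * (\<Sum>\<epsilon>\<in>frozen F S. g (restrict_spin S \<sigma> * \<epsilon>)))"
    proof (rule sum.cong[OF refl], rule arg_cong2[where f = "(*)", OF refl])
      fix F
      have "(\<Sum>\<epsilon>\<in>spins S. of_bool (\<epsilon> \<in> frozen F S) * g (restrict_spin S \<sigma> * \<epsilon>)) = (\<Sum>\<epsilon>\<in>spins S. if \<epsilon> \<in> frozen F S then g (restrict_spin S \<sigma> * \<epsilon>) else 0)"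
        by (intro sum.cong) auto
      also have "\<dots> = (\<Sum>\<epsilon>\<in>frozen F S. g (restrict_spin S \<sigma> * \<epsilon>))"
        using fin frozen_subset[of F S] by (simp add: sum.inter_restrict[symmetric] Int_absorb1)
      finally show "(\<Sum>\<epsilon>\<in>spins S. of_bool (\<epsilon> \<in> frozen F S) * g (restrict_spin S \<sigma> * \<epsilon>)) = (\<Sum>\<epsilon>\<in>frozen F S. g (restrict_spin S \<sigma> * \<epsilon>))" .
    qed
    finally show "f \<sigma> * (\<Sum>\<epsilon>\<in>spins S. g (restrict_spin S \<sigma> * \<epsilon>) * (\<Sum>F\<in>Pow ?ES. ?R F \<sigma> * of_bool (\<epsilon> \<in> frozen F S)))
      = (\<Sum>F\<in>Pow ?ES. f \<sigma> * ?R F \<sigma> * (\<Sum>\<epsilon>\<in>frozen F S. g (restrict_spin S \<sigma> * \<epsilon>)))" .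
  qed
  also have "\<dots> = (\<Sum>F\<in>Pow ?ES. \<Sum>\<sigma>\<in>spins A. f \<sigma> * ?R F \<sigma> * (\<Sum>\<epsilon>\<in>frozen F S. g (restrict_spin S \<sigma> * \<epsilon>)))"
    by (rule sum.swap)
  finally show ?thesis .
qed

text \<open>Times both partition functions, the two sides are sums over the same \<open>F\<close>
  with the same factors \<open>W F * card (frozen F S)\<close>. The right side also counts the inner
  boundary sites joined to \<open>p\<close> by \<open>F\<close>, and this count is at least 1
  whenever \<open>W F\<close> is not 0.\<close>

theorem simon_lieb:
  assumes "finite A" "finite E" "\<And>e. e \<in> E \<Longrightarrow> card e = 2" "\<beta> \<ge> 0" "S \<subseteq> A" "p \<in> S"
  shows "ising_mean E A \<beta> (\<lambda>\<sigma>. \<sigma> p)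
    \<le> (\<Sum>x\<in>inner_boundary E S. ising_mean {e \<in> E. e \<subseteq> S} S \<beta> (\<lambda>\<sigma>. \<sigma> p * \<sigma> x) * ising_mean E A \<beta> (\<lambda>\<sigma>. \<sigma> x))"
proof -
  let ?ES = "{e \<in> E. e \<subseteq> S}" and ?EO = "{e \<in> E. \<not> e \<subseteq> S}" and ?B = "inner_boundary E S"
  have fin: "finite ?ES" "finite ?EO" "finite S" using assms finite_subset by auto
  have finB: "finite ?B" using fin by (simp add: inner_boundary_def)
  define R where "R F \<sigma> = (\<Prod>e\<in>F. exp (2 * \<beta> * edge_spin e \<sigma>) - 1) * (\<Prod>e\<in>?EO. exp (\<beta> * edge_spin e \<sigma>))" for F \<sigma>
  define W where "W F = (\<Sum>\<sigma>\<in>spins A. \<sigma> p * R F \<sigma>)" for F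
  define ZA ZS where "ZA = ising_sum E A \<beta> (\<lambda>_. 1)" and "ZS = ising_sum ?ES S \<beta> (\<lambda>_. 1)"
  have Zpos: "ZA > 0" "ZS > 0" unfolding ZA_def ZS_def using assms fin by (auto intro: ising_sum_pos)
  have left: "ising_sum E A \<beta> (\<lambda>\<sigma>. \<sigma> p) * ZS = (\<Sum>F\<in>Pow ?ES. W F * card (frozen F S))"
    unfolding ZS_def ising_sum_product[OF assms(1,2,5)] W_def R_def
    by (simp add: sum_distrib_right)
  have right: "ising_sum E A \<beta> (\<lambda>\<sigma>. \<sigma> x) * ising_sum ?ES S \<beta> (\<lambda>\<sigma>. \<sigma> p * \<sigma> x)
    = (\<Sum>F\<in>Pow ?ES. W F * (card (frozen F S) * of_bool (forces (frozen F S) (\<lambda>\<epsilon>. \<epsilon> p * \<epsilon> x))))" if "x \<in> S" for x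
    unfolding ising_sum_product[OF assms(1,2,5)] sum_character_frozen[OF character_mult[OF character_eval character_eval] fin(3), symmetric] W_def sum_distrib_right
  proof (intro sum.cong refl)
    fix F \<sigma> assume "\<sigma> \<in> spins A"
    \<comment> \<open>The spin at \<open>x\<close> from the first copy cancels the one contained in
      the second copy, which leaves the spin at \<open>p\<close> and thus the factor
      \<open>W F\<close> of the left side.\<close>
    then have "\<sigma> x * \<sigma> x = 1" by (rule spin_square)
    then have "\<sigma> x * c * (\<sigma> p * \<epsilon> p * (\<sigma> x * \<epsilon> x)) = \<sigma> p * c * (\<epsilon> p * \<epsilon> x)" for c and \<epsilon> :: "'a \<Rightarrow> real"
      by (metis (no_types, opaque_lifting) mult.assoc mult.commute mult_1)
    then show "\<sigma> x * ((\<Prod>e\<in>F. exp (2 * \<beta> * edge_spin e \<sigma>) - 1) * (\<Prod>e\<in>?EO. exp (\<beta> * edge_spin e \<sigma>)))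
        * (\<Sum>\<epsilon>\<in>frozen F S. (restrict_spin S \<sigma> * \<epsilon>) p * (restrict_spin S \<sigma> * \<epsilon>) x)
      = \<sigma> p * R F \<sigma> * (\<Sum>\<epsilon>\<in>frozen F S. \<epsilon> p * \<epsilon> x)"
      using assms(6) that unfolding sum_distrib_left R_def
      by (intro sum.cong refl) (simp add: restrict_spin_def)
  qed
  \<comment> \<open>The factors \<open>exp (2 * \<beta> * edge_spin e \<sigma>) - 1\<close> can be
    negative. They equal (cosh (2 \<beta>) - 1) + sinh (2 \<beta>) times the edge spin, so the sum
    is nonnegative by the first Griffiths inequality.\<close>
  have W_nonneg: "W F \<ge> 0" if "F \<in> Pow ?ES" for F
  proof -
    define a b where "a e = (if e \<in> F then (exp (2 * \<beta>) + exp (- (2 * \<beta>))) / 2 - 1 else (exp \<beta> + exp (- \<beta>)) / 2)"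
      and "b e = (if e \<in> F then (exp (2 * \<beta>) - exp (- (2 * \<beta>))) / 2 else (exp \<beta> - exp (- \<beta>)) / 2)" for e :: "'a set"
    have fF: "finite F" using that finite_subset[OF _ fin(1)] by auto
    have "R F \<sigma> = (\<Prod>e\<in>F \<union> ?EO. a e + b e * edge_spin e \<sigma>)" if \<sigma>: "\<sigma> \<in> spins A" for \<sigma>
    proof -
      have "(\<Prod>e\<in>F. exp (2 * \<beta> * edge_spin e \<sigma>) - 1) = (\<Prod>e\<in>F. a e + b e * edge_spin e \<sigma>)"
      proof (rule prod.cong[OF refl])
        fix e assume "e \<in> F"
        then show "exp (2 * \<beta> * edge_spin e \<sigma>) - 1 = a e + b e * edge_spin e \<sigma>"
          using character_cases[OF character_edge_spin \<sigma>, of e] by (auto simp: a_def b_def field_simps)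
      qed
      moreover have "(\<Prod>e\<in>?EO. exp (\<beta> * edge_spin e \<sigma>)) = (\<Prod>e\<in>?EO. a e + b e * edge_spin e \<sigma>)"
      proof (rule prod.cong[OF refl])
        fix e assume "e \<in> ?EO"
        then have "e \<notin> F" using \<open>F \<in> Pow ?ES\<close> by auto
        then show "exp (\<beta> * edge_spin e \<sigma>) = a e + b e * edge_spin e \<sigma>"
          using character_cases[OF character_edge_spin \<sigma>, of e] by (auto simp: a_def b_def field_simps)
      qed
      moreover have "F \<inter> ?EO = {}" using \<open>F \<in> Pow ?ES\<close> by auto
      ultimately show ?thesis unfolding R_def using fF fin by (simp add: prod.union_disjoint)
    qed
    then have "W F = (\<Sum>\<sigma>\<in>spins A. \<sigma> p * (\<Prod>e\<in>F \<union> ?EO. a e + b e * edge_spin e \<sigma>))"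
      by (simp add: W_def)
    also have "\<dots> \<ge> 0"
    proof (rule sum_character_nonneg[OF assms(1) _ character_eval])
      fix e
      have cosh: "1 \<le> (exp c + exp (- c)) / (2 :: real)" for c
        using cosh_real_ge_1[of c] by (simp add: cosh_field_def)
      show "a e \<ge> 0" using cosh[of "2 * \<beta>"] by (auto simp: a_def)
      show "b e \<ge> 0" using assms(4) by (auto simp: b_def)
    qed (use fF fin in auto)
    finally show ?thesis .
  qed
  \<comment> \<open>If the cluster \<open>D\<close> of \<open>p\<close> in \<open>F\<close> misses
    the inner boundary, no edge outside \<open>S\<close> touches it. Flipping \<open>D\<close> then
    preserves \<open>R F\<close> and reverses the spin at \<open>p\<close>, so that W F = - W
    F.\<close>
  have connected: "\<exists>x\<in>?B. forces (frozen F S) (\<lambda>\<epsilon>. \<epsilon> p * \<epsilon> x)" if F: "F \<in> Pow ?ES" and "W F \<noteq> 0" for F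
  proof (rule ccontr)
    assume none: "\<not> (\<exists>x\<in>?B. forces (frozen F S) (\<lambda>\<epsilon>. \<epsilon> p * \<epsilon> x))"
    define D where "D = {x \<in> S. forces (frozen F S) (\<lambda>\<epsilon>. \<epsilon> p * \<epsilon> x)}"
    define \<eta> :: "'a \<Rightarrow> real" where "\<eta> = (\<lambda>x. if x \<in> D then -1 else 1)"
    have "D \<subseteq> A" using assms(5) by (auto simp: D_def)
    then have \<eta>: "\<eta> \<in> spins A" by (auto simp: \<eta>_def spins_def)
    have "p \<in> D"
    proof -
      have "\<epsilon> p * \<epsilon> p = 1" if "\<epsilon> \<in> frozen F S" for \<epsilon>
        using that frozen_subset[of F S] by (intro spin_square[of _ S]) auto
      then show ?thesis using assms(6) by (simp add: D_def forces_def)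
    qed
    have D_out: "e \<inter> D = {}" if "e \<in> ?EO" for e
    proof (rule ccontr)
      assume "e \<inter> D \<noteq> {}"
      then obtain x where x: "x \<in> e" "x \<in> D" by blast
      from that obtain y where y: "y \<in> e" "y \<notin> S" by blast
      have "x \<in> S" using x by (simp add: D_def)
      with that x y assms(3)[of e] have "e = {x, y}" by (auto simp: card_2_iff)
      then have "x \<in> ?B" using \<open>x \<in> S\<close> y(2) that by (auto simp: inner_boundary_def)
      with none x(2) show False by (auto simp: D_def)
    qed
    have D_in: "e \<subseteq> D \<or> e \<inter> D = {}" if "e \<in> F" for e
    proof -
      have "e \<in> ?ES" using that F by blast
      then obtain x y where e: "e = {x, y}" "x \<noteq> y" "x \<in> S" "y \<in> S" using assms(3)[of e] by (auto simp: card_2_iff)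
      have agree: "\<epsilon> x = \<epsilon> y" if "\<epsilon> \<in> frozen F S" for \<epsilon>
      proof -
        have "\<epsilon> x * \<epsilon> y = 1" using that \<open>e \<in> F\<close> e by (auto simp: frozen_def edge_spin_def)
        then show ?thesis using spin_cases[of \<epsilon> S x] spin_cases[of \<epsilon> S y] that frozen_subset by fastforce
      qed
      have "forces (frozen F S) (\<lambda>\<epsilon>. \<epsilon> p * \<epsilon> x) \<longleftrightarrow> forces (frozen F S) (\<lambda>\<epsilon>. \<epsilon> p * \<epsilon> y)"
        unfolding forces_def
      proof (rule ball_cong[OF refl])
        fix \<epsilon> assume "\<epsilon> \<in> frozen F S"
        from agree[OF this] show "\<epsilon> p * \<epsilon> x = 1 \<longleftrightarrow> \<epsilon> p * \<epsilon> y = 1" by simp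
      qed
      then have "x \<in> D \<longleftrightarrow> y \<in> D" using e by (simp add: D_def)
      then show ?thesis using e by auto
    qed
    have edge: "edge_spin e \<eta> = 1" if "e \<in> F \<or> e \<in> ?EO" for e
    proof -
      have "e \<subseteq> D \<or> e \<inter> D = {}" using that D_in D_out by blast
      moreover have "card e = 2" using that F assms(3) by blast
      ultimately show ?thesis
      proof (elim disjE)
        assume "e \<subseteq> D"
        then have "edge_spin e \<eta> = (\<Prod>x\<in>e. -1)" unfolding edge_spin_def by (intro prod.cong) (auto simp: \<eta>_def)
        then show ?thesis using \<open>card e = 2\<close> by simp
      next
        assume "e \<inter> D = {}"
        then show ?thesis unfolding edge_spin_def by (intro prod.neutral) (auto simp: \<eta>_def)
      qed
    qed
    have "W F = (\<Sum>\<sigma>\<in>spins A. (\<eta> * \<sigma>) p * R F (\<eta> * \<sigma>))"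
      unfolding W_def using sum_spins_translate[OF \<eta>, of "\<lambda>\<sigma>. \<sigma> p * R F \<sigma>"] by simp
    also have "\<dots> = (\<Sum>\<sigma>\<in>spins A. - (\<sigma> p * R F \<sigma>))"
    proof (rule sum.cong[OF refl])
      fix \<sigma> assume \<sigma>: "\<sigma> \<in> spins A"
      have "edge_spin e (\<eta> * \<sigma>) = edge_spin e \<sigma>" if "e \<in> F \<or> e \<in> ?EO" for e
        using character_times[OF character_edge_spin \<eta> \<sigma>] edge[OF that] by simp
      then have "R F (\<eta> * \<sigma>) = R F \<sigma>" unfolding R_def by (intro arg_cong2[where f = "(*)"] prod.cong) auto
      then show "(\<eta> * \<sigma>) p * R F (\<eta> * \<sigma>) = - (\<sigma> p * R F \<sigma>)" using \<open>p \<in> D\<close> by (simp add: \<eta>_def)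
    qed
    also have "\<dots> = - W F" by (simp add: W_def sum_negf)
    finally show False using \<open>W F \<noteq> 0\<close> by simp
  qed
  have "ising_sum E A \<beta> (\<lambda>\<sigma>. \<sigma> p) * ZS
    \<le> (\<Sum>F\<in>Pow ?ES. \<Sum>x\<in>?B. W F * (card (frozen F S) * of_bool (forces (frozen F S) (\<lambda>\<epsilon>. \<epsilon> p * \<epsilon> x))))"
    unfolding left
  proof (rule sum_mono)
    fix F assume F: "F \<in> Pow ?ES"
    show "W F * card (frozen F S) \<le> (\<Sum>x\<in>?B. W F * (card (frozen F S) * of_bool (forces (frozen F S) (\<lambda>\<epsilon>. \<epsilon> p * \<epsilon> x))))"
    proof (cases "W F = 0")
      case False
      with connected[OF F] obtain x where x: "x \<in> ?B" "forces (frozen F S) (\<lambda>\<epsilon>. \<epsilon> p * \<epsilon> x)" by blast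
      have "W F * (card (frozen F S) * of_bool (forces (frozen F S) (\<lambda>\<epsilon>. \<epsilon> p * \<epsilon> x)))
        \<le> (\<Sum>x\<in>?B. W F * (card (frozen F S) * of_bool (forces (frozen F S) (\<lambda>\<epsilon>. \<epsilon> p * \<epsilon> x))))"
        by (rule member_le_sum[OF x(1)]) (use finB W_nonneg[OF F] in auto)
      then show ?thesis using x(2) by simp
    qed simp
  qed
  also have "\<dots> = (\<Sum>x\<in>?B. ising_sum E A \<beta> (\<lambda>\<sigma>. \<sigma> x) * ising_sum ?ES S \<beta> (\<lambda>\<sigma>. \<sigma> p * \<sigma> x))"
    by (subst sum.swap) (intro sum.cong refl right[symmetric], simp add: inner_boundary_def)
  finally have "ising_sum E A \<beta> (\<lambda>\<sigma>. \<sigma> p) * ZS / (ZA * ZS)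
    \<le> (\<Sum>x\<in>?B. ising_sum E A \<beta> (\<lambda>\<sigma>. \<sigma> x) * ising_sum ?ES S \<beta> (\<lambda>\<sigma>. \<sigma> p * \<sigma> x)) / (ZA * ZS)"
    using Zpos by (intro divide_right_mono) auto
  then show ?thesis
    using Zpos by (simp add: ising_mean_def ZA_def[symmetric] ZS_def[symmetric] sum_divide_distrib mult_ac)
qed

section \<open>The lattice model\<close>

definition lattice_edges :: "(int ^ 'd) set set" where
  "lattice_edges = {{x, y} | x y. l1_norm (x - y) = 1}"

lemma l1_norm_zero [simp]: "l1_norm (0 :: int ^ 'd) = 0"
  by (simp add: l1_norm_def)

lemma l1_norm_minus_commute: "l1_norm (x - y :: int ^ 'd) = l1_norm (y - x)"
  by (simp add: l1_norm_def abs_minus_commute)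

lemma abs_le_l1_norm: "\<bar>(x :: int ^ 'd) $ i\<bar> \<le> l1_norm x"
  unfolding l1_norm_def by (rule member_le_sum) auto

lemma card_lattice_edge:
  assumes "e \<in> lattice_edges"
  shows "card e = 2"
proof -
  obtain x y where "e = {x, y}" "l1_norm (x - y) = 1" using assms by (auto simp: lattice_edges_def)
  then show ?thesis by (cases "x = y") auto
qed

lemma box_edges_subset: "box_edges N \<subseteq> lattice_edges"
  by (auto simp: box_edges_def lattice_edges_def)

lemma card_box_edge: "e \<in> box_edges N \<Longrightarrow> card e = 2"
  using box_edges_subset card_lattice_edge by blast

lemma box_lattice_mono: "N \<le> M \<Longrightarrow> box_lattice N \<subseteq> box_lattice M"
  unfolding box_lattice_def by (auto) (meson of_nat_mono le_imp_neg_le order_trans)+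

lemma box_lattice_add:
  assumes "x \<in> box_lattice N" "y \<in> box_lattice M"
  shows "x + y \<in> box_lattice (N + M)"
proof -
  have "- int (N + M) \<le> (x + y) $ i \<and> (x + y) $ i \<le> int (N + M)" for i
    using assms[unfolded box_lattice_def mem_Collect_eq, rule_format, of i] by simp
  then show ?thesis by (simp add: box_lattice_def)
qed

lemma zero_in_box_lattice: "0 \<in> box_lattice N"
  by (simp add: box_lattice_def)

lemma outer_boundary_subset: "outer_boundary N \<subseteq> box_lattice (N + 1)"
proof
  fix x :: "int ^ 'd" assume "x \<in> outer_boundary N"
  then obtain y where y: "y \<in> box_lattice N" "l1_norm (x - y) = 1" by (auto simp: outer_boundary_def)
  have "x - y \<in> box_lattice 1"
    using abs_le_l1_norm[of "x - y"] y(2) by (auto simp: box_lattice_def abs_le_iff) (smt (verit))+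
  from box_lattice_add[OF y(1) this] show "x \<in> box_lattice (N + 1)" by simp
qed

lemma finite_box_edges: "finite (box_edges N :: (int ^ 'd) set set)"
proof -
  have "box_edges N \<subseteq> Pow (box_lattice (N + 1) :: (int ^ 'd) set)"
    using outer_boundary_subset[of N] box_lattice_mono[of N "N + 1"] by (fastforce simp: box_edges_def)
  then show ?thesis by (rule finite_subset) (simp add: finite_box_lattice)
qed

lemma box_edge_meets: "e \<in> box_edges N \<Longrightarrow> e \<inter> box_lattice N \<noteq> {}"
  by (auto simp: box_edges_def)

text \<open>An edge that leaves the box has exactly one end inside, so a constant boundary condition
  acts as a field with this multiplicity.\<close>

definition boundary_degree :: "nat \<Rightarrow> int ^ 'd \<Rightarrow> nat" where
  "boundary_degree N x = card {e \<in> box_edges N. \<not> e \<subseteq> box_lattice N \<and> x \<in> e}"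

lemma box_energy_split:
  fixes \<sigma> :: "int ^ 'd \<Rightarrow> real" and b :: real
  shows "(\<Sum>e\<in>box_edges N. \<Prod>x\<in>e. with_boundary N b \<sigma> x)
    = (\<Sum>e\<in>{e \<in> box_edges N. e \<subseteq> box_lattice N}. \<Prod>x\<in>e. \<sigma> x) + b * (\<Sum>x\<in>box_lattice N. boundary_degree N x * \<sigma> x)"
proof -
  let ?B = "box_lattice N :: (int ^ 'd) set" and ?E = "box_edges N :: (int ^ 'd) set set"
  let ?EI = "{e \<in> ?E. e \<subseteq> ?B}" and ?EO = "{e \<in> ?E. \<not> e \<subseteq> ?B}"
  have "(\<Sum>e\<in>?E. \<Prod>x\<in>e. with_boundary N b \<sigma> x) = (\<Sum>e\<in>?EI. \<Prod>x\<in>e. with_boundary N b \<sigma> x) + (\<Sum>e\<in>?EO. \<Prod>x\<in>e. with_boundary N b \<sigma> x)"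
    by (subst sum.union_disjoint[symmetric]) (auto simp: finite_box_edges intro!: sum.cong)
  also have "(\<Sum>e\<in>?EI. \<Prod>x\<in>e. with_boundary N b \<sigma> x) = (\<Sum>e\<in>?EI. \<Prod>x\<in>e. \<sigma> x)"
    by (intro sum.cong prod.cong refl) (auto simp: with_boundary_def)
  also have "(\<Sum>e\<in>?EO. \<Prod>x\<in>e. with_boundary N b \<sigma> x) = (\<Sum>e\<in>?EO. \<Sum>x | x \<in> ?B \<and> x \<in> e. b * \<sigma> x)"
  proof (rule sum.cong[OF refl])
    fix e assume e: "e \<in> ?EO"
    then obtain x y where "x \<in> e" "x \<in> ?B" "y \<in> e" "y \<notin> ?B" using box_edge_meets by blast
    with e card_box_edge[of e N] have xy: "e = {x, y}" "x \<noteq> y" "{z. z \<in> ?B \<and> z \<in> e} = {x}"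
      by (auto simp: card_2_iff)
    then show "(\<Prod>x\<in>e. with_boundary N b \<sigma> x) = (\<Sum>x | x \<in> ?B \<and> x \<in> e. b * \<sigma> x)"
      using \<open>x \<in> ?B\<close> \<open>y \<notin> ?B\<close> unfolding xy(3) by (simp add: xy(1,2) with_boundary_def)
  qed
  also have "\<dots> = (\<Sum>x\<in>?B. \<Sum>e | e \<in> ?EO \<and> x \<in> e. b * \<sigma> x)"
    by (rule sum.swap_restrict) (simp_all add: finite_box_edges finite_box_lattice)
  also have "\<dots> = b * (\<Sum>x\<in>?B. boundary_degree N x * \<sigma> x)"
    by (simp add: boundary_degree_def sum_distrib_left conj_assoc mult_ac)
  finally show ?thesis .
qed

lemma sum_extensional_spins:
  fixes f :: "('a \<Rightarrow> real) \<Rightarrow> real"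
  shows "(\<Sum>\<sigma>\<in>A \<rightarrow>\<^sub>E {-1, 1}. f \<sigma>) = (\<Sum>\<sigma>\<in>spins A. f (restrict \<sigma> A))"
proof (rule sum.reindex_bij_witness[of _ "\<lambda>\<sigma>. restrict \<sigma> A" "\<lambda>\<sigma> x. if x \<in> A then \<sigma> x else 1"])
  fix \<sigma> :: "'a \<Rightarrow> real" assume \<sigma>: "\<sigma> \<in> A \<rightarrow>\<^sub>E {-1, 1}"
  show "restrict (\<lambda>x. if x \<in> A then \<sigma> x else 1) A = \<sigma>"
    using \<sigma> by (auto simp: fun_eq_iff restrict_def PiE_def extensional_def)
  then show "f (restrict (\<lambda>x. if x \<in> A then \<sigma> x else 1) A) = f \<sigma>" by simp
  show "(\<lambda>x. if x \<in> A then \<sigma> x else 1) \<in> spins A"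
    using \<sigma> by (auto simp: spins_def PiE_def)
next
  fix \<sigma> :: "'a \<Rightarrow> real" assume \<sigma>: "\<sigma> \<in> spins A"
  then show "(\<lambda>x. if x \<in> A then restrict \<sigma> A x else 1) = \<sigma>" by (auto simp: fun_eq_iff spins_def)
  show "restrict \<sigma> A \<in> A \<rightarrow>\<^sub>E {-1, 1}" using \<sigma> by (auto simp: spins_def)
qed

definition box_coupling :: "real \<Rightarrow> nat \<Rightarrow> (int ^ 'd) set \<Rightarrow> real" where
  "box_coupling \<beta> N e = (if e \<in> box_edges N then \<beta> else 0)"

lemma spin_configs_finite_field:
  fixes \<omega> :: "int ^ 'd \<Rightarrow> ereal"
  assumes "\<And>x. x \<in> box_lattice N \<Longrightarrow> \<bar>\<omega> x\<bar> \<noteq> \<infinity>"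
  shows "spin_configs \<omega> N = box_lattice N \<rightarrow>\<^sub>E {-1, 1}"
proof -
  have "(\<omega> x = \<infinity> \<longrightarrow> \<sigma> x = 1) \<and> (\<omega> x = -\<infinity> \<longrightarrow> \<sigma> x = -1)" if "x \<in> box_lattice N" for x and \<sigma> :: "int ^ 'd \<Rightarrow> real"
    using assms[OF that] by (cases "\<omega> x") simp_all
  then show ?thesis by (simp add: spin_configs_def)
qed

text \<open>Writing the boundary condition as a field turns the change from minus to plus into the
  change from \<open>h - v\<close> to \<open>h + v\<close> of
  \<open>field_mean_difference_le\<close>.\<close>

lemma magnetization_field_mean:
  fixes \<omega> :: "int ^ 'd \<Rightarrow> ereal"
  assumes fin: "\<And>x. x \<in> box_lattice N \<Longrightarrow> \<bar>\<omega> x\<bar> \<noteq> \<infinity>"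
  shows "magnetization \<beta> \<omega> b N = field_mean (box_coupling \<beta> N) (box_lattice N) 0
    (\<lambda>x. real_of_ereal (\<omega> x) + b * (\<beta> * boundary_degree N x))"
proof -
  let ?B = "box_lattice N :: (int ^ 'd) set"
  let ?h = "\<lambda>x. real_of_ereal (\<omega> x) + b * (\<beta> * boundary_degree N x)"
  let ?w = "\<lambda>\<sigma>. exp ((\<Sum>e | e \<subseteq> ?B \<and> card e = 2. box_coupling \<beta> N e * (\<Prod>x\<in>e. \<sigma> x)) + (\<Sum>x\<in>?B. ?h x * \<sigma> x))"
  have configs: "spin_configs \<omega> N = ?B \<rightarrow>\<^sub>E {-1, 1}"
    by (rule spin_configs_finite_field[OF fin])
  have sites: "{x. x \<in> ?B \<and> \<bar>\<omega> x\<bar> \<noteq> \<infinity>} = ?B"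
    by (rule Collect_conj_eq[THEN trans]) (use fin in \<open>simp add: Int_absorb2 subset_iff\<close>)
  have weight: "ising_weight \<beta> \<omega> b N (restrict \<sigma> ?B) = ?w \<sigma>" for \<sigma>
  proof -
    have "with_boundary N b (restrict \<sigma> ?B) = with_boundary N b \<sigma>" by (auto simp: with_boundary_def)
    moreover have "\<beta> * (\<Sum>e\<in>{e \<in> box_edges N. e \<subseteq> ?B}. \<Prod>x\<in>e. \<sigma> x) = (\<Sum>e | e \<subseteq> ?B \<and> card e = 2. box_coupling \<beta> N e * (\<Prod>x\<in>e. \<sigma> x))"
      unfolding sum_distrib_left
      by (rule sum.mono_neutral_cong_left)
        (auto simp: box_coupling_def card_box_edge finite_box_lattice intro: finite_subset[of _ "Pow ?B"])
    moreover have "b * (\<beta> * (\<Sum>x\<in>?B. boundary_degree N x * \<sigma> x)) + (\<Sum>x\<in>?B. real_of_ereal (\<omega> x) * \<sigma> x) = (\<Sum>x\<in>?B. ?h x * \<sigma> x)"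
      by (simp add: sum_distrib_left sum.distrib[symmetric] algebra_simps)
    moreover have "ising_weight \<beta> \<omega> b N (restrict \<sigma> ?B)
      = exp (\<beta> * (\<Sum>e\<in>box_edges N. \<Prod>x\<in>e. with_boundary N b \<sigma> x) + (\<Sum>x\<in>?B. real_of_ereal (\<omega> x) * \<sigma> x))"
      unfolding ising_weight_def sites calculation(1) by simp
    ultimately show ?thesis
      unfolding box_energy_split by (simp add: distrib_left mult.left_commute)
  qed
  have "magnetization \<beta> \<omega> b N = (\<Sum>\<sigma>\<in>spins ?B. ?w \<sigma> * restrict \<sigma> ?B 0) / (\<Sum>\<sigma>\<in>spins ?B. ?w \<sigma>)"
    unfolding magnetization_eq_sum partition_function_def configs sum_extensional_spins weight ..
  also have "\<dots> = field_mean (box_coupling \<beta> N) ?B 0 ?h"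
    by (simp add: field_mean_def field_Z_def zero_in_box_lattice mult.commute)
  finally show ?thesis .
qed

text \<open>The plus boundary condition is the default value 1 of \<open>spins\<close>, so edges
  leaving the box can stay as they are.\<close>

lemma magnetization_ising_mean:
  "magnetization \<beta> (\<lambda>_ :: int ^ 'd. 0) 1 N = ising_mean (box_edges N) (box_lattice N :: (int ^ 'd) set) \<beta> (\<lambda>\<sigma>. \<sigma> 0)"
proof -
  let ?B = "box_lattice N :: (int ^ 'd) set"
  have configs: "spin_configs (\<lambda>_. 0) N = ?B \<rightarrow>\<^sub>E {-1, 1}"
    by (rule spin_configs_finite_field) simp
  have weight: "ising_weight \<beta> (\<lambda>_. 0) 1 N (restrict \<sigma> ?B) = exp (\<beta> * (\<Sum>e\<in>box_edges N. edge_spin e \<sigma>))" if "\<sigma> \<in> spins ?B" for \<sigma>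
  proof -
    have "with_boundary N 1 (restrict \<sigma> ?B) = \<sigma>" using that by (auto simp: with_boundary_def spins_def)
    then show ?thesis by (simp add: ising_weight_def edge_spin_def)
  qed
  have "magnetization \<beta> (\<lambda>_ :: int ^ 'd. 0) 1 N
    = (\<Sum>\<sigma>\<in>spins ?B. ising_weight \<beta> (\<lambda>_. 0) 1 N (restrict \<sigma> ?B) * restrict \<sigma> ?B 0) / (\<Sum>\<sigma>\<in>spins ?B. ising_weight \<beta> (\<lambda>_. 0) 1 N (restrict \<sigma> ?B))"
    unfolding magnetization_eq_sum partition_function_def configs sum_extensional_spins ..
  then show ?thesis
    using weight by (simp add: ising_mean_def ising_sum_def zero_in_box_lattice mult.commute)
qed

lemma magnetization_minus:
  "magnetization \<beta> (\<lambda>_ :: int ^ 'd. 0) (-1) N = - magnetization \<beta> (\<lambda>_ :: int ^ 'd. 0) 1 N"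
  using field_mean_uminus[OF finite_box_lattice zero_in_box_lattice,
      where J = "box_coupling \<beta> N" and h = "\<lambda>x. \<beta> * boundary_degree N x"]
  by (simp add: magnetization_field_mean fun_Compl_def)

section \<open>Infinite fields as limits of finite ones\<close>

definition cut_off :: "(int ^ 'd \<Rightarrow> ereal) \<Rightarrow> nat \<Rightarrow> int ^ 'd \<Rightarrow> ereal" where
  "cut_off \<omega> n x = (if \<omega> x = \<infinity> then ereal n else if \<omega> x = -\<infinity> then ereal (- n) else \<omega> x)"

lemma cut_off_finite: "\<bar>cut_off \<omega> n x\<bar> \<noteq> \<infinity>"
  by (cases "\<omega> x") (auto simp: cut_off_def)

text \<open>Up to the factor exp (n |P|), which cancels in the quotient, a configuration has its
  weight in the limiting model times exp (n r). Here r \<le> 0, with equality exactly when all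
  constraints from infinite fields are met.\<close>

lemma magnetization_cut_off_tendsto:
  fixes \<omega> :: "int ^ 'd \<Rightarrow> ereal"
  shows "(\<lambda>n. magnetization \<beta> (cut_off \<omega> n) b N) \<longlonglongrightarrow> magnetization \<beta> \<omega> b N"
proof -
  let ?B = "box_lattice N :: (int ^ 'd) set" and ?C = "box_lattice N \<rightarrow>\<^sub>E {-1, 1} :: (int ^ 'd \<Rightarrow> real) set"
  define P where "P = {x \<in> ?B. \<bar>\<omega> x\<bar> = \<infinity>}"
  define s where "s x = (if \<omega> x = \<infinity> then 1 else -1 :: real)" for x
  define w where "w = ising_weight \<beta> \<omega> b N"
  define r where "r \<sigma> = (\<Sum>x\<in>P. s x * \<sigma> x - 1)" for \<sigma>
  have finC: "finite ?C" by (rule finite_PiE[OF finite_box_lattice]) auto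
  have finP: "finite P" by (simp add: P_def finite_box_lattice)
  have configs: "spin_configs (cut_off \<omega> n) N = ?C" for n
    by (rule spin_configs_finite_field) (rule cut_off_finite)
  have weight: "ising_weight \<beta> (cut_off \<omega> n) b N \<sigma> = exp (real n * card P) * (w \<sigma> * exp (n * r \<sigma>))" for n \<sigma>
  proof -
    have "(\<Sum>x | x \<in> ?B \<and> \<bar>cut_off \<omega> n x\<bar> \<noteq> \<infinity>. real_of_ereal (cut_off \<omega> n x) * \<sigma> x)
      = (\<Sum>x\<in>{x. x \<in> ?B \<and> \<bar>\<omega> x\<bar> \<noteq> \<infinity>} \<union> P. real_of_ereal (cut_off \<omega> n x) * \<sigma> x)"
      using cut_off_finite[of \<omega> n] by (intro sum.cong) (auto simp: P_def)
    also have "\<dots> = (\<Sum>x | x \<in> ?B \<and> \<bar>\<omega> x\<bar> \<noteq> \<infinity>. real_of_ereal (cut_off \<omega> n x) * \<sigma> x) + (\<Sum>x\<in>P. real_of_ereal (cut_off \<omega> n x) * \<sigma> x)"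
      using finP by (intro sum.union_disjoint) (auto simp: P_def finite_box_lattice)
    also have "(\<Sum>x | x \<in> ?B \<and> \<bar>\<omega> x\<bar> \<noteq> \<infinity>. real_of_ereal (cut_off \<omega> n x) * \<sigma> x) = (\<Sum>x | x \<in> ?B \<and> \<bar>\<omega> x\<bar> \<noteq> \<infinity>. real_of_ereal (\<omega> x) * \<sigma> x)"
      by (intro sum.cong) (auto simp: cut_off_def)
    also have "(\<Sum>x\<in>P. real_of_ereal (cut_off \<omega> n x) * \<sigma> x) = (\<Sum>x\<in>P. n * (s x * \<sigma> x - 1) + n)"
      by (intro sum.cong) (auto simp: cut_off_def P_def s_def algebra_simps)
    also have "\<dots> = n * r \<sigma> + real n * card P" by (simp add: r_def sum.distrib sum_distrib_left)
    finally show ?thesis by (simp add: ising_weight_def w_def exp_add mult_ac)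
  qed
  have lim: "(\<lambda>n. w \<sigma> * exp (real n * r \<sigma>)) \<longlonglongrightarrow> (if \<sigma> \<in> spin_configs \<omega> N then w \<sigma> else 0)" if \<sigma>: "\<sigma> \<in> ?C" for \<sigma>
  proof -
    have pm: "\<sigma> x = 1 \<or> \<sigma> x = -1" if "x \<in> ?B" for x using \<sigma> that by (auto simp: PiE_def Pi_def)
    have ok: "\<sigma> \<in> spin_configs \<omega> N \<longleftrightarrow> (\<forall>x\<in>P. s x * \<sigma> x = 1)"
    proof -
      have "(\<omega> x = \<infinity> \<longrightarrow> \<sigma> x = 1) \<and> (\<omega> x = -\<infinity> \<longrightarrow> \<sigma> x = -1) \<longleftrightarrow> (x \<in> P \<longrightarrow> s x * \<sigma> x = 1)" if "x \<in> ?B" for x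
        using that by (cases "\<omega> x") (auto simp: P_def s_def)
      then show ?thesis using \<sigma> by (auto simp: spin_configs_def P_def)
    qed
    have le: "s x * \<sigma> x - 1 \<le> 0" if "x \<in> P" for x
      using pm[of x] that by (auto simp: s_def P_def)
    show ?thesis
    proof (cases "\<sigma> \<in> spin_configs \<omega> N")
      case True
      then show ?thesis using ok by (simp add: r_def)
    next
      case False
      then obtain x where x: "x \<in> P" "s x * \<sigma> x \<noteq> 1" using ok by blast
      have "r \<sigma> < (\<Sum>x\<in>P. 0)"
        unfolding r_def
      proof (rule sum_strict_mono_ex1[OF finP])
        have "s x * \<sigma> x - 1 < 0" using le[OF x(1)] x(2) by simp
        then show "\<exists>a\<in>P. s a * \<sigma> a - 1 < 0" using x(1) by blast
      qed (use le in blast)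
      then have "filterlim (\<lambda>n. r \<sigma> * real n) at_bot sequentially"
        by (intro filterlim_tendsto_neg_mult_at_bot[OF tendsto_const] filterlim_real_sequentially) auto
      then have "filterlim (\<lambda>n. real n * r \<sigma>) at_bot sequentially" by (simp add: mult.commute)
      from filterlim_compose[OF exp_at_bot this] have "(\<lambda>n. w \<sigma> * exp (real n * r \<sigma>)) \<longlonglongrightarrow> w \<sigma> * 0"
        by (intro tendsto_intros)
      then show ?thesis using False by simp
    qed
  qed
  have sub: "spin_configs \<omega> N \<subseteq> ?C" by (auto simp: spin_configs_def)
  have sums: "(\<lambda>n. \<Sum>\<sigma>\<in>?C. w \<sigma> * exp (real n * r \<sigma>) * f \<sigma>) \<longlonglongrightarrow> (\<Sum>\<sigma>\<in>spin_configs \<omega> N. w \<sigma> * f \<sigma>)" for f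
  proof -
    have "(\<lambda>n. \<Sum>\<sigma>\<in>?C. w \<sigma> * exp (real n * r \<sigma>) * f \<sigma>) \<longlonglongrightarrow> (\<Sum>\<sigma>\<in>?C. (if \<sigma> \<in> spin_configs \<omega> N then w \<sigma> else 0) * f \<sigma>)"
      by (intro tendsto_sum tendsto_mult lim tendsto_const)
    also have "(\<Sum>\<sigma>\<in>?C. (if \<sigma> \<in> spin_configs \<omega> N then w \<sigma> else 0) * f \<sigma>) = (\<Sum>\<sigma>\<in>spin_configs \<omega> N. w \<sigma> * f \<sigma>)"
      using finC sub by (intro sum.mono_neutral_cong_right) auto
    finally show ?thesis .
  qed
  have "(\<lambda>n. (\<Sum>\<sigma>\<in>?C. w \<sigma> * exp (real n * r \<sigma>) * \<sigma> 0) / (\<Sum>\<sigma>\<in>?C. w \<sigma> * exp (real n * r \<sigma>) * 1))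
    \<longlonglongrightarrow> (\<Sum>\<sigma>\<in>spin_configs \<omega> N. w \<sigma> * \<sigma> 0) / (\<Sum>\<sigma>\<in>spin_configs \<omega> N. w \<sigma> * 1)"
    using partition_function_pos[of \<beta> \<omega> b N]
    by (intro tendsto_divide sums) (simp add: partition_function_def w_def)
  moreover have "magnetization \<beta> (cut_off \<omega> n) b N = (\<Sum>\<sigma>\<in>?C. w \<sigma> * exp (real n * r \<sigma>) * \<sigma> 0) / (\<Sum>\<sigma>\<in>?C. w \<sigma> * exp (real n * r \<sigma>) * 1)" for n
    unfolding magnetization_eq_sum partition_function_def configs weight
    by (simp add: mult.assoc sum_distrib_left[symmetric])
  ultimately show ?thesis by (simp add: magnetization_eq_sum partition_function_def w_def)
qed

theorem boundary_influence_le: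
  fixes \<omega> :: "int ^ 'd \<Rightarrow> ereal"
  assumes "\<beta> \<ge> 0"
  shows "magnetization \<beta> \<omega> 1 N - magnetization \<beta> \<omega> (-1) N
    \<le> magnetization \<beta> (\<lambda>_ :: int ^ 'd. 0) 1 N - magnetization \<beta> (\<lambda>_ :: int ^ 'd. 0) (-1) N"
proof (rule LIMSEQ_le_const2)
  show "(\<lambda>n. magnetization \<beta> (cut_off \<omega> n) 1 N - magnetization \<beta> (cut_off \<omega> n) (-1) N)
    \<longlonglongrightarrow> magnetization \<beta> \<omega> 1 N - magnetization \<beta> \<omega> (-1) N"
    by (intro tendsto_diff magnetization_cut_off_tendsto)
  let ?J = "box_coupling \<beta> N :: (int ^ 'd) set \<Rightarrow> real"
  define v where "v = (\<lambda>x :: int ^ 'd. \<beta> * boundary_degree N x)"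
  have "magnetization \<beta> (cut_off \<omega> n) 1 N - magnetization \<beta> (cut_off \<omega> n) (-1) N
    \<le> magnetization \<beta> (\<lambda>_ :: int ^ 'd. 0) 1 N - magnetization \<beta> (\<lambda>_ :: int ^ 'd. 0) (-1) N" for n
  proof -
    define h where "h = (\<lambda>x. real_of_ereal (cut_off \<omega> n x))"
    have "field_mean ?J (box_lattice N) 0 (h + v) - field_mean ?J (box_lattice N) 0 (h - v)
      \<le> field_mean ?J (box_lattice N) 0 v - field_mean ?J (box_lattice N) 0 (- v)"
      by (rule field_mean_difference_le)
        (use assms in \<open>auto simp: finite_box_lattice zero_in_box_lattice box_coupling_def v_def\<close>)
    then show ?thesis
      by (simp add: magnetization_field_mean cut_off_finite fun_ops h_def v_def)
  qed
  then show "\<exists>M. \<forall>n\<ge>M. magnetization \<beta> (cut_off \<omega> n) 1 N - magnetization \<beta> (cut_off \<omega> n) (-1) N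
    \<le> magnetization \<beta> (\<lambda>_ :: int ^ 'd. 0) 1 N - magnetization \<beta> (\<lambda>_ :: int ^ 'd. 0) (-1) N" by blast
qed


section \<open>Translation invariance and exponential decay below the critical point\<close>

lemma spins_image:
  fixes \<pi> :: "'a \<Rightarrow> 'a"
  assumes "bij \<pi>"
  shows "(\<Sum>\<sigma>\<in>spins (\<pi> ` A). f \<sigma>) = (\<Sum>\<sigma>\<in>spins A. f (\<sigma> \<circ> inv \<pi>))"
proof (rule sum.reindex_bij_witness[of _ "\<lambda>\<sigma>. \<sigma> \<circ> inv \<pi>" "\<lambda>\<sigma>. \<sigma> \<circ> \<pi>"])
  have inv: "inv \<pi> \<circ> \<pi> = id" "\<pi> \<circ> inv \<pi> = id" and ap: "inv \<pi> (\<pi> x) = x" "\<pi> (inv \<pi> x) = x" for x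
    using assms by (simp_all add: bij_is_inj bij_is_surj surj_f_inv_f flip: surj_iff)
  fix \<sigma> :: "'a \<Rightarrow> real"
  show "(\<sigma> \<circ> \<pi>) \<circ> inv \<pi> = \<sigma>" "(\<sigma> \<circ> inv \<pi>) \<circ> \<pi> = \<sigma>" by (simp_all add: comp_assoc inv)
  then show "f ((\<sigma> \<circ> \<pi>) \<circ> inv \<pi>) = f \<sigma>" by simp
  show "\<sigma> \<circ> \<pi> \<in> spins A" if "\<sigma> \<in> spins (\<pi> ` A)"
    using that assms by (auto simp: spins_def bij_is_inj inj_image_mem_iff)
  show "\<sigma> \<circ> inv \<pi> \<in> spins (\<pi> ` A)" if "\<sigma> \<in> spins A"
    using that ap by (fastforce simp: spins_def image_iff)
qed

lemma ising_mean_image: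
  fixes \<pi> :: "'a \<Rightarrow> 'a"
  assumes "bij \<pi>"
  shows "ising_mean ((`) \<pi> ` E) (\<pi> ` A) \<beta> f = ising_mean E A \<beta> (\<lambda>\<sigma>. f (\<sigma> \<circ> inv \<pi>))"
proof -
  have inj: "inj \<pi>" using assms by (rule bij_is_inj)
  have edge: "edge_spin (\<pi> ` e) (\<sigma> \<circ> inv \<pi>) = edge_spin e \<sigma>" for e and \<sigma> :: "'a \<Rightarrow> real"
    unfolding edge_spin_def using inj by (subst prod.reindex) (auto intro: inj_on_subset)
  have "ising_sum ((`) \<pi> ` E) (\<pi> ` A) \<beta> f = ising_sum E A \<beta> (\<lambda>\<sigma>. f (\<sigma> \<circ> inv \<pi>))" for f
  proof -
    have "inj_on ((`) \<pi>) E" using inj by (auto intro!: inj_onI simp: inj_image_eq_iff)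
    then have "(\<Sum>e\<in>(`) \<pi> ` E. edge_spin e (\<sigma> \<circ> inv \<pi>)) = (\<Sum>e\<in>E. edge_spin e \<sigma>)" for \<sigma> :: "'a \<Rightarrow> real"
      by (simp add: sum.reindex edge)
    then show ?thesis unfolding ising_sum_def spins_image[OF assms] by simp
  qed
  then show ?thesis by (simp add: ising_mean_def)
qed

lemma translate_lattice_edge: "(+) z ` e \<in> lattice_edges \<longleftrightarrow> e \<in> lattice_edges"
proof -
  have *: "(+) w ` e \<in> lattice_edges" if e: "e \<in> lattice_edges" for e and w :: "int ^ 'd"
  proof -
    obtain x y where "e = {x, y}" "l1_norm (x - y) = 1" using e by (auto simp: lattice_edges_def)
    then have "(+) w ` e = {w + x, w + y}" "l1_norm ((w + x) - (w + y)) = 1" by auto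
    then show ?thesis unfolding lattice_edges_def by blast
  qed
  have "(+) (- z) ` (+) z ` e = e" by (simp add: image_image)
  then show ?thesis using *[of e z] *[of "(+) z ` e" "- z"] by auto
qed

text \<open>Lets one set around the origin serve at every site in the iteration of
  \<open>simon_lieb\<close>.\<close>

lemma boundary_correlation_translate:
  "boundary_correlation lattice_edges \<beta> (z + p) ((+) z ` S) = boundary_correlation lattice_edges \<beta> p S"
proof -
  have bij: "bij ((+) z)" by simp
  have edges: "{e \<in> lattice_edges. e \<subseteq> (+) z ` S} = (`) ((+) z) ` {e \<in> lattice_edges. e \<subseteq> S}"
  proof (intro equalityI subsetI)
    fix e assume e: "e \<in> {e \<in> lattice_edges. e \<subseteq> (+) z ` S}"
    then obtain e' where e': "e = (+) z ` e'" "e' \<subseteq> S" by (auto simp: subset_image_iff)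
    with e translate_lattice_edge show "e \<in> (`) ((+) z) ` {e \<in> lattice_edges. e \<subseteq> S}" by blast
  qed (use translate_lattice_edge in blast)
  have mem: "z + x \<in> (+) z ` S \<longleftrightarrow> x \<in> S" for x by auto
  have bd: "inner_boundary lattice_edges ((+) z ` S) = (+) z ` inner_boundary lattice_edges S"
  proof (intro equalityI subsetI)
    fix x' assume "x' \<in> inner_boundary lattice_edges ((+) z ` S)"
    then obtain x y' where x: "x \<in> S" "x' = z + x" "y' \<notin> (+) z ` S" "{z + x, y'} \<in> lattice_edges"
      by (auto simp: inner_boundary_def)
    define y where "y = y' - z"
    have "{z + x, y'} = (+) z ` {x, y}" "y' = z + y" by (auto simp: y_def)
    then have "{x, y} \<in> lattice_edges" "y \<notin> S" using x translate_lattice_edge[of z "{x, y}"] by auto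
    then show "x' \<in> (+) z ` inner_boundary lattice_edges S" using x by (auto simp: inner_boundary_def)
  next
    fix x' assume "x' \<in> (+) z ` inner_boundary lattice_edges S"
    then obtain x y where x: "x' = z + x" "x \<in> S" "y \<notin> S" "{x, y} \<in> lattice_edges"
      by (auto simp: inner_boundary_def)
    then have "{z + x, z + y} \<in> lattice_edges" using translate_lattice_edge[of z "{x, y}"] by auto
    then show "x' \<in> inner_boundary lattice_edges ((+) z ` S)"
      using x by (auto simp: inner_boundary_def intro!: exI[of _ "z + y"])
  qed
  have inv: "inv ((+) z) (z + x) = x" for x by (simp add: inv_f_f)
  show ?thesis
    unfolding boundary_correlation_def edges bd
    by (subst sum.reindex) (simp_all add: ising_mean_image[OF bij] inv)
qed

text \<open>\<open>box_edges\<close> contains every lattice edge that meets the box, so what is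
  computed inside \<open>S\<close> does not depend on the box around it.\<close>

lemma box_edges_inside:
  assumes "S \<subseteq> box_lattice N"
  shows "{e \<in> box_edges N. e \<subseteq> S} = {e \<in> lattice_edges. e \<subseteq> S}"
    and "inner_boundary (box_edges N) S = inner_boundary lattice_edges S"
proof -
  have edge: "{x, y} \<in> box_edges N" if "{x, y} \<in> lattice_edges" "x \<in> box_lattice N" for x y
  proof -
    have "\<exists>a b. {x, y} = {a, b} \<and> l1_norm (a - b) = 1" using that(1) by (simp only: lattice_edges_def mem_Collect_eq)
    then obtain a b where ab: "{x, y} = {a, b}" "l1_norm (a - b) = 1" by blast
    then have l1: "l1_norm (x - y) = 1" by (auto simp: doubleton_eq_iff l1_norm_minus_commute)
    then have "y \<in> box_lattice N \<union> outer_boundary N"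
      using that(2) l1_norm_minus_commute[of x y] by (auto simp: outer_boundary_def)
    then show ?thesis using l1 that(2) by (auto simp: box_edges_def)
  qed
  show "{e \<in> box_edges N. e \<subseteq> S} = {e \<in> lattice_edges. e \<subseteq> S}"
  proof (intro equalityI subsetI)
    fix e assume e: "e \<in> {e \<in> lattice_edges. e \<subseteq> S}"
    then obtain x y where "e = {x, y}" by (auto simp: lattice_edges_def)
    then show "e \<in> {e \<in> box_edges N. e \<subseteq> S}" using e edge[of x y] assms by auto
  qed (use box_edges_subset in blast)
  show "inner_boundary (box_edges N) S = inner_boundary lattice_edges S"
    using edge assms box_edges_subset by (fastforce simp: inner_boundary_def)
qed

lemma boundary_correlation_box:
  "S \<subseteq> box_lattice N \<Longrightarrow> boundary_correlation (box_edges N) \<beta> p S = boundary_correlation lattice_edges \<beta> p S"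
  by (simp add: boundary_correlation_def box_edges_inside)

text \<open>Iterates \<open>simon_lieb\<close> with translates of \<open>S\<close>. A step moves
  each coordinate of the site by at most \<open>R\<close>, and \<open>n + j * R \<le> N\<close>
  leaves room for \<open>j\<close> steps from a site of the box of size \<open>n\<close>.\<close>

lemma box_mean_le_power:
  fixes S :: "(int ^ 'd) set" and z :: "int ^ 'd"
  assumes S: "S \<subseteq> box_lattice R" "0 \<in> S" and "\<beta> \<ge> 0"
    and c: "boundary_correlation lattice_edges \<beta> 0 S \<le> c"
  shows "z \<in> box_lattice n \<Longrightarrow> n + j * R \<le> N \<Longrightarrow>
    ising_mean (box_edges N) (box_lattice N) \<beta> (\<lambda>\<sigma>. \<sigma> z) \<le> c ^ j"
proof (induction j arbitrary: z n)
  case 0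
  then show ?case using ising_mean_spin_bounds(2)[OF finite_box_lattice finite_box_edges \<open>\<beta> \<ge> 0\<close>] by simp
next
  case (Suc j)
  let ?E = "box_edges N :: (int ^ 'd) set set" and ?B = "box_lattice N :: (int ^ 'd) set" and ?S = "(+) z ` S"
  let ?m = "\<lambda>x. ising_mean ?E ?B \<beta> (\<lambda>\<sigma>. \<sigma> x)"
  have sub: "?S \<subseteq> box_lattice (n + R)" using Suc.prems(1) S box_lattice_add by blast
  then have subN: "?S \<subseteq> ?B" using Suc.prems(2) box_lattice_mono[of "n + R" N] by auto
  then have fin: "finite ?S" using finite_box_lattice finite_subset by blast
  have nn: "ising_mean {e \<in> ?E. e \<subseteq> ?S} ?S \<beta> (\<lambda>\<sigma>. \<sigma> z * \<sigma> x) \<ge> 0" for x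
    by (rule ising_mean_spin_pair_nonneg[OF fin]) (simp_all add: finite_box_edges assms)
  have "z \<in> ?S" using S(2) by force
  have "?m z \<le> (\<Sum>x\<in>inner_boundary ?E ?S. ising_mean {e \<in> ?E. e \<subseteq> ?S} ?S \<beta> (\<lambda>\<sigma>. \<sigma> z * \<sigma> x) * ?m x)"
    by (rule simon_lieb) (use assms subN \<open>z \<in> ?S\<close> in \<open>auto simp: finite_box_lattice finite_box_edges card_box_edge\<close>)
  also have "\<dots> \<le> (\<Sum>x\<in>inner_boundary ?E ?S. ising_mean {e \<in> ?E. e \<subseteq> ?S} ?S \<beta> (\<lambda>\<sigma>. \<sigma> z * \<sigma> x) * c ^ j)"
  proof (intro sum_mono mult_left_mono nn)
    fix x assume "x \<in> inner_boundary ?E ?S"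
    then have "x \<in> box_lattice (n + R)" using sub by (auto simp: inner_boundary_def)
    then show "?m x \<le> c ^ j" using Suc.IH[of x "n + R"] Suc.prems(2) by simp
  qed
  also have "\<dots> = boundary_correlation ?E \<beta> z ?S * c ^ j"
    by (simp add: boundary_correlation_def sum_distrib_right)
  also have "\<dots> \<le> c * c ^ j"
  proof -
    have eq: "boundary_correlation ?E \<beta> z ?S = boundary_correlation lattice_edges \<beta> 0 S"
      using boundary_correlation_box[OF subN] boundary_correlation_translate[of \<beta> z 0 S] by simp
    have "0 \<le> boundary_correlation ?E \<beta> z ?S"
      unfolding boundary_correlation_def by (intro sum_nonneg nn)
    then show ?thesis using c unfolding eq by (intro mult_right_mono zero_le_power) linarith+
  qed
  finally show ?case by simp
qed

lemma exponential_decay_below_critical: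
  fixes \<beta> :: real
  assumes "\<beta> > 0" "ereal \<beta> < critical_beta TYPE('d::finite)"
  shows "\<exists>C c. C > 0 \<and> c > 0 \<and> (\<forall>N. magnetization \<beta> (\<lambda>_ :: int ^ 'd. 0) 1 N \<le> C * exp (- c * real N))"
proof -
  let ?E = "\<lambda>N. box_edges N :: (int ^ 'd) set set"
  let ?B = "\<lambda>N. box_lattice N :: (int ^ 'd) set"
  obtain \<beta>' where \<beta>': "\<beta> < \<beta>'" "(\<lambda>N. magnetization \<beta>' (\<lambda>_ :: int ^ 'd. 0) 1 N) \<longlonglongrightarrow> 0"
    using assms(2) unfolding critical_beta_def less_Sup_iff by auto
  have "\<exists>t R S. \<beta> \<le> t \<and> S \<subseteq> ?B R \<and> 0 \<in> S \<and> boundary_correlation lattice_edges t 0 S < 1"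
  proof (rule ccontr)
    assume none: "\<not> ?thesis"
    \<comment> \<open>The lower bound is the same for all boxes, so it survives the limit and
      contradicts the choice of \<open>\<beta>'\<close>.\<close>
    have "1 - exp (\<beta> - \<beta>') \<le> magnetization \<beta>' (\<lambda>_ :: int ^ 'd. 0) 1 N" for N
      unfolding magnetization_ising_mean
    proof (rule ising_mean_lower_bound)
      fix t S assume "\<beta> \<le> t" "S \<subseteq> ?B N" "0 \<in> S"
      then show "1 \<le> boundary_correlation (?E N) t 0 S"
        using none boundary_correlation_box[of S N t 0] by fastforce
    qed (use assms \<beta>' in \<open>auto simp: finite_box_lattice finite_box_edges card_box_edge zero_in_box_lattice\<close>)
    then have "1 - exp (\<beta> - \<beta>') \<le> 0" by (intro LIMSEQ_le_const[OF \<beta>'(2)]) auto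
    then show False using \<beta>'(1) by simp
  qed
  then obtain t R0 S where t: "\<beta> \<le> t" and S0: "S \<subseteq> ?B R0" "0 \<in> S" and phi: "boundary_correlation lattice_edges t 0 S < 1"
    by blast
  \<comment> \<open>\<open>R0\<close> may be 0, and \<open>N\<close> is divided by \<open>R\<close>
    below.\<close>
  define R where "R = R0 + 1"
  have S: "S \<subseteq> ?B R" using S0(1) box_lattice_mono[of R0 R] by (auto simp: R_def)
  \<comment> \<open>The maximum with 1/2 keeps \<open>c\<close> positive, so that its logarithm
    gives a finite rate, and still below 1.\<close>
  define c where "c = max (1 / 2) (boundary_correlation lattice_edges t 0 S)"
  have c: "0 < c" "c < 1" "boundary_correlation lattice_edges t 0 S \<le> c" using phi by (auto simp: c_def)
  have "magnetization \<beta> (\<lambda>_ :: int ^ 'd. 0) 1 N \<le> (1 / c) * exp (- (- ln c / R) * real N)" for N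
  proof -
    have "magnetization \<beta> (\<lambda>_ :: int ^ 'd. 0) 1 N \<le> ising_mean (?E N) (?B N) t (\<lambda>\<sigma>. \<sigma> 0)"
      unfolding magnetization_ising_mean
      using assms t by (intro ising_mean_edge_mono) (auto simp: finite_box_lattice finite_box_edges)
    also have "\<dots> \<le> c ^ (N div R)"
      by (rule box_mean_le_power[OF S S0(2) _ c(3), of _ 0]) (use assms t in \<open>auto simp: zero_in_box_lattice\<close>)
    also have "\<dots> = c powr real (N div R)" using c by (simp add: powr_realpow)
    \<comment> \<open>Rounding N / R down loses less than one step, hence the constant 1 /
      c.\<close>
    also have "\<dots> \<le> c powr (real N / R - 1)"
    proof (rule powr_mono')
      have "N mod R < R" by (simp add: R_def)
      then have "real (N mod R) \<le> real R" by simp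
      moreover have "real N = real (N div R) * real R + real (N mod R)"
        by (metis div_mult_mod_eq of_nat_add of_nat_mult)
      ultimately show "real N / R - 1 \<le> real (N div R)" by (simp add: field_simps R_def)
    qed (use c in auto)
    also have "\<dots> = (1 / c) * exp (- (- ln c / R) * real N)"
      using c by (simp add: powr_def exp_diff left_diff_distrib field_simps)
    finally show ?thesis .
  qed
  moreover have "- ln c / R > 0" using c by (simp add: R_def divide_neg_pos)
  moreover have "1 / c > 0" using c by simp
  ultimately show ?thesis by blast
qed

theorem corollary1p6:
  fixes \<beta> :: real
  assumes "CARD('d::finite) \<ge> 2" and "\<beta> > 0"
  shows "\<exists>C1 C2 :: real. C1 > 0 \<and> C2 \<ge> 0
    \<and> (ereal \<beta> \<ge> critical_beta TYPE('d) \<longrightarrow> C2 = 0)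
    \<and> (ereal \<beta> < critical_beta TYPE('d) \<longrightarrow> C2 > 0)
    \<and> (\<forall>(\<omega> :: int ^ 'd \<Rightarrow> ereal) (N :: nat).
         magnetization \<beta> \<omega> 1 N - magnetization \<beta> \<omega> (-1) N
           \<le> magnetization \<beta> (\<lambda>_ :: int ^ 'd. 0) 1 N - magnetization \<beta> (\<lambda>_ :: int ^ 'd. 0) (-1) N
       \<and> magnetization \<beta> (\<lambda>_ :: int ^ 'd. 0) 1 N - magnetization \<beta> (\<lambda>_ :: int ^ 'd. 0) (-1) N
           \<le> C1 * exp (- C2 * real N))"
proof -
  have influence: "magnetization \<beta> \<omega> 1 N - magnetization \<beta> \<omega> (-1) N
    \<le> magnetization \<beta> (\<lambda>_ :: int ^ 'd. 0) 1 N - magnetization \<beta> (\<lambda>_ :: int ^ 'd. 0) (-1) N" for \<omega> :: "int ^ 'd \<Rightarrow> ereal" and N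
    using assms(2) by (intro boundary_influence_le) simp
  \<comment> \<open>The global flip gives the factor 2, which is the origin of the constants
    \<open>2 * C\<close> and 2 below.\<close>
  have twice: "magnetization \<beta> (\<lambda>_ :: int ^ 'd. 0) 1 N - magnetization \<beta> (\<lambda>_ :: int ^ 'd. 0) (-1) N
    = 2 * magnetization \<beta> (\<lambda>_ :: int ^ 'd. 0) 1 N" for N
    by (simp add: magnetization_minus)
  show ?thesis
  proof (cases "ereal \<beta> < critical_beta TYPE('d)")
    case True
    then obtain C c where "C > 0" "c > 0" and "\<And>N. magnetization \<beta> (\<lambda>_ :: int ^ 'd. 0) 1 N \<le> C * exp (- c * real N)"
      using exponential_decay_below_critical assms(2) by blast
    then show ?thesis
      using True influence by (intro exI[of _ "2 * C"] exI[of _ c]) (auto simp: twice)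
  next
    case False
    have "magnetization \<beta> (\<lambda>_ :: int ^ 'd. 0) 1 N \<le> 1" for N
      unfolding magnetization_ising_mean using assms(2)
      by (intro ising_mean_spin_bounds(2)) (auto simp: finite_box_lattice finite_box_edges)
    then show ?thesis
      using False influence by (intro exI[of _ 2] exI[of _ 0]) (auto simp: twice)
  qed
qed

end
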